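(* Let $\ell\ge1$ be an integer, $\varphi(\xi)=1-\cos(2\pi\xi)$, $\omega=\varphi(1/(2\ell))$ and $\Omega=\varphi^{-1}([0,\omega])=[-\frac1{2\ell},\frac1{2\ell}]\subset\mathbb{T}$. Let $(\lambda_j)_{j\in\mathbb{N}}$ be a uniformly separated sequence in the open unit disc, $s:\mathbb{N}\to\mathbb{Z}$ a bijection, and $$e_j(\xi)=\sqrt{\ell}\,\chi_\Omega(\xi)\,e^{2\pi i\ell s(j)\xi},\qquad j\ge0,$$ the corresponding orthonormal basis of $L^2(\Omega)$. Let $Tg=\sum_{j=0}^\infty\lambda_j\langle g,e_j\rangle e_j$ (for $g\in L^2(\mathbb{T})$), and let $a\in L^2(\Omega)$ satisfy $|\langle a,e_j\rangle|^2\sim1-|\lambda_j|^2$. Set $R=\mathcal{F}^{-1}T\mathcal{F}$. Then: 1. $R$ is a bounded operator on $\ell^2(\mathbb{Z})$ and $R(GPW_\omega(\mathbb{Z}))\subset GPW_\omega(\mathbb{Z})$. 2. For every $f\in GPW_\omega(\mathbb{Z})$, $$(Rf)(k)=\sum_{j=0}^\infty\lambda_j\,f(\ell s(j))\,\operatorname{sinc}\Bigl(\frac{k}{\ell}-s(j)\Bigr),\qquad k\in\mathbb{Z},$$ with convergence in $\ell^2(\mathbb{Z})$. 3. With $f_0=\mathcal{F}^{-1}a$, the sequence $\{R^nf_0\}_{n\ge0}$ is a frame for $GPW_\omega(\mathbb{Z})$.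
   Context: $\mathbb{N}=\{0,1,2,\dots\}$. $\operatorname{sinc}(x)=\frac{\sin(\pi x)}{\pi x}$ for $x\ne0$, $\operatorname{sinc}(0)=1$. $\mathbb{T}$ is identified with $[-1/2,1/2)$ with addition modulo $1$ and Lebesgue measure. $\mathcal{F}:\ell^2(\mathbb{Z})\to L^2(\mathbb{T})$ is the unitary Fourier transform $\mathcal{F}f(\xi)=\sum_{k\in\mathbb{Z}}f(k)e^{2\pi ik\xi}$. $\chi_\Omega$ is the characteristic function of $\Omega$ and $L^2(\Omega)=\{g\in L^2(\mathbb{T}):g=0\text{ a.e. on }\mathbb{T}\setminus\Omega\}$. The Graph Paley--Wiener space $GPW_\omega(\mathbb{Z})$ is the spectral subspace, corresponding to $[0,\omega]$, of the normalized Laplacian $\mathcal{L}f(n)=\frac12(2f(n)-f(n+1)-f(n-1))$ on $\ell^2(\mathbb{Z})$; equivalently $GPW_\omega(\mathbb{Z})=\{f\in\ell^2(\mathbb{Z}):\mathcal{F}f\in L^2(\Omega)\}$. A sequence $(\lambda_j)_{j\in\mathbb{N}}$ in the open unit disc is uniformly separated if $\inf_{j}\prod_{k\ne j}\left|\frac{\lambda_j-\lambda_k}{1-\overline{\lambda_k}\lambda_j}\right|>0$. For nonnegative sequences, $a_j\sim b_j$ means there exist $c,C>0$ with $c\,a_j\le b_j\le C\,a_j$ for all $j$. A sequence $(f_n)$ in a Hilbert space $\mathcal{H}$ is a frame for $\mathcal{H}$ if there are $A,B>0$ with $A\|f\|^2\le\sum_n|\langle f,f_n\rangle|^2\le B\|f\|^2$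 for all $f\in\mathcal{H}$. *)

theory Defs
  imports "HOL-Analysis.Analysis"
begin

section \<open>Complex inner product spaces\<close>

text \<open>
  The real inner product, the norm and the topology are those of the class
  \<^class>\<open>real_inner\<close>; the complex inner product is linear in its first argument.
\<close>

class complex_inner = real_inner +
  fixes scaleC :: "complex \<Rightarrow> 'a \<Rightarrow> 'a"  (infixr "*\<^sub>C" 75)
    and cinner :: "'a \<Rightarrow> 'a \<Rightarrow> complex"
  assumes scaleC_add_right: "c *\<^sub>C (x + y) = c *\<^sub>C x + c *\<^sub>C y"
    and scaleC_add_left: "(c + d) *\<^sub>C x = c *\<^sub>C x + d *\<^sub>C x"
    and scaleC_scaleC: "c *\<^sub>C d *\<^sub>C x = (c * d) *\<^sub>C x"
    and scaleR_eq_scaleC: "r *\<^sub>R x = complex_of_real r *\<^sub>C x"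
    and cinner_add_left: "cinner (x + y) z = cinner x z + cinner y z"
    and cinner_scaleC_left: "cinner (c *\<^sub>C x) y = c * cinner x y"
    and cinner_commute: "cinner x y = cnj (cinner y x)"
    and inner_eq_Re_cinner: "inner x y = Re (cinner x y)"

definition bounded_clinear :: "('a::complex_inner \<Rightarrow> 'b::complex_inner) \<Rightarrow> bool" where
  "bounded_clinear A \<longleftrightarrow> bounded_linear A \<and> (\<forall>c x. A (c *\<^sub>C x) = c *\<^sub>C A x)"

definition is_frame :: "'a::complex_inner set \<Rightarrow> (nat \<Rightarrow> 'a) \<Rightarrow> bool" where
  "is_frame H v \<longleftrightarrow> (\<forall>n. v n \<in> H) \<and>
     (\<exists>A>0. \<exists>B>0. \<forall>x\<in>H. summable (\<lambda>n. (cmod (cinner x (v n)))\<^sup>2) \<and>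
        A * (norm x)\<^sup>2 \<le> (\<Sum>n. (cmod (cinner x (v n)))\<^sup>2) \<and>
        (\<Sum>n. (cmod (cinner x (v n)))\<^sup>2) \<le> B * (norm x)\<^sup>2)"

definition orthogonal_projection :: "('a::complex_inner \<Rightarrow> 'a) \<Rightarrow> bool" where
  "orthogonal_projection P \<longleftrightarrow> bounded_clinear P \<and> (\<forall>x. P (P x) = P x) \<and>
     (\<forall>x y. cinner (P x) y = cinner x (P y))"

definition projection_valued_measure :: "(real set \<Rightarrow> 'a::complex_inner \<Rightarrow> 'a) \<Rightarrow> bool" where
  "projection_valued_measure E \<longleftrightarrow>
     (\<forall>B\<in>sets borel. orthogonal_projection (E B)) \<and>
     (\<forall>x. E UNIV x = x) \<and>
     (\<forall>B\<in>sets borel. \<forall>C\<in>sets borel. \<forall>x. E (B \<inter> C) x = E B (E C x)) \<and>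
     (\<forall>B::nat \<Rightarrow> real set. range B \<subseteq> sets borel \<longrightarrow> disjoint_family B \<longrightarrow>
        (\<forall>x. (\<lambda>n. E (B n) x) sums E (\<Union>n. B n) x))"

definition scalar_measure :: "(real set \<Rightarrow> 'a::complex_inner \<Rightarrow> 'a) \<Rightarrow> 'a \<Rightarrow> real measure" where
  "scalar_measure E x = measure_of UNIV (sets borel) (\<lambda>B. ennreal ((norm (E B x))\<^sup>2))"

text \<open>
  For an everywhere defined self-adjoint operator \<open>A\<close>: \<open>A = \<integral>t dE(t)\<close> in the weak sense, i.e.
  \<open>\<langle>A x, x\<rangle> = \<integral>t d\<langle>E(t) x, x\<rangle>\<close> for every \<open>x\<close>; by polarization these diagonal values
  determine \<open>A\<close>.
\<close>

definition is_spectral_measure ::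
    "('a::complex_inner \<Rightarrow> 'a) \<Rightarrow> (real set \<Rightarrow> 'a \<Rightarrow> 'a) \<Rightarrow> bool" where
  "is_spectral_measure A E \<longleftrightarrow> projection_valued_measure E \<and>
     (\<forall>x. integrable (scalar_measure E x) (\<lambda>t. t) \<and>
          cinner (A x) x = complex_of_real (LINT t|scalar_measure E x. t))"

definition spectral_subspace :: "('a::complex_inner \<Rightarrow> 'a) \<Rightarrow> real set \<Rightarrow> 'a set" where
  "spectral_subspace A B = range ((SOME E. is_spectral_measure A E) B)"


section \<open>The Hilbert space of square summable functions on the integers\<close>

definition square_summable :: "(int \<Rightarrow> complex) \<Rightarrow> bool" where
  "square_summable f \<longleftrightarrow> (\<lambda>k. (cmod (f k))\<^sup>2) summable_on UNIV"

lemma cmod_add_sq_le: "(cmod (a + b))\<^sup>2 \<le> 2 * (cmod a)\<^sup>2 + 2 * (cmod b)\<^sup>2"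
proof -
  have "(cmod (a + b))\<^sup>2 \<le> (cmod a + cmod b)\<^sup>2"
    by (intro power_mono norm_triangle_ineq) auto
  also have "\<dots> \<le> 2 * (cmod a)\<^sup>2 + 2 * (cmod b)\<^sup>2"
    using sum_squares_bound[of "cmod a" "cmod b"] by (simp add: power2_sum)
  finally show ?thesis .
qed

lemma cmod_mult_cnj_le: "cmod (a * cnj b) \<le> (cmod a)\<^sup>2 + (cmod b)\<^sup>2"
proof -
  have "0 \<le> cmod a * cmod b" by simp
  then show ?thesis
    using sum_squares_bound[of "cmod a" "cmod b"] unfolding norm_mult complex_mod_cnj by linarith
qed

lemma square_summable_zero: "square_summable (\<lambda>_. 0)"
  by (simp add: square_summable_def)

lemma square_summable_add:
  assumes "square_summable f" "square_summable g"
  shows "square_summable (\<lambda>k. f k + g k)"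
  unfolding square_summable_def
proof (rule summable_on_comparison_test)
  show "(\<lambda>k. 2 * (cmod (f k))\<^sup>2 + 2 * (cmod (g k))\<^sup>2) summable_on UNIV"
    using assms unfolding square_summable_def
    by (intro summable_on_add summable_on_cmult_right)
qed (auto intro: cmod_add_sq_le)

lemma square_summable_scale:
  assumes "square_summable f"
  shows "square_summable (\<lambda>k. c * f k)"
  using assms unfolding square_summable_def norm_mult power_mult_distrib
  by (intro summable_on_cmult_right)

lemma square_summable_translate:
  assumes "square_summable f"
  shows "square_summable (\<lambda>k. f (k + m))"
proof -
  have "bij_betw (\<lambda>k::int. k + m) UNIV UNIV"
    by (rule bij_betw_byWitness[where f' = "\<lambda>k. k - m"]) auto
  from summable_on_reindex_bij_betw[OF this, of "\<lambda>k. (cmod (f k))\<^sup>2"]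
  show ?thesis using assms by (simp add: square_summable_def)
qed

lemma square_summable_mult_cnj:
  assumes "square_summable f" "square_summable g"
  shows "(\<lambda>k. f k * cnj (g k)) summable_on UNIV"
proof (rule abs_summable_summable, rule summable_on_comparison_test)
  show "(\<lambda>k. (cmod (f k))\<^sup>2 + (cmod (g k))\<^sup>2) summable_on UNIV"
    using assms unfolding square_summable_def by (rule summable_on_add)
qed (auto intro: cmod_mult_cnj_le)

typedef ell2 = "{f. square_summable f}"
  morphisms ell2_apply ell2_of
  using square_summable_zero by blast

setup_lifting type_definition_ell2

instantiation ell2 :: complex_inner
begin

lift_definition zero_ell2 :: ell2 is "\<lambda>_. 0"
  by (rule square_summable_zero)
lift_definition plus_ell2 :: "ell2 \<Rightarrow> ell2 \<Rightarrow> ell2" is "\<lambda>f g k. f k + g k"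
  by (rule square_summable_add)
lift_definition uminus_ell2 :: "ell2 \<Rightarrow> ell2" is "\<lambda>f k. - f k"
  by (simp add: square_summable_def)
lift_definition scaleC_ell2 :: "complex \<Rightarrow> ell2 \<Rightarrow> ell2" is "\<lambda>c f k. c * f k"
  by (rule square_summable_scale)
lift_definition cinner_ell2 :: "ell2 \<Rightarrow> ell2 \<Rightarrow> complex"
  is "\<lambda>f g. \<Sum>\<^sub>\<infinity>k. f k * cnj (g k)" .

definition minus_ell2_def: "(f :: ell2) - g = f + (- g)"
definition scaleR_ell2_def: "r *\<^sub>R (f :: ell2) = complex_of_real r *\<^sub>C f"
definition inner_ell2_def: "inner (f :: ell2) g = Re (cinner f g)"
definition norm_ell2_def: "norm (f :: ell2) = sqrt (inner f f)"
definition sgn_ell2_def: "sgn (f :: ell2) = inverse (norm f) *\<^sub>R f"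
definition dist_ell2_def: "dist (f :: ell2) g = norm (f - g)"
definition uniformity_ell2_def:
  "(uniformity :: (ell2 \<times> ell2) filter) = (INF e\<in>{0<..}. principal {(x, y). dist x y < e})"
definition open_ell2_def:
  "open (U :: ell2 set) \<longleftrightarrow> (\<forall>x\<in>U. eventually (\<lambda>(x', y). x' = x \<longrightarrow> y \<in> U) uniformity)"

instance
proof
  fix x y z :: ell2 and c d :: complex and a b :: real
  show "x + y + z = x + (y + z)" by transfer (simp add: add.assoc)
  show "x + y = y + x" by transfer (simp add: add.commute)
  show "0 + x = x" by transfer simp
  show "- x + x = 0" by transfer simp
  show "x - y = x + - y" by (simp add: minus_ell2_def)
  show C1: "c *\<^sub>C (x + y) = c *\<^sub>C x + c *\<^sub>C y" for c :: complex and x y :: ell2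
    by transfer (simp add: distrib_left)
  show C2: "(c + d) *\<^sub>C x = c *\<^sub>C x + d *\<^sub>C x" for c d :: complex and x :: ell2
    by transfer (simp add: distrib_right)
  show C3: "c *\<^sub>C d *\<^sub>C x = (c * d) *\<^sub>C x" for c d :: complex and x :: ell2
    by transfer (simp add: mult.assoc)
  show "a *\<^sub>R x = complex_of_real a *\<^sub>C x" by (simp add: scaleR_ell2_def)
  show "a *\<^sub>R (x + y) = a *\<^sub>R x + a *\<^sub>R y" by (simp add: scaleR_ell2_def C1)
  show "(a + b) *\<^sub>R x = a *\<^sub>R x + b *\<^sub>R x" by (simp add: scaleR_ell2_def C2)
  show "a *\<^sub>R b *\<^sub>R x = (a * b) *\<^sub>R x" by (simp add: scaleR_ell2_def C3)
  show "1 *\<^sub>R x = x" unfolding scaleR_ell2_def by transfer simp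
  show add: "cinner (x + y) z = cinner x z + cinner y z" for x y z :: ell2
    by transfer (simp add: distrib_right infsum_add square_summable_mult_cnj)
  show scale: "cinner (c *\<^sub>C x) y = c * cinner x y" for c and x y :: ell2
    by transfer (simp add: mult.assoc infsum_cmult_right')
  show comm: "cinner x y = cnj (cinner y x)" for x y :: ell2
    by transfer (simp flip: infsum_cnj add: mult.commute)
  show "inner x y = Re (cinner x y)" by (simp add: inner_ell2_def)
  show "inner x y = inner y x" using comm[of x y] by (simp add: inner_ell2_def)
  show "inner (x + y) z = inner x z + inner y z" by (simp add: inner_ell2_def add)
  show "inner (a *\<^sub>R x) y = a * inner x y" by (simp add: inner_ell2_def scaleR_ell2_def scale)
  have self: "inner x x = (\<Sum>\<^sub>\<infinity>k. (cmod (ell2_apply x k))\<^sup>2)"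
  proof -
    have "(\<lambda>k. ell2_apply x k * cnj (ell2_apply x k)) summable_on UNIV"
      using ell2_apply[of x] by (intro square_summable_mult_cnj) auto
    from infsum_Re[OF this] show ?thesis
      by (simp add: inner_ell2_def cinner_ell2.rep_eq flip: complex_norm_square)
  qed
  show "0 \<le> inner x x" unfolding self by (intro infsum_nonneg) simp
  show "inner x x = 0 \<longleftrightarrow> x = 0"
  proof
    assume "inner x x = 0"
    moreover have "(\<lambda>k. (cmod (ell2_apply x k))\<^sup>2) summable_on UNIV"
      using ell2_apply[of x] by (simp add: square_summable_def)
    ultimately have "(cmod (ell2_apply x k))\<^sup>2 = 0" for k
      using nonneg_infsum_le_0D[of "\<lambda>k. (cmod (ell2_apply x k))\<^sup>2" UNIV k] by (simp add: self)
    then show "x = 0" by transfer auto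
  next
    assume "x = 0"
    then show "inner x x = 0" unfolding self by (simp add: zero_ell2.rep_eq)
  qed
  show "norm x = sqrt (inner x x)" by (simp add: norm_ell2_def)
  show "sgn x = inverse (norm x) *\<^sub>R x" by (simp add: sgn_ell2_def)
  show "dist x y = norm (x - y)" by (simp add: dist_ell2_def)
  show "uniformity = (INF e\<in>{0<..}. principal {(x, y :: ell2). dist x y < e})"
    by (simp add: uniformity_ell2_def)
  show "open U \<longleftrightarrow> (\<forall>x\<in>U. eventually (\<lambda>(x', y). x' = x \<longrightarrow> y \<in> U) uniformity)"
    for U :: "ell2 set" by (simp add: open_ell2_def)
qed

end


section \<open>The space of square integrable functions on the circle, modulo null sets\<close>

definition circle :: "real measure" where
  "circle = lebesgue_on {-1/2..<1/2}"

definition square_integrable :: "(real \<Rightarrow> complex) \<Rightarrow> bool" where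
  "square_integrable g \<longleftrightarrow>
     g \<in> borel_measurable circle \<and> integrable circle (\<lambda>x. (cmod (g x))\<^sup>2)"

lemma finite_measure_circle: "finite_measure circle"
  unfolding circle_def by (intro finite_measure_lebesgue_on bounded_set_imp_lmeasurable) auto

lemma square_integrable_bounded:
  assumes [measurable]: "g \<in> borel_measurable circle" and "\<And>x. cmod (g x) \<le> K"
  shows "square_integrable g"
  unfolding square_integrable_def
proof
  show "integrable circle (\<lambda>x. (cmod (g x))\<^sup>2)"
    by (rule finite_measure.integrable_const_bound[OF finite_measure_circle, where B = "K\<^sup>2"])
      (auto intro!: power_mono assms(2))
qed fact

lemma borel_measurable_circle:
  "g \<in> borel_measurable borel \<Longrightarrow> g \<in> borel_measurable circle"
  unfolding circle_def by (intro measurable_restrict_space1 measurable_completion) simp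

lemma square_integrable_zero: "square_integrable (\<lambda>_. 0)"
  by (rule square_integrable_bounded[where K = 0]) auto

lemma square_integrable_add:
  assumes "square_integrable f" "square_integrable g"
  shows "square_integrable (\<lambda>x. f x + g x)"
proof -
  have [measurable]: "f \<in> borel_measurable circle" "g \<in> borel_measurable circle"
    using assms by (auto simp: square_integrable_def)
  have "integrable circle (\<lambda>x. 2 * (cmod (f x))\<^sup>2 + 2 * (cmod (g x))\<^sup>2)"
    using assms by (auto simp: square_integrable_def)
  then have "integrable circle (\<lambda>x. (cmod (f x + g x))\<^sup>2)"
    by (rule Bochner_Integration.integrable_bound) (auto intro!: AE_I2 order.trans[OF cmod_add_sq_le])
  then show ?thesis by (simp add: square_integrable_def)
qed

lemma square_integrable_scale:
  "square_integrable f \<Longrightarrow> square_integrable (\<lambda>x. c * f x)"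
  by (auto simp: square_integrable_def norm_mult power_mult_distrib)

lemma square_integrable_mult_cnj:
  assumes "square_integrable f" "square_integrable g"
  shows "integrable circle (\<lambda>x. f x * cnj (g x))"
proof -
  have [measurable]: "f \<in> borel_measurable circle" "g \<in> borel_measurable circle"
    using assms by (auto simp: square_integrable_def)
  have [measurable]: "(\<lambda>x. cnj (g x)) \<in> borel_measurable circle"
    by (rule borel_measurable_continuous_on[OF continuous_on_cnj]) (auto intro: continuous_intros)
  have "integrable circle (\<lambda>x. (cmod (f x))\<^sup>2 + (cmod (g x))\<^sup>2)"
    using assms by (auto simp: square_integrable_def)
  then show ?thesis
    by (rule Bochner_Integration.integrable_bound)
      (use cmod_mult_cnj_le in \<open>auto intro!: AE_I2 simp: norm_mult\<close>)
qed

definition circle_ae_eq :: "(real \<Rightarrow> complex) \<Rightarrow> (real \<Rightarrow> complex) \<Rightarrow> bool" where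
  "circle_ae_eq f g \<longleftrightarrow>
     square_integrable f \<and> square_integrable g \<and> (AE x in circle. f x = g x)"

quotient_type L2_circle = "real \<Rightarrow> complex" / partial: circle_ae_eq
  morphisms rep_L2_circle L2_of
proof (rule part_equivpI)
  show "\<exists>f. circle_ae_eq f f"
    using square_integrable_zero by (auto simp: circle_ae_eq_def)
  show "symp circle_ae_eq"
    by (auto simp: circle_ae_eq_def symp_def)
  show "transp circle_ae_eq"
    unfolding circle_ae_eq_def transp_def by auto
qed

lemma integral_mult_cnj_cong:
  assumes "circle_ae_eq f f'" "circle_ae_eq g g'"
  shows "(LINT x|circle. f x * cnj (g x)) = (LINT x|circle. f' x * cnj (g' x))"
proof (rule integral_cong_AE)
  show "AE x in circle. f x * cnj (g x) = f' x * cnj (g' x)"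
    using assms by (auto simp: circle_ae_eq_def)
qed (use assms square_integrable_mult_cnj in \<open>auto simp: circle_ae_eq_def\<close>)

instantiation L2_circle :: complex_inner
begin

lift_definition zero_L2_circle :: L2_circle is "\<lambda>_. 0"
  by (simp add: circle_ae_eq_def square_integrable_zero)
lift_definition plus_L2_circle :: "L2_circle \<Rightarrow> L2_circle \<Rightarrow> L2_circle" is "\<lambda>f g x. f x + g x"
  by (auto simp: circle_ae_eq_def square_integrable_add)
lift_definition uminus_L2_circle :: "L2_circle \<Rightarrow> L2_circle" is "\<lambda>f x. - f x"
  by (auto simp: circle_ae_eq_def square_integrable_def)
lift_definition scaleC_L2_circle :: "complex \<Rightarrow> L2_circle \<Rightarrow> L2_circle" is "\<lambda>c f x. c * f x"
  by (auto simp: circle_ae_eq_def square_integrable_scale)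
lift_definition cinner_L2_circle :: "L2_circle \<Rightarrow> L2_circle \<Rightarrow> complex"
  is "\<lambda>f g. LINT x|circle. f x * cnj (g x)"
  by (rule integral_mult_cnj_cong)

definition minus_L2_circle_def: "(f :: L2_circle) - g = f + (- g)"
definition scaleR_L2_circle_def: "r *\<^sub>R (f :: L2_circle) = complex_of_real r *\<^sub>C f"
definition inner_L2_circle_def: "inner (f :: L2_circle) g = Re (cinner f g)"
definition norm_L2_circle_def: "norm (f :: L2_circle) = sqrt (inner f f)"
definition sgn_L2_circle_def: "sgn (f :: L2_circle) = inverse (norm f) *\<^sub>R f"
definition dist_L2_circle_def: "dist (f :: L2_circle) g = norm (f - g)"
definition uniformity_L2_circle_def:
  "(uniformity :: (L2_circle \<times> L2_circle) filter) = (INF e\<in>{0<..}. principal {(x, y). dist x y < e})"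
definition open_L2_circle_def:
  "open (U :: L2_circle set) \<longleftrightarrow> (\<forall>x\<in>U. eventually (\<lambda>(x', y). x' = x \<longrightarrow> y \<in> U) uniformity)"

instance
proof
  fix x y z :: L2_circle and c d :: complex and a b :: real
  note S = circle_ae_eq_def square_integrable_add square_integrable_scale square_integrable_zero
  show "x + y + z = x + (y + z)" by transfer (simp add: S add.assoc)
  show "x + y = y + x" by transfer (simp add: S add.commute)
  show "0 + x = x" by transfer (simp add: S)
  show "- x + x = 0" by transfer (simp add: S)
  show "x - y = x + - y" by (simp add: minus_L2_circle_def)
  show C1: "c *\<^sub>C (x + y) = c *\<^sub>C x + c *\<^sub>C y" for c :: complex and x y :: L2_circle
    by transfer (auto simp: S distrib_left)
  show C2: "(c + d) *\<^sub>C x = c *\<^sub>C x + d *\<^sub>C x" for c d :: complex and x :: L2_circle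
    by transfer (auto simp: S distrib_right)
  show C3: "c *\<^sub>C d *\<^sub>C x = (c * d) *\<^sub>C x" for c d :: complex and x :: L2_circle
    by transfer (auto simp: S mult.assoc)
  show "a *\<^sub>R x = complex_of_real a *\<^sub>C x" by (simp add: scaleR_L2_circle_def)
  show "a *\<^sub>R (x + y) = a *\<^sub>R x + a *\<^sub>R y" by (simp add: scaleR_L2_circle_def C1)
  show "(a + b) *\<^sub>R x = a *\<^sub>R x + b *\<^sub>R x" by (simp add: scaleR_L2_circle_def C2)
  show "a *\<^sub>R b *\<^sub>R x = (a * b) *\<^sub>R x" by (simp add: scaleR_L2_circle_def C3)
  show "1 *\<^sub>R x = x" unfolding scaleR_L2_circle_def by transfer (simp add: S)
  show add: "cinner (x + y) z = cinner x z + cinner y z" for x y z :: L2_circle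
    by transfer (simp add: circle_ae_eq_def distrib_right square_integrable_mult_cnj)
  show scale: "cinner (c *\<^sub>C x) y = c * cinner x y" for c and x y :: L2_circle
    by transfer (simp add: mult.assoc)
  show comm: "cinner x y = cnj (cinner y x)" for x y :: L2_circle
    by transfer (subst Bochner_Integration.integral_cnj[symmetric], simp add: mult.commute)
  show "inner x y = Re (cinner x y)" by (simp add: inner_L2_circle_def)
  show "inner x y = inner y x"
    using comm[of x y] by (simp add: inner_L2_circle_def)
  show "inner (x + y) z = inner x z + inner y z" by (simp add: inner_L2_circle_def add)
  show "inner (a *\<^sub>R x) y = a * inner x y"
    by (simp add: inner_L2_circle_def scaleR_L2_circle_def scale)
  have self: "Re (LINT t|circle. f t * cnj (f t)) = (LINT t|circle. (cmod (f t))\<^sup>2)" for f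
    by (simp flip: complex_norm_square of_real_power)
  show "0 \<le> inner x x"
    unfolding inner_L2_circle_def by transfer (simp only: self, simp)
  show "inner x x = 0 \<longleftrightarrow> x = 0"
    unfolding inner_L2_circle_def
    by transfer (simp only: self, auto simp: circle_ae_eq_def square_integrable_def
        integral_nonneg_eq_0_iff_AE)
  show "norm x = sqrt (inner x x)" by (simp add: norm_L2_circle_def)
  show "sgn x = inverse (norm x) *\<^sub>R x" by (simp add: sgn_L2_circle_def)
  show "dist x y = norm (x - y)" by (simp add: dist_L2_circle_def)
  show "uniformity = (INF e\<in>{0<..}. principal {(x, y :: L2_circle). dist x y < e})"
    by (simp add: uniformity_L2_circle_def)
  show "open U \<longleftrightarrow> (\<forall>x\<in>U. eventually (\<lambda>(x', y). x' = x \<longrightarrow> y \<in> U) uniformity)"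
    for U :: "L2_circle set" by (simp add: open_L2_circle_def)
qed

end

lift_definition zero_outside :: "real set \<Rightarrow> L2_circle \<Rightarrow> bool"
  is "\<lambda>S g. AE x in circle. x \<notin> S \<longrightarrow> g x = 0"
  by (auto simp: circle_ae_eq_def)

definition L2_on :: "real set \<Rightarrow> L2_circle set" where
  "L2_on S = {g. zero_outside S g}"


section \<open>Fourier transform, Laplacian and Graph Paley-Wiener space\<close>

lift_definition character :: "int \<Rightarrow> L2_circle"
  is "\<lambda>k \<xi>. exp (2 * complex_of_real pi * \<i> * of_int k * complex_of_real \<xi>)"
  unfolding circle_ae_eq_def
  by (auto intro!: square_integrable_bounded[where K = 1] borel_measurable_circle
      borel_measurable_continuous_onI continuous_intros simp: norm_exp_eq_Re)

definition fourier :: "ell2 \<Rightarrow> L2_circle" where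
  "fourier f = (\<Sum>\<^sub>\<infinity>k. ell2_apply f k *\<^sub>C character k)"

lift_definition laplacian :: "ell2 \<Rightarrow> ell2"
  is "\<lambda>f n. 1/2 * (2 * f n - f (n + 1) - f (n - 1))"
proof -
  fix f :: "int \<Rightarrow> complex" assume "square_summable f"
  then have "square_summable
      (\<lambda>n. 1/2 * ((2 * f n + (-1) * f (n + 1)) + (-1) * f (n + (-1))))"
    by (intro square_summable_scale square_summable_add square_summable_translate)
  then show "square_summable (\<lambda>n. 1/2 * (2 * f n - f (n + 1) - f (n - 1)))"
    by simp
qed

definition GPW :: "real \<Rightarrow> ell2 set" where
  "GPW \<omega> = spectral_subspace laplacian {0..\<omega>}"


section \<open>The frequency band and its orthonormal basis\<close>

definition \<phi> :: "real \<Rightarrow> real" where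
  "\<phi> \<xi> = 1 - cos (2 * pi * \<xi>)"

definition band_limit :: "nat \<Rightarrow> real" where
  "band_limit l = \<phi> (1 / (2 * real l))"

definition band :: "nat \<Rightarrow> real set" where
  "band l = {\<xi> \<in> {-1/2..<1/2}. \<phi> \<xi> \<in> {0..band_limit l}}"

text \<open>
  For \<open>l = 1\<close> the right end point is the point \<open>1/2 = -1/2\<close> of the circle, which the
  fundamental domain lists as \<open>-1/2\<close> only.
\<close>

lemma band_eq:
  assumes "l \<ge> 1"
  shows "band l = {- 1 / (2 * real l)..1 / (2 * real l)} \<inter> {-1/2..<1/2}"
proof -
  have "\<phi> \<xi> \<in> {0..band_limit l} \<longleftrightarrow> \<bar>\<xi>\<bar> \<le> 1 / (2 * real l)" if "\<xi> \<in> {-1/2..<1/2}" for \<xi>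
  proof -
    have xi: "\<bar>\<xi>\<bar> \<le> 1 / 2" using that by auto
    have l: "1 / (2 * real l) \<le> 1 / 2" using assms by (simp add: field_simps)
    have "\<phi> \<xi> \<le> band_limit l \<longleftrightarrow> cos (2 * pi * (1 / (2 * real l))) \<le> cos (2 * pi * \<bar>\<xi>\<bar>)"
      by (cases "\<xi> \<ge> 0") (auto simp: \<phi>_def band_limit_def)
    also have "\<dots> \<longleftrightarrow> 2 * pi * \<bar>\<xi>\<bar> \<le> 2 * pi * (1 / (2 * real l))"
    proof (rule cos_mono_le_eq)
      show "2 * pi * \<bar>\<xi>\<bar> \<le> pi" using mult_left_mono[OF xi, of "2 * pi"] by simp
      show "2 * pi * (1 / (2 * real l)) \<le> pi" using mult_left_mono[OF l, of "2 * pi"] by simp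
    qed auto
    also have "\<dots> \<longleftrightarrow> \<bar>\<xi>\<bar> \<le> 1 / (2 * real l)" by (subst mult_le_cancel_left_pos) auto
    finally show ?thesis by (simp add: \<phi>_def)
  qed
  then have "band l = {\<xi> \<in> {-1/2..<1/2}. \<bar>\<xi>\<bar> \<le> 1 / (2 * real l)}"
    unfolding band_def by (intro Collect_cong) blast
  moreover have "\<bar>\<xi>\<bar> \<le> 1 / (2 * real l) \<longleftrightarrow> \<xi> \<in> {- 1 / (2 * real l)..1 / (2 * real l)}" for \<xi>
    unfolding abs_le_iff atLeastAtMost_iff by linarith
  ultimately show ?thesis by blast
qed

lemma band_borel [measurable]: "band l \<in> sets borel"
proof -
  have [measurable]: "\<phi> \<in> borel_measurable borel"
    unfolding \<phi>_def by measurable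
  have "band l = {-1/2..<1/2} \<inter> \<phi> -` {0..band_limit l}"
    by (auto simp: band_def)
  then show ?thesis
    by (simp add: measurable_sets_borel[of \<phi> borel] sets.Int)
qed

lift_definition band_basis :: "nat \<Rightarrow> int \<Rightarrow> L2_circle"
  is "\<lambda>l m \<xi>. complex_of_real (sqrt (real l)) * indicator (band l) \<xi> *
        exp (2 * complex_of_real pi * \<i> * of_nat l * of_int m * complex_of_real \<xi>)"
proof -
  fix l m
  have [measurable]: "(\<lambda>\<xi>. exp (2 * complex_of_real pi * \<i> * of_nat l * of_int m * complex_of_real \<xi>))
      \<in> borel_measurable borel"
    by (intro borel_measurable_continuous_onI continuous_intros)
  show "circle_ae_eq
     (\<lambda>\<xi>. complex_of_real (sqrt (real l)) * indicator (band l) \<xi> *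
        exp (2 * complex_of_real pi * \<i> * of_nat l * of_int m * complex_of_real \<xi>))
     (\<lambda>\<xi>. complex_of_real (sqrt (real l)) * indicator (band l) \<xi> *
        exp (2 * complex_of_real pi * \<i> * of_nat l * of_int m * complex_of_real \<xi>))"
    unfolding circle_ae_eq_def
    by (auto intro!: square_integrable_bounded[where K = "sqrt (real l)"] borel_measurable_circle
        simp: norm_mult indicator_def)
qed


section \<open>Sequences\<close>

definition sinc :: "real \<Rightarrow> real" where
  "sinc x = (if x = 0 then 1 else sin (pi * x) / (pi * x))"

text \<open>
  The factors of the product over \<open>k \<noteq> j\<close> lie between 0 and 1, so the partial products always
  converge; \<^const>\<open>prodinf\<close> is not used because it does not admit the limit 0 unless some
  factor vanishes.
\<close>

definition uniformly_separated :: "(nat \<Rightarrow> complex) \<Rightarrow> bool" where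
  "uniformly_separated z \<longleftrightarrow>
     0 < (INF j. lim (\<lambda>n. \<Prod>k\<in>{..<n} - {j}. cmod ((z j - z k) / (1 - cnj (z k) * z j))))"

definition comparable :: "(nat \<Rightarrow> real) \<Rightarrow> (nat \<Rightarrow> real) \<Rightarrow> bool" where
  "comparable a b \<longleftrightarrow> (\<exists>c>0. \<exists>C>0. \<forall>j. c * a j \<le> b j \<and> b j \<le> C * a j)"

end

theory Submission
  imports Defs "HOL-Complex_Analysis.Complex_Analysis"
begin

text \<open>
  The Fourier transform turns the Laplacian into multiplication by \<open>\<phi>\<close>, so the Graph
  Paley--Wiener space should correspond to \<open>L2_on (band l)\<close> (\<open>GPW_eq\<close>). That space is defined by
  an arbitrary spectral measure, and the identification rests on a description of the spectral
  subspaces of a positive operator \<open>A\<close> by the operator alone, Bernstein's characterization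
  (\<open>range_E_eq_Bernstein\<close>): \<open>x\<close> belongs to the spectral subspace of \<open>[0, w]\<close> if and only if
  \<open>norm ((A ^^ n) x) \<le> w ^ n * norm x\<close> for all \<open>n\<close>.

  The elements \<open>band_basis l m\<close> form an orthonormal basis of \<open>L2_on (band l)\<close>, because exponentials
  of frequencies \<open>l * m\<close> separate functions on an interval of length \<open>1 / l\<close>
  (\<open>trigonometric_uniqueness\<close>). The coefficient of a band-limited function at \<open>band_basis l m\<close> is,
  up to the factor \<open>sqrt l\<close>, the sample at \<open>l * m\<close> of its inverse transform, and the inverse
  transform of the basis element is a shifted sinc function. The sampling formula is the image of
  the series that defines the diagonal operator \<open>T\<close>, and boundedness and invariance hold for every
  diagonal operator with bounded eigenvalues.

  For the frame property, let \<open>x = \<Sum>j\<in>I. x j *\<^sub>C e j\<close> with \<open>I\<close> finite. The inner product of \<open>x\<close>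
  with \<open>(T ^^ n) a\<close> is the complex conjugate of \<open>\<Sum>j\<in>I. y j * lam j ^ n\<close> with
  \<open>y j = cnj (x j) * cinner a (e j)\<close>, and these numbers are the Fourier coefficients of
  \<open>\<Sum>j\<in>I. y j *\<^sub>C cauchy_kernel (lam j)\<close>. So the claim is that the normalized Cauchy kernels at
  uniformly separated points form a Riesz sequence, with constants that do not depend on \<open>I\<close>
  (\<open>Riesz_sequence_kernels\<close>). Scaling each kernel by the value \<open>m (lam j)\<close> of a bounded analytic
  function \<open>m\<close> is a compression of multiplication by \<open>m\<close>, hence costs at most the supremum of
  \<open>m\<close> (\<open>norm_multiplied_kernels_le\<close>). Functions \<open>m\<close> with prescribed signs at the points and a
  uniform bound are supplied by P. Jones' explicit form of Carleson's interpolation theorem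
  (\<open>bounded_interpolation\<close>). So arbitrary changes of signs are uniformly bounded. Chosen one at
  a time, signs can make the squared norm at most, and other signs at least, the sum of the squared
  norms of the terms, which is therefore comparable to the squared norm of the combination. Finite combinations are dense, and the frame bounds extend
  (\<open>is_frame_dense\<close>).
\<close>


section \<open>Orthonormal families in complex inner product spaces\<close>

lemma cmod_square_eq: "(complex_of_real (cmod z))\<^sup>2 = cnj z * z"
  using complex_norm_square[of z] by (simp add: mult.commute)

lemma cinner_add_right: "cinner x (y + z) = cinner x y + cinner x (z :: 'a::complex_inner)"
  by (metis cinner_add_left cinner_commute complex_cnj_add)

lemma cinner_scaleC_right: "cinner x (c *\<^sub>C y) = cnj c * cinner x (y :: 'a::complex_inner)"
  by (metis cinner_scaleC_left cinner_commute complex_cnj_mult)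

lemma cinner_scaleR_left: "cinner (r *\<^sub>R x) y = r *\<^sub>R cinner x (y :: 'a::complex_inner)"
  by (simp add: scaleR_eq_scaleC cinner_scaleC_left scaleR_conv_of_real)

lemma cinner_scaleR_right: "cinner x (r *\<^sub>R y) = r *\<^sub>R cinner x (y :: 'a::complex_inner)"
  by (simp add: scaleR_eq_scaleC cinner_scaleC_right scaleR_conv_of_real)

lemma cinner_self: "cinner x x = complex_of_real ((norm (x :: 'a::complex_inner))\<^sup>2)"
proof -
  have "Im (cinner x x) = 0"
    using cinner_commute[of x x] by (metis Reals_cnj_iff complex_is_Real_iff)
  moreover have "Re (cinner x x) = (norm x)\<^sup>2"
    by (simp add: power2_norm_eq_inner inner_eq_Re_cinner)
  ultimately show ?thesis by (simp add: complex_eq_iff)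
qed

lemma norm_scaleC: "norm (c *\<^sub>C x) = cmod c * norm (x :: 'a::complex_inner)"
proof -
  have "complex_of_real ((norm (c *\<^sub>C x))\<^sup>2) = complex_of_real ((cmod c * norm x)\<^sup>2)"
    unfolding cinner_self[symmetric] cinner_scaleC_left cinner_scaleC_right
    by (simp add: cinner_self power_mult_distrib mult.assoc[symmetric] cmod_square_eq)
  then have "(norm (c *\<^sub>C x))\<^sup>2 = (cmod c * norm x)\<^sup>2"
    by (simp only: of_real_eq_iff)
  then show ?thesis by (simp add: power2_eq_iff_nonneg)
qed

text \<open>
  A unimodular scalar rotates the complex inner product onto the nonnegative real axis, where the
  real Cauchy-Schwarz inequality applies.
\<close>
lemma cinner_Cauchy_Schwarz: "cmod (cinner x y) \<le> norm x * norm (y :: 'a::complex_inner)"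
proof (cases "cinner x y = 0")
  case False
  define c where "c = cnj (cinner x y) / complex_of_real (cmod (cinner x y))"
  have c: "cmod c = 1" using False by (simp add: c_def norm_divide)
  have "cinner (c *\<^sub>C x) y = complex_of_real (cmod (cinner x y))"
    using False
    by (simp add: c_def cinner_scaleC_left complex_norm_square[symmetric] power2_eq_square
        mult.commute)
  then have "cmod (cinner x y) = inner (c *\<^sub>C x) y"
    by (simp add: inner_eq_Re_cinner)
  also have "\<dots> \<le> norm (c *\<^sub>C x) * norm y" by (rule norm_cauchy_schwarz)
  finally show ?thesis by (simp add: norm_scaleC c)
qed auto

lemma bounded_linear_cinner_left: "bounded_linear (\<lambda>x :: 'a::complex_inner. cinner x y)"
  by (rule bounded_linear_intro[where K = "norm y"])
    (auto simp: cinner_add_left cinner_scaleR_left cinner_Cauchy_Schwarz)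

lemma bounded_linear_cinner_right: "bounded_linear (\<lambda>y :: 'a::complex_inner. cinner x y)"
  by (rule bounded_linear_intro[where K = "norm x"])
    (auto simp: cinner_add_right cinner_scaleR_right mult.commute[of _ "norm x"] cinner_Cauchy_Schwarz)

lemmas cinner_zero_left [simp] = bounded_linear.linear[OF bounded_linear_cinner_left, THEN linear_0]
  and cinner_zero_right [simp] = bounded_linear.linear[OF bounded_linear_cinner_right, THEN linear_0]
  and cinner_diff_left = bounded_linear.linear[OF bounded_linear_cinner_left, THEN linear_diff]
  and cinner_diff_right = bounded_linear.linear[OF bounded_linear_cinner_right, THEN linear_diff]
  and cinner_sum_left = bounded_linear.linear[OF bounded_linear_cinner_left, THEN linear_sum]
  and cinner_sum_right = bounded_linear.linear[OF bounded_linear_cinner_right, THEN linear_sum]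

lemma bounded_linear_scaleC_right: "bounded_linear (\<lambda>x :: 'a::complex_inner. c *\<^sub>C x)"
  by (rule bounded_linear_intro[where K = "cmod c"])
    (auto simp: scaleC_add_right norm_scaleC scaleR_eq_scaleC scaleC_scaleC mult.commute)

lemma scaleC_one [simp]: "1 *\<^sub>C (x :: 'a::complex_inner) = x"
  using scaleR_eq_scaleC[of 1 x] by simp


definition orthonormal :: "('i \<Rightarrow> 'a::complex_inner) \<Rightarrow> bool" where
  "orthonormal u \<longleftrightarrow> (\<forall>i j. cinner (u i) (u j) = (if i = j then 1 else 0))"

lemma cinner_orthonormal: "orthonormal u \<Longrightarrow> cinner (u i) (u j) = (if i = j then 1 else 0)"
  by (simp add: orthonormal_def)

lemma cinner_orthonormal_sum:
  assumes "orthonormal u" "finite F"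
  shows "cinner (\<Sum>i\<in>F. c i *\<^sub>C u i) (u j) = (if j \<in> F then c j else 0)"
  using assms(2) by (simp add: cinner_orthonormal[OF assms(1)] cinner_sum_left cinner_scaleC_left
      if_distrib sum.delta cong: if_cong)

lemma norm_orthonormal_sum:
  assumes "orthonormal u" "finite F"
  shows "(norm (\<Sum>i\<in>F. c i *\<^sub>C u i))\<^sup>2 = (\<Sum>i\<in>F. (cmod (c i))\<^sup>2)"
proof -
  have "complex_of_real ((norm (\<Sum>i\<in>F. c i *\<^sub>C u i))\<^sup>2)
      = (\<Sum>j\<in>F. cnj (c j) * cinner (\<Sum>i\<in>F. c i *\<^sub>C u i) (u j))"
    unfolding cinner_self[symmetric] by (subst cinner_sum_right) (simp add: cinner_scaleC_right)
  also have "\<dots> = complex_of_real (\<Sum>i\<in>F. (cmod (c i))\<^sup>2)"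
    by (auto simp: cinner_orthonormal_sum[OF assms] complex_norm_square mult.commute simp del: of_real_power
        intro!: sum.cong)
  finally show ?thesis by (simp only: of_real_eq_iff)
qed

text \<open>
  Pythagoras for the orthogonal projection \<open>p\<close> of \<open>x\<close> onto the span of finitely many members.
\<close>
lemma bessel_finite:
  assumes "orthonormal u" "finite F"
  shows "(\<Sum>i\<in>F. (cmod (cinner x (u i)))\<^sup>2) \<le> (norm x)\<^sup>2"
proof -
  define p where "p = (\<Sum>i\<in>F. cinner x (u i) *\<^sub>C u i)"
  have "cinner x p = complex_of_real (\<Sum>i\<in>F. (cmod (cinner x (u i)))\<^sup>2)"
    unfolding p_def by (subst cinner_sum_right)
      (simp add: cinner_scaleC_right cmod_square_eq)
  then have "inner x p = (norm p)\<^sup>2"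
    using norm_orthonormal_sum[OF assms, of "\<lambda>i. cinner x (u i)"]
    by (simp add: inner_eq_Re_cinner p_def)
  then have "(norm (x - p))\<^sup>2 = (norm x)\<^sup>2 - (norm p)\<^sup>2"
    by (simp add: power2_norm_eq_inner inner_diff inner_commute)
  moreover have "(norm p)\<^sup>2 = (\<Sum>i\<in>F. (cmod (cinner x (u i)))\<^sup>2)"
    unfolding p_def by (rule norm_orthonormal_sum[OF assms])
  ultimately show ?thesis by (metis diff_ge_0_iff_ge zero_le_power2)
qed

lemma bessel_summable:
  assumes "orthonormal u"
  shows "(\<lambda>i. (cmod (cinner x (u i)))\<^sup>2) summable_on UNIV"
  by (rule nonneg_bdd_above_summable_on) (auto intro!: bdd_aboveI2 bessel_finite[OF assms])

text \<open>
  The squared norm of a finite block of the series is the matching block of the convergent sum of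
  the \<open>(cmod (c i))\<^sup>2\<close>, so the net of partial sums is Cauchy.
\<close>
lemma orthonormal_summable:
  fixes u :: "'i \<Rightarrow> 'a::{complex_inner, banach}"
  assumes u: "orthonormal u" and c: "(\<lambda>i. (cmod (c i))\<^sup>2) summable_on UNIV"
  shows "(\<lambda>i. c i *\<^sub>C u i) summable_on UNIV"
proof -
  let ?S = "\<lambda>F. \<Sum>i\<in>F. c i *\<^sub>C u i" and ?N = "\<lambda>F. \<Sum>i\<in>F. (cmod (c i))\<^sup>2"
  have "\<exists>P. eventually P (finite_subsets_at_top UNIV) \<and>
      (\<forall>F F'. P F \<and> P F' \<longrightarrow> dist (?S F) (?S F') < e)" if e: "e > 0" for e
  proof -
    define L where "L = infsum (\<lambda>i. (cmod (c i))\<^sup>2) UNIV"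
    obtain F0 where F0: "finite F0" "dist (?N F0) L \<le> (e/3)\<^sup>2"
      using infsum_finite_approximation[OF c, of "(e/3)\<^sup>2"] e unfolding L_def by auto
    have near: "dist (?S F) (?S F0) \<le> e/3" if "finite F" "F0 \<subseteq> F" for F
    proof -
      have "?S F - ?S F0 = ?S (F - F0)" "?N F - ?N F0 = ?N (F - F0)"
        using that F0 by (auto simp: sum_diff)
      moreover have "?N F \<le> L"
        unfolding L_def by (rule finite_sum_le_infsum) (use c that in auto)
      ultimately have "(dist (?S F) (?S F0))\<^sup>2 \<le> (e/3)\<^sup>2"
        using F0 norm_orthonormal_sum[OF u, of "F - F0" c] that by (simp add: dist_norm)
      then show ?thesis by (rule power2_le_imp_le) (use e in auto)
    qed
    have "dist (?S F) (?S F') < e" if "finite F \<and> F0 \<subseteq> F" "finite F' \<and> F0 \<subseteq> F'" for F F'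
      using near[of F] near[of F'] that dist_triangle3[of "?S F" "?S F'" "?S F0"] e
        dist_triangle[of "?S F" "?S F'" "?S F0"] by (auto simp: dist_commute)
    moreover have "eventually (\<lambda>F. finite F \<and> F0 \<subseteq> F) (finite_subsets_at_top UNIV)"
      using F0 by (auto simp: eventually_finite_subsets_at_top)
    ultimately show ?thesis by blast
  qed
  then have "cauchy_filter (filtermap ?S (finite_subsets_at_top UNIV))"
    by (simp add: cauchy_filter_metric_filtermap)
  moreover have "complete (UNIV :: 'a set)"
    by (rule complete_UNIV)
  ultimately obtain L where "(?S \<longlongrightarrow> L) (finite_subsets_at_top UNIV)"
    using complete_uniform[where S = "UNIV :: 'a set"] by (force simp: filterlim_def)
  then show ?thesis unfolding summable_on_def has_sum_def by blast
qed

lemma cinner_orthonormal_has_sum: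
  assumes u: "orthonormal u" and x: "((\<lambda>i. c i *\<^sub>C u i) has_sum x) UNIV"
  shows "cinner x (u j) = c j"
proof -
  have 1: "((\<lambda>i. cinner (c i *\<^sub>C u i) (u j)) has_sum cinner x (u j)) UNIV"
    using has_sum_bounded_linear[OF bounded_linear_cinner_left x] by (simp add: o_def)
  have "(\<lambda>i. cinner (c i *\<^sub>C u i) (u j)) = (\<lambda>i. if i = j then c j else 0)"
    using u by (auto simp: orthonormal_def cinner_scaleC_left)
  moreover have "((\<lambda>i. if i = j then c j else 0) has_sum c j) UNIV"
    by (rule has_sum_finite_neutralI[of "{j}"]) auto
  ultimately show ?thesis using 1 has_sum_unique by metis
qed

lemma norm_orthonormal_has_sum:
  assumes u: "orthonormal u" and x: "((\<lambda>i. c i *\<^sub>C u i) has_sum x) UNIV"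
  shows "((\<lambda>i. (cmod (c i))\<^sup>2) has_sum (norm x)\<^sup>2) UNIV"
  unfolding has_sum_def
proof (rule Lim_transform_eventually)
  show "((\<lambda>F. (norm (\<Sum>i\<in>F. c i *\<^sub>C u i))\<^sup>2) \<longlongrightarrow> (norm x)\<^sup>2) (finite_subsets_at_top UNIV)"
    using x unfolding has_sum_def by (intro tendsto_intros)
  show "\<forall>\<^sub>F F in finite_subsets_at_top UNIV.
      (norm (\<Sum>i\<in>F. c i *\<^sub>C u i))\<^sup>2 = (\<Sum>i\<in>F. (cmod (c i))\<^sup>2)"
    by (rule eventually_finite_subsets_at_top_weakI) (rule norm_orthonormal_sum[OF u])
qed

text \<open>
  If only \<open>0\<close> in a subspace is orthogonal to the family, then the difference between \<open>x\<close>
  and its orthogonal expansion, being orthogonal to the family, vanishes.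
\<close>
lemma orthonormal_expansion:
  fixes u :: "'i \<Rightarrow> 'a::{complex_inner, banach}"
  assumes u: "orthonormal u"
    and total: "\<And>y. y \<in> S \<Longrightarrow> (\<And>i. cinner y (u i) = 0) \<Longrightarrow> y = 0"
    and S: "subspace S" "closed S" "\<And>c i. c *\<^sub>C u i \<in> S" and x: "x \<in> S"
  shows "((\<lambda>i. cinner x (u i) *\<^sub>C u i) has_sum x) UNIV"
proof -
  obtain y where y: "((\<lambda>i. cinner x (u i) *\<^sub>C u i) has_sum y) UNIV"
    using orthonormal_summable[OF u bessel_summable[OF u, of x]] by (auto simp: summable_on_def)
  have "y \<in> S"
    using y unfolding has_sum_def
  proof (rule Lim_in_closed_set[OF S(2), rotated 2])
    show "\<forall>\<^sub>F F in finite_subsets_at_top UNIV. (\<Sum>i\<in>F. cinner x (u i) *\<^sub>C u i) \<in> S"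
      by (rule eventually_finite_subsets_at_top_weakI) (auto intro: subspace_sum S)
  qed auto
  then have "x - y \<in> S" using S(1) x by (intro subspace_diff)
  moreover have "cinner (x - y) (u i) = 0" for i
    by (simp add: cinner_diff_left cinner_orthonormal_has_sum[OF u y])
  ultimately have "x - y = 0" by (rule total)
  then show ?thesis using y by simp
qed


section \<open>Completeness and multiplication operators on the circle\<close>

lemma circle_ae_eq_refl: "circle_ae_eq f f \<longleftrightarrow> square_integrable f"
  by (auto simp: circle_ae_eq_def)

lemma L2_cases:
  obtains f where "square_integrable f" "x = L2_of f"
  using L2_circle.abs_induct[of "\<lambda>x. \<exists>f. square_integrable f \<and> x = L2_of f" x]
  by (auto simp: circle_ae_eq_refl)

lemma L2_of_eq_iff:
  assumes "square_integrable f" "square_integrable g"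
  shows "L2_of f = L2_of g \<longleftrightarrow> (AE x in circle. f x = g x)"
  using Quotient3_rel[OF Quotient3_L2_circle, of f g] assms by (auto simp: circle_ae_eq_def)

lemma cinner_L2_of:
  assumes "square_integrable f" "square_integrable g"
  shows "cinner (L2_of f) (L2_of g) = (LINT x|circle. f x * cnj (g x))"
  using assms by (simp add: cinner_L2_circle.abs_eq circle_ae_eq_refl)

lemma norm_L2_of:
  assumes "square_integrable f"
  shows "(norm (L2_of f))\<^sup>2 = (LINT x|circle. (cmod (f x))\<^sup>2)"
proof -
  have "complex_of_real ((norm (L2_of f))\<^sup>2) = complex_of_real (LINT x|circle. (cmod (f x))\<^sup>2)"
    unfolding cinner_self[symmetric] cinner_L2_of[OF assms assms]
    by (simp flip: complex_norm_square of_real_power)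
  then show ?thesis by (simp only: of_real_eq_iff)
qed

lemma square_integrable_diff:
  "square_integrable f \<Longrightarrow> square_integrable g \<Longrightarrow> square_integrable (\<lambda>x. f x - g x)"
  using square_integrable_add[of f "\<lambda>x. - 1 * g x"] square_integrable_scale[of g "-1"] by simp

lemma L2_of_diff:
  assumes "square_integrable f" "square_integrable g"
  shows "L2_of f - L2_of g = L2_of (\<lambda>x. f x - g x)"
proof -
  have "square_integrable (\<lambda>x. - g x)" using square_integrable_scale[OF assms(2), of "-1"] by simp
  then show ?thesis using assms
    by (simp add: minus_L2_circle_def uminus_L2_circle.abs_eq plus_L2_circle.abs_eq circle_ae_eq_refl)
qed

lemma L2_of_add:
  assumes "square_integrable f" "square_integrable g"
  shows "L2_of f + L2_of g = L2_of (\<lambda>x. f x + g x)"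
  using assms by (simp add: plus_L2_circle.abs_eq circle_ae_eq_refl)

lemma L2_of_scaleC:
  assumes "square_integrable f"
  shows "c *\<^sub>C L2_of f = L2_of (\<lambda>x. c * f x)"
  using assms by (simp add: scaleC_L2_circle.abs_eq circle_ae_eq_refl)

lemma square_integrable_imp_integrable_norm:
  assumes "square_integrable f" shows "integrable circle (\<lambda>x. cmod (f x))"
proof -
  have [measurable]: "f \<in> borel_measurable circle" using assms by (simp add: square_integrable_def)
  have "integrable circle (\<lambda>x. (cmod (f x))\<^sup>2 + 1)"
    using assms unfolding square_integrable_def
    by (intro Bochner_Integration.integrable_add finite_measure.integrable_const[OF finite_measure_circle]) auto
  then show ?thesis
  proof (rule Bochner_Integration.integrable_bound)
    have "norm (cmod (f x)) \<le> norm ((cmod (f x))\<^sup>2 + 1)" for x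
    proof -
      have "2 * cmod (f x) \<le> (cmod (f x))\<^sup>2 + 1" using sum_squares_bound[of "cmod (f x)" 1] by simp
      then have "cmod (f x) \<le> (cmod (f x))\<^sup>2 + 1" using norm_ge_zero[of "f x"] by linarith
      then show ?thesis by simp
    qed
    then show "AE x in circle. norm (cmod (f x)) \<le> norm ((cmod (f x))\<^sup>2 + 1)" by simp
  qed measurable
qed

lemma measure_circle: "measure circle (space circle) = 1"
  by (simp add: circle_def measure_restrict_space)

text \<open>
  On a space of finite measure the geometric bound on the \<open>L\<^sup>2\<close> norms of the increments makes their
  \<open>L\<^sup>1\<close> norms summable, so the representatives converge almost everywhere; Fatou's lemma shows that
  the pointwise limit is also the limit in norm.
\<close>
lemma L2_circle_Riesz_Fischer:
  fixes Y :: "nat \<Rightarrow> L2_circle"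
  assumes Y: "\<And>m n. m \<le> n \<Longrightarrow> norm (Y n - Y m) \<le> (1/2) ^ m"
  shows "convergent Y"
proof -
  have "\<exists>f. square_integrable f \<and> Y n = L2_of f" for n
    using L2_cases[of "Y n"] by blast
  then obtain g where g: "\<And>n. square_integrable (g n)" "\<And>n. Y n = L2_of (g n)" by metis
  have [measurable]: "g n \<in> borel_measurable circle" for n
    using g(1)[of n] by (simp add: square_integrable_def)
  have sq: "square_integrable (\<lambda>x. g n x - g m x)" for m n
    by (intro square_integrable_diff g)
  have bound: "(LINT x|circle. (cmod (g n x - g m x))\<^sup>2) \<le> ((1/2) ^ m)\<^sup>2" if "m \<le> n" for m n
    using power_mono[OF Y[OF that], of 2] norm_L2_of[OF sq[of n m]]
    by (simp add: g L2_of_diff)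
  define d where "d n x = cmod (g (Suc n) x - g n x)" for n x
  have [measurable]: "d n \<in> borel_measurable circle" for n unfolding d_def by measurable
  have d2: "integrable circle (\<lambda>x. (d n x)\<^sup>2)" for n
    using sq[of "Suc n" n] by (simp add: square_integrable_def d_def)
  have d1: "integrable circle (d n)" for n
    using square_integrable_imp_integrable_norm[OF sq[of "Suc n" n]] by (simp add: d_def[abs_def])
  have dint: "integral\<^sup>L circle (d n) \<le> 2 * (1/2) ^ n" for n
  proof -
    \<comment> \<open>The weight \<open>2 ^ n\<close> balances \<open>(d n x)\<^sup>2\<close>, of integral at most \<open>(1/4) ^ n\<close>, against the constant.\<close>
    have "integral\<^sup>L circle (d n) \<le> (LINT x|circle. 2 ^ n * (d n x)\<^sup>2 + (1/2) ^ n)"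
    proof (rule integral_mono[OF d1])
      show "integrable circle (\<lambda>x. 2 ^ n * (d n x)\<^sup>2 + (1/2) ^ n)"
        by (intro Bochner_Integration.integrable_add finite_measure.integrable_const[OF finite_measure_circle]
            integrable_mult_right d2)
      fix x
      define t :: real where "t = 2 ^ n * d n x"
      have "t \<ge> 0" by (simp add: t_def d_def)
      then have "t \<le> t * t + 1" using sum_squares_bound[of t 1] by (simp add: power2_eq_square)
      then have "2 ^ n * d n x \<le> 2 ^ n * (2 ^ n * (d n x)\<^sup>2 + (1/2) ^ n)"
        by (simp add: t_def power2_eq_square distrib_left power_divide mult_ac)
      then show "d n x \<le> 2 ^ n * (d n x)\<^sup>2 + (1/2) ^ n"
        by (subst (asm) mult_le_cancel_left_pos) auto
    qed
    also have "\<dots> = 2 ^ n * (LINT x|circle. (d n x)\<^sup>2) + (1/2) ^ n"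
      by (subst Bochner_Integration.integral_add[OF integrable_mult_right[OF d2]
            finite_measure.integrable_const[OF finite_measure_circle]]) (simp add: measure_circle)
    also have "\<dots> \<le> 2 ^ n * ((1/2) ^ n)\<^sup>2 + (1/2) ^ n"
      using bound[of n "Suc n"] by (simp add: d_def)
    also have "\<dots> = 2 * (1/2) ^ n" by (simp add: power2_eq_square power_divide)
    finally show ?thesis .
  qed
  have "(\<integral>\<^sup>+x. (\<Sum>n. ennreal (d n x)) \<partial>circle) = (\<Sum>n. \<integral>\<^sup>+x. ennreal (d n x) \<partial>circle)"
    by (rule nn_integral_suminf) measurable
  also have "\<dots> \<le> (\<Sum>n. ennreal (2 * (1/2) ^ n))"
  proof (intro suminf_le)
    fix n
    have "(\<integral>\<^sup>+x. ennreal (d n x) \<partial>circle) = ennreal (integral\<^sup>L circle (d n))"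
      by (rule nn_integral_eq_integral[OF d1]) (simp add: d_def)
    then show "(\<integral>\<^sup>+x. ennreal (d n x) \<partial>circle) \<le> ennreal (2 * (1/2) ^ n)"
      using dint[of n] by (simp only: ennreal_leI)
  qed auto
  also have "\<dots> = ennreal (\<Sum>n. 2 * (1/2) ^ n)"
    by (intro suminf_ennreal2 summable_mult) (auto intro: summable_geometric)
  also have "\<dots> < \<infinity>" by simp
  finally have "AE x in circle. (\<Sum>n. ennreal (d n x)) \<noteq> \<infinity>"
    by (intro nn_integral_noteq_infinite) auto
  then have ae: "AE x in circle. convergent (\<lambda>n. g n x)"
  proof eventually_elim
    case (elim x)
    have "summable (\<lambda>n. d n x)"
      by (rule summable_suminf_not_top) (use elim in \<open>auto simp: d_def\<close>)
    then have "summable (\<lambda>n. g (Suc n) x - g n x)"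
      unfolding d_def by (rule summable_norm_cancel)
    then have "convergent (\<lambda>n. g n x - g 0 x)"
      using sum_lessThan_telescope[of "\<lambda>i. g i x"] by (simp add: summable_iff_convergent)
    then show ?case
      using convergent_add[OF _ convergent_const, of "\<lambda>n. g n x - g 0 x" "g 0 x"] by simp
  qed
  define G where "G x = lim (\<lambda>n. g n x)" for x
  have [measurable]: "G \<in> borel_measurable circle"
    unfolding G_def by (rule borel_measurable_lim_metric) measurable
  have fatou: "(\<integral>\<^sup>+x. ennreal ((cmod (G x - g m x))\<^sup>2) \<partial>circle) \<le> ennreal (((1/2) ^ m)\<^sup>2)" for m
  proof -
    have "(\<integral>\<^sup>+x. ennreal ((cmod (G x - g m x))\<^sup>2) \<partial>circle)
        = (\<integral>\<^sup>+x. liminf (\<lambda>n. ennreal ((cmod (g n x - g m x))\<^sup>2)) \<partial>circle)"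
    proof (rule nn_integral_cong_AE)
      show "AE x in circle. ennreal ((cmod (G x - g m x))\<^sup>2)
          = liminf (\<lambda>n. ennreal ((cmod (g n x - g m x))\<^sup>2))"
        using ae
      proof eventually_elim
        case (elim x)
        then have "(\<lambda>n. g n x) \<longlonglongrightarrow> G x" by (simp add: G_def convergent_LIMSEQ_iff)
        then have "(\<lambda>n. ennreal ((cmod (g n x - g m x))\<^sup>2)) \<longlonglongrightarrow> ennreal ((cmod (G x - g m x))\<^sup>2)"
          by (intro tendsto_intros)
        then show ?case by (intro lim_imp_Liminf[symmetric]) auto
      qed
    qed
    also have "\<dots> \<le> liminf (\<lambda>n. \<integral>\<^sup>+x. ennreal ((cmod (g n x - g m x))\<^sup>2) \<partial>circle)"
      by (rule nn_integral_liminf) measurable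
    also have "\<dots> \<le> limsup (\<lambda>n. \<integral>\<^sup>+x. ennreal ((cmod (g n x - g m x))\<^sup>2) \<partial>circle)"
      by (rule Liminf_le_Limsup) simp
    also have "\<dots> \<le> ennreal (((1/2) ^ m)\<^sup>2)"
    proof (rule Limsup_bounded)
      show "\<forall>\<^sub>F n in sequentially. (\<integral>\<^sup>+x. ennreal ((cmod (g n x - g m x))\<^sup>2) \<partial>circle)
          \<le> ennreal (((1/2) ^ m)\<^sup>2)"
        using eventually_ge_at_top[of m]
      proof eventually_elim
        case (elim n)
        have "integrable circle (\<lambda>x. (cmod (g n x - g m x))\<^sup>2)"
          using sq[of n m] by (simp add: square_integrable_def)
        then show ?case
          by (subst nn_integral_eq_integral) (use bound[OF elim] in \<open>auto intro: ennreal_leI\<close>)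
      qed
    qed
    finally show ?thesis .
  qed
  have Gg: "square_integrable (\<lambda>x. G x - g m x)" for m
    unfolding square_integrable_def
  proof
    show "integrable circle (\<lambda>x. (cmod (G x - g m x))\<^sup>2)"
      by (rule integrableI_nonneg)
        (use fatou[of m] in \<open>auto intro: le_less_trans[OF _ ennreal_less_top]\<close>)
  qed measurable
  have G: "square_integrable G"
    using square_integrable_add[OF Gg[of 0] g(1)[of 0]] by simp
  have "norm (L2_of G - Y m) \<le> (1/2) ^ m" for m
  proof -
    have "(norm (L2_of G - Y m))\<^sup>2 = (LINT x|circle. (cmod (G x - g m x))\<^sup>2)"
      using norm_L2_of[OF Gg[of m]] by (simp add: g L2_of_diff G)
    also have "\<dots> = enn2real (\<integral>\<^sup>+x. ennreal ((cmod (G x - g m x))\<^sup>2) \<partial>circle)"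
      by (rule integral_eq_nn_integral) auto
    also have "\<dots> \<le> ((1/2) ^ m)\<^sup>2"
      by (rule enn2real_leI) (use fatou[of m] in auto)
    finally show ?thesis by (rule power2_le_imp_le) simp
  qed
  then have "(\<lambda>m. Y m - L2_of G) \<longlonglongrightarrow> 0"
    by (intro Lim_null_comparison[OF _ LIMSEQ_power_zero[of "1/2 :: real"]])
      (auto simp: norm_minus_commute)
  then have "Y \<longlonglongrightarrow> L2_of G" by (simp add: LIM_zero_iff)
  then show ?thesis by (rule convergentI)
qed

instance L2_circle :: complete_space
proof
  fix X :: "nat \<Rightarrow> L2_circle" assume X: "Cauchy X"
  have "\<exists>N. \<forall>m\<ge>N. \<forall>n\<ge>N. dist (X m) (X n) < (1/2) ^ i" for i :: nat
    using X by (auto simp: Cauchy_def)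
  then obtain N where N: "\<And>i m n. m \<ge> N i \<Longrightarrow> n \<ge> N i \<Longrightarrow> dist (X m) (X n) < (1/2) ^ i"
    by metis
  define r where "r n = (\<Sum>i\<le>n. N i)" for n
  have r: "N m \<le> r n" if "m \<le> n" for m n
    unfolding r_def using that by (intro member_le_sum) auto
  have "convergent (\<lambda>n. X (r n))"
    by (rule L2_circle_Riesz_Fischer) (auto simp: dist_norm[symmetric] intro!: less_imp_le[OF N] r)
  then obtain L where L: "(\<lambda>n. X (r n)) \<longlonglongrightarrow> L" by (auto simp: convergent_def)
  have "X \<longlonglongrightarrow> L"
  proof (rule metric_LIMSEQ_I)
    fix e :: real assume e: "e > 0"
    obtain i where i: "(1/2) ^ i < e/2" using real_arch_pow_inv[of "e/2" "1/2"] e by auto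
    obtain M where M: "\<And>n. n \<ge> M \<Longrightarrow> dist (X (r n)) L < e/2"
      using metric_LIMSEQ_D[OF L, of "e/2"] e by auto
    define n where "n = max M i"
    show "\<exists>no. \<forall>k\<ge>no. dist (X k) L < e"
    proof (intro exI allI impI)
      fix k assume "k \<ge> N i"
      then have "dist (X k) (X (r n)) < (1/2) ^ i" by (intro N r) (auto simp: n_def)
      then show "dist (X k) L < e"
        using M[of n] i dist_triangle[of "X k" L "X (r n)"] by (auto simp: n_def)
    qed
  qed
  then show "convergent X" by (rule convergentI)
qed

instance L2_circle :: banach ..


definition bounded_multiplier :: "(real \<Rightarrow> complex) \<Rightarrow> bool" where
  "bounded_multiplier m \<longleftrightarrow> m \<in> borel_measurable borel \<and> bounded (range m)"

lemma bounded_multiplierI: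
  "m \<in> borel_measurable borel \<Longrightarrow> (\<And>\<xi>. cmod (m \<xi>) \<le> K) \<Longrightarrow> bounded_multiplier m"
  by (auto simp: bounded_multiplier_def bounded_iff)

lemma square_integrable_mult:
  assumes m: "bounded_multiplier m" and f: "square_integrable f"
  shows "square_integrable (\<lambda>\<xi>. m \<xi> * f \<xi>)"
proof -
  have [measurable]: "m \<in> borel_measurable circle" "f \<in> borel_measurable circle"
    using assms by (auto simp: bounded_multiplier_def square_integrable_def borel_measurable_circle)
  obtain K where K: "\<And>\<xi>. cmod (m \<xi>) \<le> K"
    using m by (auto simp: bounded_multiplier_def bounded_iff)
  have "integrable circle (\<lambda>\<xi>. K\<^sup>2 * (cmod (f \<xi>))\<^sup>2)"
    using f by (auto simp: square_integrable_def)
  then have "integrable circle (\<lambda>\<xi>. (cmod (m \<xi> * f \<xi>))\<^sup>2)"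
    by (rule Bochner_Integration.integrable_bound)
      (auto intro!: AE_I2 mult_right_mono power_mono K simp: norm_mult power_mult_distrib)
  then show ?thesis by (simp add: square_integrable_def)
qed

text \<open>
  The test for boundedness makes the operation total: every other symbol acts as \<open>0\<close>.
\<close>
lift_definition mult_op :: "(real \<Rightarrow> complex) \<Rightarrow> L2_circle \<Rightarrow> L2_circle"
  is "\<lambda>m g \<xi>. if bounded_multiplier m then m \<xi> * g \<xi> else 0"
  subgoal for m f g
    using square_integrable_mult[of m f] square_integrable_mult[of m g]
    by (cases "bounded_multiplier m") (auto simp: circle_ae_eq_def square_integrable_zero)
  done

lemma mult_op_L2_of:
  "bounded_multiplier m \<Longrightarrow> square_integrable f \<Longrightarrow> mult_op m (L2_of f) = L2_of (\<lambda>\<xi>. m \<xi> * f \<xi>)"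
  by (simp add: mult_op.abs_eq circle_ae_eq_refl)

lemma norm_mult_op_le:
  assumes m: "bounded_multiplier m" and K: "\<And>\<xi>. cmod (m \<xi>) \<le> K"
  shows "norm (mult_op m g) \<le> K * norm g"
proof -
  have "K \<ge> 0" using K[of 0] norm_ge_zero[of "m 0"] by linarith
  obtain f where f: "square_integrable f" and g: "g = L2_of f" by (rule L2_cases)
  have "(norm (mult_op m g))\<^sup>2 = (LINT x|circle. (cmod (m x * f x))\<^sup>2)"
    using m f by (simp add: g mult_op_L2_of norm_L2_of square_integrable_mult)
  also have "\<dots> \<le> (LINT x|circle. K\<^sup>2 * (cmod (f x))\<^sup>2)"
    using f square_integrable_mult[OF m f]
    by (intro integral_mono)
      (auto simp: square_integrable_def norm_mult power_mult_distrib intro!: mult_right_mono power_mono K)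
  also have "\<dots> = (K * norm g)\<^sup>2"
    using f by (simp add: g norm_L2_of power_mult_distrib)
  finally show ?thesis by (rule power2_le_imp_le) (simp add: \<open>K \<ge> 0\<close>)
qed

lemma bounded_clinear_mult_op:
  assumes m: "bounded_multiplier m" shows "bounded_clinear (mult_op m)"
proof -
  have add: "mult_op m (x + y) = mult_op m x + mult_op m y" for x y
    by (rule L2_cases[of x], rule L2_cases[of y])
      (simp add: L2_of_add mult_op_L2_of m square_integrable_add square_integrable_mult distrib_left)
  have sc: "mult_op m (c *\<^sub>C x) = c *\<^sub>C mult_op m x" for c x
    by (rule L2_cases[of x])
      (simp add: L2_of_scaleC mult_op_L2_of m square_integrable_scale square_integrable_mult mult.left_commute)
  obtain K where K: "\<And>\<xi>. cmod (m \<xi>) \<le> K"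
    using m by (auto simp: bounded_multiplier_def bounded_iff)
  have "bounded_linear (mult_op m)"
    by (rule bounded_linear_intro[where K = K])
      (use norm_mult_op_le[OF m K] in \<open>simp_all add: add sc scaleR_eq_scaleC mult.commute\<close>)
  then show ?thesis by (simp add: bounded_clinear_def sc)
qed

lemma bounded_multiplier_mult:
  assumes "bounded_multiplier m" "bounded_multiplier m'"
  shows "bounded_multiplier (\<lambda>\<xi>. m \<xi> * m' \<xi>)"
proof -
  obtain K K' where "\<And>\<xi>. cmod (m \<xi>) \<le> K" "\<And>\<xi>. cmod (m' \<xi>) \<le> K'"
    using assms by (auto simp: bounded_multiplier_def bounded_iff)
  then have "cmod (m \<xi> * m' \<xi>) \<le> K * K'" for \<xi>
    by (metis mult_mono' norm_ge_zero norm_mult)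
  then show ?thesis
    by (rule bounded_multiplierI[rotated]) (use assms in \<open>auto simp: bounded_multiplier_def\<close>)
qed

lemma mult_op_mult_op:
  assumes "bounded_multiplier m" "bounded_multiplier m'"
  shows "mult_op m (mult_op m' g) = mult_op (\<lambda>\<xi>. m \<xi> * m' \<xi>) g"
  by (rule L2_cases[of g])
    (simp add: mult_op_L2_of assms square_integrable_mult bounded_multiplier_mult mult.assoc)

lemma bounded_multiplier_cnj:
  assumes "bounded_multiplier m" shows "bounded_multiplier (\<lambda>\<xi>. cnj (m \<xi>))"
proof -
  have [measurable]: "m \<in> borel_measurable borel" using assms by (simp add: bounded_multiplier_def)
  have "(\<lambda>\<xi>. cnj (m \<xi>)) \<in> borel_measurable borel"
    by (rule borel_measurable_continuous_on[OF continuous_on_cnj]) (auto intro: continuous_intros)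
  then show ?thesis using assms by (auto simp: bounded_multiplier_def bounded_iff)
qed

lemma cinner_mult_op:
  assumes m: "bounded_multiplier m"
  shows "cinner (mult_op m g) h = cinner g (mult_op (\<lambda>\<xi>. cnj (m \<xi>)) h)"
  by (rule L2_cases[of g], rule L2_cases[of h])
    (simp add: mult_op_L2_of cinner_L2_of m square_integrable_mult bounded_multiplier_cnj mult.assoc
      mult.left_commute[of _ "cnj _"] mult.left_commute[of "m _"])


section \<open>A uniqueness theorem for trigonometric coefficients\<close>

lemma AE_circle_not_in_null:
  assumes "N \<in> null_sets lborel" shows "AE x in circle. x \<notin> N"
proof -
  have "AE x in lebesgue. x \<notin> N" by (rule AE_completion[OF AE_not_in[OF assms]])
  then show ?thesis unfolding circle_def by (subst AE_restrict_space_iff) auto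
qed

lemma borel_measurable_indicator_circle:
  "A \<in> sets borel \<Longrightarrow> (indicator A :: real \<Rightarrow> real) \<in> borel_measurable circle"
  by (intro borel_measurable_circle) simp

lemma integrable_mult_bounded_multiplier:
  assumes "integrable circle g" and m: "bounded_multiplier m"
  shows "integrable circle (\<lambda>\<xi>. g \<xi> * m \<xi>)"
proof -
  have [measurable]: "m \<in> borel_measurable circle" "g \<in> borel_measurable circle"
    using assms by (auto simp: bounded_multiplier_def borel_measurable_circle)
  obtain K where K: "\<And>\<xi>. cmod (m \<xi>) \<le> K"
    using m by (auto simp: bounded_multiplier_def bounded_iff)
  have "integrable circle (\<lambda>\<xi>. K * cmod (g \<xi>))" using assms by auto
  then show ?thesis
    by (rule Bochner_Integration.integrable_bound)
      (use K order.trans[OF norm_ge_zero K] in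
        \<open>auto intro!: AE_I2 simp: norm_mult abs_mult mult.commute[of K] mult_left_mono\<close>)
qed

lemma bounded_multiplier_cis: "bounded_multiplier (\<lambda>\<xi>. cis (c * \<xi>))"
  by (rule bounded_multiplierI[where K = 1])
    (auto intro!: borel_measurable_continuous_onI continuous_intros)

lemma bounded_multiplier_add:
  assumes "bounded_multiplier m" "bounded_multiplier m'"
  shows "bounded_multiplier (\<lambda>\<xi>. m \<xi> + m' \<xi>)"
proof -
  obtain K K' where "\<And>\<xi>. cmod (m \<xi>) \<le> K" "\<And>\<xi>. cmod (m' \<xi>) \<le> K'"
    using assms by (auto simp: bounded_multiplier_def bounded_iff)
  then have "cmod (m \<xi> + m' \<xi>) \<le> K + K'" for \<xi>
    by (meson add_mono norm_triangle_le)
  then show ?thesis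
    by (rule bounded_multiplierI[rotated]) (use assms in \<open>auto simp: bounded_multiplier_def\<close>)
qed

lemma bounded_multiplier_const: "bounded_multiplier (\<lambda>\<xi>. c)"
  by (rule bounded_multiplierI[where K = "cmod c"]) auto

text \<open>
  On the unit circle a polynomial in the real and the imaginary part is a trigonometric polynomial.
  The induction avoids expanding it: \<open>H h\<close> says that all coefficients of \<open>g * h\<close> vanish, and this
  class of functions \<open>h\<close> is closed under sums and under multiplication by any such polynomial.
\<close>
lemma integral_real_polynomial_cis_eq_0:
  fixes g :: "real \<Rightarrow> complex"
  assumes g: "integrable circle g"
    and zero: "\<And>m::int. (LINT x|circle. g x * cis (2 * pi * real l * of_int m * x)) = 0"
    and p: "real_polynomial_function p"
  shows "(LINT x|circle. g x * complex_of_real (p (cis (2 * pi * real l * x)))) = 0"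
proof -
  define c where "c m x = cis (2 * pi * real l * of_int m * x)" for m :: int and x
  define H where "H h \<longleftrightarrow> bounded_multiplier h \<and> (\<forall>m. (LINT x|circle. g x * (h x * c m x)) = 0)" for h
  have c_bm: "bounded_multiplier (c m)" for m
    unfolding c_def by (rule bounded_multiplier_cis)
  have c_add: "c m x * c n x = c (m + n) x" for m n x
    by (simp add: c_def cis_mult algebra_simps)
  have int: "integrable circle (\<lambda>x. g x * (h x * c m x))" if "bounded_multiplier h" for h m
    by (intro integrable_mult_bounded_multiplier[OF g] bounded_multiplier_mult that c_bm)
  have H_add: "H (\<lambda>x. h x + k x)" if "H h" "H k" for h k
    using that int[of h] int[of k]
    by (auto simp: H_def bounded_multiplier_add distrib_left distrib_right)
  have H_scale: "H (\<lambda>x. h x * a)" if "H h" for h a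
  proof -
    have "(\<lambda>x. g x * (h x * a * c m x)) = (\<lambda>x. g x * (h x * c m x) * a)" for m
      by (simp add: mult_ac)
    then show ?thesis using that
      by (simp only: H_def bounded_multiplier_mult bounded_multiplier_const integral_mult_left_zero) simp
  qed
  have H_c: "H (\<lambda>x. h x * c n x)" if "H h" for h n
    using that by (auto simp: H_def bounded_multiplier_mult c_bm mult.assoc c_add)
  have "H (\<lambda>x. h x * complex_of_real (p (c 1 x)))" if "H h" for h
    using p that
  proof (induction arbitrary: h rule: real_polynomial_function.induct)
    case (linear f)
    define \<alpha> where "\<alpha> = Complex (f 1 / 2) (- (f \<i> / 2))"
    have f_eq: "f z = Re z * f 1 + Im z * f \<i>" for z
    proof -
      have "f z = f (Re z *\<^sub>R 1 + Im z *\<^sub>R \<i>)"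
        by (rule arg_cong[of _ _ f]) (simp add: complex_eq_iff)
      also have "\<dots> = Re z * f 1 + Im z * f \<i>"
        using linear(1) by (simp only: linear_add linear_scale bounded_linear.linear real_scaleR_def)
      finally show ?thesis .
    qed
    have "complex_of_real (f (c 1 x)) = c 1 x * \<alpha> + c (-1) x * cnj \<alpha>" for x
      by (subst f_eq) (simp add: complex_eq_iff \<alpha>_def c_def)
    then show ?case
      using H_add[OF H_scale[OF H_c[OF linear(2), of 1], of \<alpha>] H_scale[OF H_c[OF linear(2), of "-1"], of "cnj \<alpha>"]]
      by (simp add: distrib_left mult.assoc)
  next
    case (const a)
    then show ?case by (intro H_scale)
  next
    case (add f1 f2)
    show ?case using H_add[OF add(3)[OF add(5)] add(4)[OF add(5)]] by (simp add: distrib_left)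
  next
    case (mult f1 f2)
    show ?case using mult(4)[OF mult(3)[OF mult(5)]] by (simp add: mult.assoc)
  qed
  moreover have "H (\<lambda>x. 1)"
    using zero by (auto simp: H_def c_def bounded_multiplier_const)
  ultimately have "H (\<lambda>x. 1 * complex_of_real (p (c 1 x)))" by blast
  then have "(LINT x|circle. g x * (complex_of_real (p (c 1 x)) * c 0 x)) = 0"
    unfolding H_def by auto
  then show ?thesis by (simp add: c_def)
qed

text \<open>
  By the Stone-Weierstrass theorem on the unit circle and the integrability of \<open>g\<close>.
\<close>
lemma integral_continuous_cis_eq_0:
  fixes g :: "real \<Rightarrow> complex" and F :: "complex \<Rightarrow> real"
  assumes g: "integrable circle g"
    and zero: "\<And>m::int. (LINT x|circle. g x * cis (2 * pi * real l * of_int m * x)) = 0"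
    and F: "continuous_on UNIV F"
  shows "(LINT x|circle. g x * complex_of_real (F (cis (2 * pi * real l * x)))) = 0"
    (is "?I = 0")
proof -
  let ?w = "\<lambda>x. cis (2 * pi * real l * x)"
  have bm: "bounded_multiplier (\<lambda>x. complex_of_real (f (?w x)))" if f: "continuous_on UNIV f" for f :: "complex \<Rightarrow> real"
  proof -
    have "bounded (f ` sphere 0 1)"
      by (intro compact_imp_bounded compact_continuous_image continuous_on_subset[OF f]) auto
    then obtain K where "\<And>z. z \<in> sphere 0 1 \<Longrightarrow> \<bar>f z\<bar> \<le> K"
      unfolding bounded_iff by (metis image_eqI real_norm_def)
    then show ?thesis
      by (intro bounded_multiplierI[where K = K] borel_measurable_continuous_onI continuous_intros
          continuous_on_compose2[OF f]) auto
  qed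
  have "cmod ?I \<le> e * (LINT x|circle. cmod (g x))" if e: "e > 0" for e
  proof -
    obtain p where p: "real_polynomial_function p" "\<And>z. z \<in> sphere 0 1 \<Longrightarrow> \<bar>F z - p z\<bar> < e"
      using Stone_Weierstrass_real_polynomial_function[of "sphere 0 1" F e] continuous_on_subset[OF F] e
      by auto
    have p': "continuous_on UNIV p"
      using p(1) by (intro continuous_on_polymonial_function) (simp add: real_polynomial_function_eq)
    have iF: "integrable circle (\<lambda>x. g x * complex_of_real (F (?w x)))"
      and ip: "integrable circle (\<lambda>x. g x * complex_of_real (p (?w x)))"
      by (intro integrable_mult_bounded_multiplier[OF g] bm F p')+
    define D where "D x = g x * complex_of_real (F (?w x)) - g x * complex_of_real (p (?w x))" for x
    have "?I = integral\<^sup>L circle D"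
      unfolding D_def using iF ip integral_real_polynomial_cis_eq_0[OF g zero p(1)] by simp
    then have "cmod ?I \<le> (LINT x|circle. cmod (D x))"
      by (simp only: integral_norm_bound)
    also have "(LINT x|circle. cmod (D x)) \<le> (LINT x|circle. e * cmod (g x))"
    proof (rule integral_mono)
      show "integrable circle (\<lambda>x. cmod (D x))" unfolding D_def using iF ip by auto
      fix x
      have "cmod (D x) = cmod (g x) * \<bar>F (?w x) - p (?w x)\<bar>"
        by (simp flip: right_diff_distrib of_real_diff add: D_def norm_mult)
      also have "\<dots> \<le> cmod (g x) * e"
        by (intro mult_left_mono less_imp_le[OF p(2)]) auto
      finally show "cmod (D x) \<le> e * cmod (g x)"
        by (simp add: mult.commute)
    qed (use g in auto)
    finally show ?thesis by simp
  qed
  then have "cmod ?I \<le> e" if "e > 0" for e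
  proof -
    define K where "K = (LINT x|circle. cmod (g x)) + 1"
    have K: "K > 0" unfolding K_def by (smt (verit) integral_nonneg_AE AE_I2 norm_ge_zero)
    have "cmod ?I \<le> (e / K) * (K - 1)"
      using \<open>\<And>e. e > 0 \<Longrightarrow> cmod ?I \<le> e * (LINT x|circle. cmod (g x))\<close>[of "e / K"] that K by (simp add: K_def)
    also have "\<dots> \<le> (e / K) * K" using that K by (intro mult_left_mono) auto
    finally show ?thesis using K by simp
  qed
  then have "cmod ?I \<le> 0 + e" if "e > 0" for e using that by simp
  then have "cmod ?I \<le> 0" by (rule field_le_epsilon)
  then show ?thesis by simp
qed

text \<open>
  The map \<open>w x = cis (2 * pi * l * x)\<close> is injective on the interior of the band and maps only
  end points to \<open>- 1\<close>, so, within the closed band, the part of \<open>U\<close> in the interior is the preimage of the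
  complement of a compact set \<open>C\<close>. Its indicator is the pointwise limit of the continuous functions
  \<open>min 1 (n * infdist z C)\<close> of \<open>z = w x\<close>.
\<close>
lemma integral_open_indicator_eq_0:
  fixes g :: "real \<Rightarrow> complex"
  assumes l: "l \<ge> 1" and g: "integrable circle g"
    and band: "AE x in circle. x \<notin> band l \<longrightarrow> g x = 0"
    and zero: "\<And>m::int. (LINT x|circle. g x * cis (2 * pi * real l * of_int m * x)) = 0"
    and U: "open U"
  shows "(LINT x|circle. indicator U x *\<^sub>R g x) = 0"
proof -
  define r where "r = 1 / (2 * real l)"
  define w where "w x = cis (2 * pi * real l * x)" for x
  define V where "V = U \<inter> {-r<..<r}"
  define C where "C = w ` ({-r..r} - V)"
  define F where "F n z = min 1 (real n * infdist z C)" for n z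
  have V_borel: "V \<in> sets borel" using U by (auto simp: V_def)
  have r: "r > 0" using l by (simp add: r_def)
  have [measurable]: "g \<in> borel_measurable circle" using g by auto
  have "r \<in> {-r..r} - V" using r by (auto simp: V_def)
  then have C_ne: "C \<noteq> {}" unfolding C_def by blast
  have "compact ({-r..r} - V)"
    using U by (intro compact_diff) (auto simp: V_def)
  then have "compact C"
    unfolding C_def w_def by (intro compact_continuous_image continuous_intros)
  then have C_closed: "closed C" by (rule compact_imp_closed)
  have inj: "x = y" if xy: "w x = w y" "x \<in> {-r<..<r}" "y \<in> {-r..r}" for x y
  proof -
    obtain n :: int where "\<i> * complex_of_real (2 * pi * real l * x)
        = \<i> * complex_of_real (2 * pi * real l * y) + of_int (2 * n) * pi * \<i>"
      using xy(1) unfolding w_def cis_conv_exp exp_eq by auto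
    then have "2 * pi * real l * x = 2 * pi * real l * y + 2 * of_int n * pi"
      by (simp add: complex_eq_iff)
    then have "2 * pi * (real l * (x - y)) = 2 * pi * of_int n"
      by (simp add: right_diff_distrib mult_ac)
    then have n: "real l * (x - y) = of_int n" by simp
    have "\<bar>x - y\<bar> < 2 * r" using xy by auto
    then have "real l * \<bar>x - y\<bar> < real l * (2 * r)" using l by (intro mult_strict_left_mono) auto
    then have "\<bar>real l * (x - y)\<bar> < 1" using l by (simp add: r_def abs_mult)
    then have "n = 0" unfolding n by linarith
    then show ?thesis using n l by simp
  qed
  have notC: "w x \<in> C \<longleftrightarrow> x \<notin> V" if "x \<in> {-r..r}" for x
    using that inj unfolding C_def V_def by auto blast+
  have F_cont: "continuous_on UNIV (F n)" for n
    unfolding F_def by (intro continuous_intros)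
  have "(\<lambda>n. LINT x|circle. complex_of_real (F n (w x)) * g x) \<longlonglongrightarrow> (LINT x|circle. indicator V x *\<^sub>R g x)"
  proof (rule integral_dominated_convergence[where w = "\<lambda>x. cmod (g x)"])
    show "(\<lambda>x. indicator V x *\<^sub>R g x) \<in> borel_measurable circle"
      using V_borel by (intro borel_measurable_scaleR borel_measurable_indicator_circle) auto
    show "(\<lambda>x. complex_of_real (F n (w x)) * g x) \<in> borel_measurable circle" for n
    proof (rule borel_measurable_times[OF borel_measurable_circle])
      show "(\<lambda>x. complex_of_real (F n (w x))) \<in> borel_measurable borel"
        unfolding w_def
        by (intro borel_measurable_continuous_onI continuous_intros continuous_on_compose2[OF F_cont]) auto
    qed measurable
    show "AE x in circle. cmod (complex_of_real (F n (w x)) * g x) \<le> cmod (g x)" for n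
      by (auto simp: F_def norm_mult infdist_nonneg intro!: mult_left_le_one_le)
    show "AE x in circle. (\<lambda>n. complex_of_real (F n (w x)) * g x) \<longlonglongrightarrow> indicator V x *\<^sub>R g x"
      using band
    proof eventually_elim
      case (elim x)
      show ?case
      proof (cases "x \<in> band l")
        case True
        then have x: "x \<in> {-r..r}" by (auto simp: band_eq[OF l] r_def)
        have "(\<lambda>n. F n (w x)) \<longlonglongrightarrow> indicator V x"
        proof (cases "x \<in> V")
          case True
          then have "infdist (w x) C > 0"
            using notC[OF x] infdist_pos_not_in_closed[OF C_closed C_ne] by blast
          then have "eventually (\<lambda>n. 1 \<le> real n * infdist (w x) C) sequentially"
            by real_asymp
          then have "eventually (\<lambda>n. F n (w x) = 1) sequentially"
            by eventually_elim (simp add: F_def)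
          then show ?thesis using True by (simp add: tendsto_eventually)
        next
          case False
          then have "infdist (w x) C = 0" using notC[OF x] by simp
          then show ?thesis using False by (simp add: F_def)
        qed
        then show ?thesis
          unfolding scaleR_conv_of_real by (intro tendsto_intros)
      qed (use elim in simp)
    qed
  qed (use g in auto)
  moreover have "(LINT x|circle. complex_of_real (F n (w x)) * g x) = 0" for n
    using integral_continuous_cis_eq_0[OF g zero F_cont] by (simp add: w_def mult.commute)
  ultimately have V0: "(LINT x|circle. indicator V x *\<^sub>R g x) = 0"
    by (simp add: LIMSEQ_const_iff)
  have "{-r, r} \<in> null_sets lborel" by (rule finite_imp_null_set_lborel) simp
  note AE_circle_not_in_null[OF this]
  with band have "AE x in circle. indicator U x *\<^sub>R g x = indicator V x *\<^sub>R g x"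
  proof eventually_elim
    case (elim x)
    show ?case
    proof (cases "x \<in> band l")
      case True
      then have "x \<in> {-r<..<r}" using elim(2) by (auto simp: band_eq[OF l] r_def)
      then show ?thesis by (simp add: V_def indicator_def)
    qed (use elim in simp)
  qed
  then have "(LINT x|circle. indicator U x *\<^sub>R g x) = (LINT x|circle. indicator V x *\<^sub>R g x)"
    using V_borel U
    by (intro integral_cong_AE borel_measurable_scaleR borel_measurable_indicator_circle) auto
  then show ?thesis using V0 by simp
qed

text \<open>
  The sets over which the integral of \<open>g\<close> vanishes form a Dynkin system containing the open sets.
\<close>
lemma integral_borel_indicator_eq_0:
  fixes g :: "real \<Rightarrow> complex"
  assumes g: "integrable circle g"
    and U: "\<And>U. open U \<Longrightarrow> (LINT x|circle. indicator U x *\<^sub>R g x) = 0"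
    and A: "A \<in> sets borel"
  shows "(LINT x|circle. indicator A x *\<^sub>R g x) = 0"
proof -
  have [measurable]: "g \<in> borel_measurable circle" using g by auto
  have int: "integrable circle (\<lambda>x. indicator A x *\<^sub>R g x)" if "A \<in> sets borel" for A
  proof (rule Bochner_Integration.integrable_bound[OF g])
    show "(\<lambda>x. indicator A x *\<^sub>R g x) \<in> borel_measurable circle"
      using that by (intro borel_measurable_scaleR borel_measurable_indicator_circle) auto
  qed (auto simp: indicator_def)
  have "Int_stable {S :: real set. open S}" by (auto simp: Int_stable_def)
  moreover have "{S :: real set. open S} \<subseteq> Pow UNIV" by simp
  moreover have "A \<in> sigma_sets UNIV {S. open S}" using A by (simp add: borel_def)
  ultimately show ?thesis
  proof (induction rule: sigma_sets_induct_disjoint[of "{S. open S}" UNIV, consumes 3, case_names basic empty compl union])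
    case (basic A)
    then show ?case using U by simp
  next
    case (compl A)
    have A: "A \<in> sets borel" using compl by (simp add: borel_def)
    have "(LINT x|circle. indicator (UNIV - A) x *\<^sub>R g x)
        = (LINT x|circle. indicator UNIV x *\<^sub>R g x - indicator A x *\<^sub>R g x)"
      by (intro Bochner_Integration.integral_cong) (auto simp: indicator_def)
    also have "\<dots> = 0" using int[OF A] U[of UNIV] compl by (simp add: g)
    finally show ?case .
  next
    case (union B)
    have B: "B i \<in> sets borel" for i using union by (auto simp: borel_def)
    have "(\<lambda>n. LINT x|circle. (\<Sum>i<n. indicator (B i) x) *\<^sub>R g x)
        \<longlonglongrightarrow> (LINT x|circle. indicator (\<Union>i. B i) x *\<^sub>R g x)"
    proof (rule integral_dominated_convergence[where w = "\<lambda>x. cmod (g x)"])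
      have s: "(\<lambda>i. indicator (B i) x :: real) sums indicator (\<Union>i. B i) x" for x
        using union(1) by (intro indicator_sums) (auto simp: disjoint_family_on_def)
      then show "AE x in circle. (\<lambda>n. (\<Sum>i<n. indicator (B i) x) *\<^sub>R g x)
          \<longlonglongrightarrow> indicator (\<Union>i. B i) x *\<^sub>R g x"
        by (auto simp: sums_def intro!: tendsto_intros)
      have "(\<Sum>i<n. indicator (B i) x :: real) \<le> indicator (\<Union>i. B i) x" for n x
        using sum_le_suminf[OF sums_summable[OF s], of "{..<n}" x] sums_unique[OF s, of x] by simp
      then have "(\<Sum>i<n. indicator (B i) x :: real) \<le> 1" for n x
        by (rule order.trans) (simp add: indicator_def)
      then have "norm ((\<Sum>i<n. indicator (B i) x) *\<^sub>R g x) \<le> cmod (g x)" for n x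
        by (simp add: abs_of_nonneg sum_nonneg mult_left_le_one_le)
      then show "AE x in circle. norm ((\<Sum>i<n. indicator (B i) x) *\<^sub>R g x) \<le> cmod (g x)" for n
        by simp
    qed (use g B in \<open>auto intro!: borel_measurable_scaleR borel_measurable_indicator_circle borel_measurable_sum\<close>)
    moreover have "(LINT x|circle. (\<Sum>i<n. indicator (B i) x) *\<^sub>R g x) = 0" for n
      unfolding scaleR_left.sum
      by (subst Bochner_Integration.integral_sum) (simp_all only: int[OF B] union(3) sum.neutral_const)
    ultimately show ?case by (simp add: LIMSEQ_const_iff)
  qed auto
qed

lemma AE_eq_0_if_integral_borel_eq_0:
  fixes g :: "real \<Rightarrow> complex"
  assumes g: "integrable circle g"
    and A: "\<And>A. A \<in> sets borel \<Longrightarrow> (LINT x|circle. indicator A x *\<^sub>R g x) = 0"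
  shows "AE x in circle. g x = 0"
proof -
  interpret finite_measure circle by (rule finite_measure_circle)
  have [measurable]: "g \<in> borel_measurable circle" using g by auto
  show ?thesis
  proof (rule density_zero[OF g])
    fix A assume A': "A \<in> sets circle"
    then have "A \<in> sets (completion lborel)"
      by (auto simp: circle_def sets_restrict_space)
    then obtain S N N' where S: "A = S \<union> N" "N \<subseteq> N'" "N' \<in> null_sets lborel" "S \<in> sets lborel"
      by (rule sets_completionE)
    have "(LINT x|circle. indicator A x *\<^sub>R g x) = (LINT x|circle. indicator S x *\<^sub>R g x)"
    proof (rule integral_cong_AE)
      show "AE x in circle. indicator A x *\<^sub>R g x = indicator S x *\<^sub>R g x"
        using AE_circle_not_in_null[OF S(3)]
        by eventually_elim (use S in \<open>auto simp: indicator_def\<close>)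
    qed (use A' S in \<open>auto intro!: borel_measurable_scaleR borel_measurable_indicator_circle\<close>)
    then show "set_lebesgue_integral circle A g = 0"
      using A[of S] S by (simp add: set_lebesgue_integral_def)
  qed
qed

text \<open>
  A band of length \<open>1 / l\<close> is a full period of the frequencies \<open>l * m\<close>, so these frequencies
  suffice to determine a function supported there. For \<open>l = 1\<close> this is the uniqueness theorem for
  Fourier coefficients.
\<close>
lemma trigonometric_uniqueness:
  fixes g :: "real \<Rightarrow> complex"
  assumes "l \<ge> 1" "integrable circle g" "AE x in circle. x \<notin> band l \<longrightarrow> g x = 0"
    and "\<And>m::int. (LINT x|circle. g x * cis (2 * pi * real l * of_int m * x)) = 0"
  shows "AE x in circle. g x = 0"
  by (rule AE_eq_0_if_integral_borel_eq_0[OF assms(2)],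
      rule integral_borel_indicator_eq_0[OF assms(2)],
      rule integral_open_indicator_eq_0[OF assms])


section \<open>The Fourier transform and the sampling basis\<close>

lemma exp_eq_cis:
  "exp (2 * complex_of_real pi * \<i> * of_int k * complex_of_real \<xi>) = cis (2 * pi * of_int k * \<xi>)"
  by (simp add: cis_conv_exp mult_ac)

lemma square_integrable_bounded_multiplier: "bounded_multiplier m \<Longrightarrow> square_integrable m"
  using square_integrable_mult[of m "\<lambda>_. 1"] square_integrable_bounded[of "\<lambda>_. 1" 1] by simp

lemma bounded_multiplier_indicator: "S \<in> sets borel \<Longrightarrow> bounded_multiplier (indicator S)"
  by (rule bounded_multiplierI[where K = 1]) (auto simp: indicator_def)

lemma square_integrable_cis: "square_integrable (\<lambda>\<xi>. cis (c * \<xi>))"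
  by (intro square_integrable_bounded_multiplier bounded_multiplier_cis)

lemma character_eq: "character k = L2_of (\<lambda>\<xi>. cis (2 * pi * of_int k * \<xi>))"
  unfolding character_def by (simp add: exp_eq_cis)

lemma band_basis_eq:
  "band_basis l m = complex_of_real (sqrt l) *\<^sub>C mult_op (indicator (band l)) (character (int l * m))"
proof -
  have "complex_of_real (sqrt l) *\<^sub>C mult_op (indicator (band l)) (character (int l * m))
      = L2_of (\<lambda>\<xi>. complex_of_real (sqrt l) * (indicator (band l) \<xi> * cis (2 * pi * of_int (int l * m) * \<xi>)))"
    unfolding character_eq
    by (subst mult_op_L2_of[OF bounded_multiplier_indicator[OF band_borel] square_integrable_cis])
      (intro L2_of_scaleC square_integrable_mult bounded_multiplier_indicator band_borel square_integrable_cis)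
  then show ?thesis
    unfolding band_basis_def exp_eq_cis[symmetric] by (simp add: mult_ac)
qed

lemma L2_on_iff:
  assumes "S \<in> sets borel"
  shows "g \<in> L2_on S \<longleftrightarrow> mult_op (indicator S) g = g"
proof (rule L2_cases[of g])
  fix f assume f: "square_integrable f" "g = L2_of f"
  have "(AE x in circle. indicator S x * f x = f x) \<longleftrightarrow> (AE x in circle. x \<notin> S \<longrightarrow> f x = 0)"
    by (intro AE_cong) (auto simp: indicator_def)
  then show ?thesis
    using f by (simp add: L2_on_def zero_outside.abs_eq circle_ae_eq_refl mult_op_L2_of L2_of_eq_iff
        bounded_multiplier_indicator assms square_integrable_mult)
qed

lemma subspace_L2_on:
  assumes "S \<in> sets borel" shows "subspace (L2_on S)"
proof -
  have "linear (mult_op (indicator S))"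
    using bounded_clinear_mult_op[OF bounded_multiplier_indicator[OF assms]]
    by (auto simp: bounded_clinear_def bounded_linear.linear)
  then show ?thesis
    by (auto simp: subspace_def L2_on_iff[OF assms] linear_0 linear_add linear_scale)
qed

lemma closed_L2_on:
  assumes "S \<in> sets borel" shows "closed (L2_on S)"
proof -
  have "continuous_on UNIV (mult_op (indicator S))"
    using bounded_clinear_mult_op[OF bounded_multiplier_indicator[OF assms]]
    by (auto simp: bounded_clinear_def intro: linear_continuous_on)
  then have "closed {g. mult_op (indicator S) g = g}"
    by (intro closed_Collect_eq continuous_on_id)
  moreover have "L2_on S = {g. mult_op (indicator S) g = g}" using L2_on_iff[OF assms] by blast
  ultimately show ?thesis by simp
qed

lemma mult_op_indicator_in_L2_on:
  assumes "S \<in> sets borel" shows "mult_op (indicator S) g \<in> L2_on S"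
proof -
  have "(\<lambda>\<xi>. indicator S \<xi> * indicator S \<xi> :: complex) = indicator S" by (auto simp: indicator_def)
  then show ?thesis
    by (simp add: L2_on_iff assms mult_op_mult_op bounded_multiplier_indicator)
qed

lemma scaleC_in_L2_on:
  assumes "S \<in> sets borel" "g \<in> L2_on S" shows "c *\<^sub>C g \<in> L2_on S"
  using assms bounded_clinear_mult_op[OF bounded_multiplier_indicator[OF assms(1)]]
  by (simp add: L2_on_iff bounded_clinear_def)

lemma band_basis_in_L2_on: "band_basis l m \<in> L2_on (band l)"
  unfolding band_basis_eq by (intro scaleC_in_L2_on mult_op_indicator_in_L2_on band_borel)

lemma cnj_indicator: "cnj (indicator S x) = indicator S x"
  by (simp add: indicator_def)

text \<open>
  A function supported in the band does not see the cut-off in the basis element. Its basis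
  coefficients are therefore, up to a factor, its Fourier coefficients at multiples of \<open>l\<close>, which
  is why sampling appears.
\<close>
lemma cinner_band_basis:
  assumes "g \<in> L2_on (band l)"
  shows "cinner g (band_basis l m) = complex_of_real (sqrt l) * cinner g (character (int l * m))"
  using assms cinner_mult_op[OF bounded_multiplier_indicator[OF band_borel[of l]], of g "character (int l * m)"]
  by (simp add: band_basis_eq cinner_scaleC_right L2_on_iff cnj_indicator)

lemma AE_circle_interval: "AE x in circle. x \<in> {-1/2..<1/2}"
  unfolding circle_def by (rule AE_I2) auto

text \<open>
  The Fourier transform of the characteristic function of the band.
\<close>
lemma integral_band_cis:
  assumes l: "l \<ge> 1"
  shows "(LINT x|circle. indicator (band l) x * cis (2 * pi * t * x)) = complex_of_real (sinc (t / real l) / real l)"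
proof -
  define r where "r = 1 / (2 * real l)"
  have cis_borel: "(\<lambda>x. cis (2 * pi * t * x)) \<in> borel_measurable borel"
    using bounded_multiplier_cis by (auto simp: bounded_multiplier_def)
  have r: "r > 0" "r \<le> 1/2" using l by (auto simp: r_def field_simps)
  define F where "F x = (if t = 0 then complex_of_real x else cis (2 * pi * t * x) / (2 * pi * t * \<i>))" for x
  have F: "(F has_vector_derivative cis (2 * pi * t * x)) (at x within A)" for x A
  proof (cases "t = 0")
    case True
    then show ?thesis by (auto simp: F_def[abs_def] intro!: derivative_eq_intros)
  next
    case False
    have "((\<lambda>x. cis (2 * pi * t * x)) has_vector_derivative (2 * pi * t * \<i>) * cis (2 * pi * t * x)) (at x within A)"
    proof -
      have "((\<lambda>z. exp (complex_of_real (2 * pi * t) * \<i> * z)) has_field_derivative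
          complex_of_real (2 * pi * t) * \<i> * exp (complex_of_real (2 * pi * t) * \<i> * complex_of_real x)) (at (complex_of_real x))"
        by (auto intro!: derivative_eq_intros)
      from has_vector_derivative_real_field[OF this] show ?thesis
        by (simp add: cis_conv_exp mult_ac)
    qed
    from has_vector_derivative_divide[OF this, of "2 * pi * t * \<i>"] show ?thesis
      using False by (simp add: F_def[abs_def])
  qed
  have "(LINT x|circle. indicator (band l) x * cis (2 * pi * t * x))
      = (LINT x|lebesgue. indicator {-1/2..<1/2} x *\<^sub>R (indicator (band l) x * cis (2 * pi * t * x)))"
    unfolding circle_def by (rule integral_restrict_space) auto
  also have "\<dots> = (LINT x|lborel. indicator {-1/2..<1/2} x *\<^sub>R (indicator (band l) x * cis (2 * pi * t * x)))"
    by (intro integral_completion borel_measurable_scaleR borel_measurable_times) (use cis_borel in auto)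
  also have "\<dots> = (LINT x|lborel. indicator {-r..r} x *\<^sub>R cis (2 * pi * t * x))"
  proof (rule integral_cong_AE)
    have "band l = {-r..r} \<inter> {-1/2..<1/2}" by (simp add: band_eq[OF l] r_def)
    note band = this
    have "AE x in lborel. x \<noteq> 1/2" by (rule AE_lborel_singleton)
    then show "AE x in lborel. indicator {-1/2..<1/2} x *\<^sub>R (indicator (band l) x * cis (2 * pi * t * x))
        = indicator {-r..r} x *\<^sub>R cis (2 * pi * t * x)"
      by eventually_elim (use r in \<open>auto simp: band indicator_def\<close>)
  qed (intro borel_measurable_scaleR borel_measurable_times; use cis_borel in simp)+
  also have "\<dots> = F r - F (- r)"
  proof -
    have "continuous_on {-r..r} (\<lambda>x. cis (2 * pi * t * x))"
      unfolding cis_conv_exp by (intro continuous_intros)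
    then show ?thesis
      using integral_FTC_Icc[of "-r" r F "\<lambda>x. cis (2 * pi * t * x)"] r F
      by (auto simp: has_bochner_integral_iff)
  qed
  also have "\<dots> = complex_of_real (sinc (t / real l) / real l)"
  proof (cases "t = 0")
    case False
    have arg: "2 * pi * t * r = pi * (t / real l)" "2 * pi * t * (- r) = - (pi * (t / real l))"
      by (simp_all add: r_def)
    have "cis a - cis (- a) = 2 * \<i> * complex_of_real (sin a)" for a
      by (simp add: complex_eq_iff)
    then have "F r - F (- r) = 2 * \<i> * complex_of_real (sin (pi * (t / real l))) / (2 * pi * t * \<i>)"
      using False unfolding F_def by (simp only: arg if_False diff_divide_distrib[symmetric])
    also have "\<dots> = complex_of_real (sin (pi * (t / real l)) / (pi * t))"
      by simp
    finally show ?thesis using False l by (simp add: sinc_def)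
  qed (simp add: F_def sinc_def r_def)
  finally show ?thesis .
qed

lemma sinc_minus: "sinc (- x) = sinc x"
  by (simp add: sinc_def)

lemma sinc_of_int: "sinc (of_int k) = (if k = 0 then 1 else 0)"
  by (simp add: sinc_def sin_integer_2pi mult.commute sin_zero_iff_int2)

lemma cinner_band_basis_character:
  assumes "l \<ge> 1"
  shows "cinner (band_basis l m) (character k)
    = complex_of_real (sinc (of_int k / real l - of_int m) / sqrt (real l))"
proof -
  have "cinner (band_basis l m) (character k)
      = complex_of_real (sqrt l) * (LINT x|circle. indicator (band l) x * cis (2 * pi * of_int (int l * m) * x)
          * cnj (cis (2 * pi * of_int k * x)))"
    unfolding band_basis_eq cinner_scaleC_left character_eq
    by (simp add: mult_op_L2_of cinner_L2_of bounded_multiplier_indicator band_borel square_integrable_cis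
        square_integrable_mult del: of_int_mult)
  also have "(\<lambda>x. indicator (band l) x * cis (2 * pi * of_int (int l * m) * x) * cnj (cis (2 * pi * of_int k * x)))
      = (\<lambda>x. indicator (band l) x * cis (2 * pi * of_int (int l * m - k) * x))"
    by (simp add: cis_cnj cis_mult mult.assoc algebra_simps)
  also have "complex_of_real (sqrt l) * integral\<^sup>L circle \<dots>
      = complex_of_real (sqrt l * (sinc (of_int (int l * m - k) / real l) / real l))"
    by (simp only: integral_band_cis[OF assms] of_real_mult)
  also have "of_int (int l * m - k) / real l = - (of_int k / real l - of_int m)"
    using assms by (simp add: field_simps)
  also have "sqrt l * (sinc (- (of_int k / real l - of_int m)) / real l)
      = sinc (of_int k / real l - of_int m) / sqrt l"
    using assms by (simp add: sinc_minus field_simps flip: power2_eq_square)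
  finally show ?thesis .
qed

lemma orthonormal_band_basis:
  assumes "l \<ge> 1" shows "orthonormal (band_basis l)"
  unfolding orthonormal_def
proof (intro allI)
  fix m n
  have "(of_int (int l * n) / real l - of_int m) = real_of_int (n - m)"
    using assms by simp
  then show "cinner (band_basis l m) (band_basis l n) = (if m = n then 1 else 0)"
    using assms by (simp add: cinner_band_basis[OF band_basis_in_L2_on] cinner_band_basis_character
        sinc_of_int[of "n - m", unfolded of_int_diff] sinc_def[of 0] del: of_int_mult)
qed

text \<open>
  A function in \<open>L2_on (band l)\<close> orthogonal to the basis has vanishing coefficients at all
  multiples of \<open>l\<close>, so it is \<open>0\<close> by trigonometric uniqueness.
\<close>
lemma band_basis_has_sum:
  assumes l: "l \<ge> 1" and g: "g \<in> L2_on (band l)"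
  shows "((\<lambda>m. cinner g (band_basis l m) *\<^sub>C band_basis l m) has_sum g) UNIV"
proof (rule orthonormal_expansion[OF orthonormal_band_basis[OF l] _ _ _ _ g])
  fix y assume y: "y \<in> L2_on (band l)" and 0: "\<And>m. cinner y (band_basis l m) = 0"
  obtain f where f: "square_integrable f" "y = L2_of f" by (rule L2_cases)
  have "(LINT x|circle. f x * cis (2 * pi * real l * of_int m * x)) = 0" for m
  proof -
    have "cinner y (character (int l * - m)) = 0"
      using 0[of "- m"] cinner_band_basis[OF y, of "- m"] l by auto
    also have "cinner y (character (int l * - m)) = (LINT x|circle. f x * cnj (cis (2 * pi * of_int (int l * - m) * x)))"
      unfolding f(2) character_eq by (rule cinner_L2_of[OF f(1) square_integrable_cis])
    finally show ?thesis by (simp add: cis_cnj mult_ac)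
  qed
  moreover have "AE x in circle. x \<notin> band l \<longrightarrow> f x = 0"
    using y f by (simp add: L2_on_def zero_outside.abs_eq circle_ae_eq_refl)
  moreover have "integrable circle f"
    using f(1) square_integrable_imp_integrable_norm[OF f(1)]
    by (subst (asm) integrable_norm_iff) (auto simp: square_integrable_def)
  ultimately have "AE x in circle. f x = 0" by (intro trigonometric_uniqueness[OF l])
  then show "y = 0"
    using f by (simp add: zero_L2_circle_def L2_of_eq_iff square_integrable_zero)
qed (auto intro: subspace_L2_on closed_L2_on scaleC_in_L2_on band_basis_in_L2_on)

lemma mult_op_1 [simp]: "mult_op (\<lambda>_. 1) g = g"
  by (rule L2_cases[of g]) (simp add: mult_op_L2_of bounded_multiplier_const)

text \<open>
  For \<open>l = 1\<close> the band is the whole circle, so completeness of the characters is a special case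
  of completeness of the sampling basis.
\<close>
lemma character_eq_band_basis: "character k = band_basis 1 k" and L2_on_band_1: "g \<in> L2_on (band 1)"
proof -
  have "mult_op (indicator (band 1)) g = g" for g
  proof (rule L2_cases[of g])
    fix f assume f: "square_integrable f" "g = L2_of f"
    have "AE x in circle. indicator (band 1) x * f x = f x"
      using AE_circle_interval by eventually_elim (auto simp: band_eq)
    then show ?thesis
      using f by (simp add: mult_op_L2_of L2_of_eq_iff bounded_multiplier_indicator square_integrable_mult)
  qed
  then show "character k = band_basis 1 k" "g \<in> L2_on (band 1)"
    by (auto simp: band_basis_eq L2_on_iff)
qed

lemma orthonormal_character: "orthonormal character"
  using orthonormal_band_basis[of 1] unfolding character_eq_band_basis[abs_def] by simp

lemma character_has_sum: "((\<lambda>k. cinner g (character k) *\<^sub>C character k) has_sum g) UNIV"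
  using band_basis_has_sum[OF order.refl L2_on_band_1] unfolding character_eq_band_basis .

lemma L2_circle_eqI: "(\<And>k. cinner g (character k) = cinner h (character k)) \<Longrightarrow> g = h"
  using character_has_sum[of g] character_has_sum[of h] has_sum_unique by auto

lemma square_summable_ell2_apply: "square_summable (ell2_apply f)"
  using ell2_apply by auto

lemma fourier_has_sum: "((\<lambda>k. ell2_apply f k *\<^sub>C character k) has_sum fourier f) UNIV"
  unfolding fourier_def
  using square_summable_ell2_apply[of f, unfolded square_summable_def]
  by (intro has_sum_infsum orthonormal_summable orthonormal_character)

lemma cinner_fourier_character: "cinner (fourier f) (character k) = ell2_apply f k"
  by (rule cinner_orthonormal_has_sum[OF orthonormal_character fourier_has_sum])

lemma square_summable_coefficients: "square_summable (\<lambda>k. cinner g (character k))"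
  unfolding square_summable_def by (rule bessel_summable[OF orthonormal_character])

lemma fourier_ell2_of: "fourier (ell2_of (\<lambda>k. cinner g (character k))) = g"
  by (rule L2_circle_eqI)
    (simp add: cinner_fourier_character ell2_of_inverse square_summable_coefficients)

lemma bij_fourier: "bij fourier"
proof (rule bijI)
  show "inj fourier"
    by (rule injI) (metis cinner_fourier_character ell2_apply_inject ext)
  show "surj fourier"
    using fourier_ell2_of by (metis surj_def)
qed

lemma fourier_inv [simp]: "fourier (inv fourier g) = g" "inv fourier (fourier f) = f"
  using bij_fourier by (auto simp: bij_is_surj surj_f_inv_f bij_is_inj)

lemma ell2_apply_inv_fourier: "ell2_apply (inv fourier g) k = cinner g (character k)"
  by (metis cinner_fourier_character fourier_inv(1))

lemma cinner_fourier: "cinner (fourier f) (fourier g) = cinner f g"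
proof -
  have "((\<lambda>k. cinner (fourier f) (ell2_apply g k *\<^sub>C character k)) has_sum cinner (fourier f) (fourier g)) UNIV"
    using has_sum_bounded_linear[OF bounded_linear_cinner_right fourier_has_sum[of g]] by (simp add: o_def)
  then have "((\<lambda>k. ell2_apply f k * cnj (ell2_apply g k)) has_sum cinner (fourier f) (fourier g)) UNIV"
    by (simp add: cinner_scaleC_right cinner_fourier_character mult.commute)
  then show ?thesis by (simp add: cinner_ell2.rep_eq infsumI)
qed

lemma norm_fourier [simp]: "norm (fourier f) = norm f"
  by (simp add: norm_eq_sqrt_inner inner_eq_Re_cinner cinner_fourier)

lemma bounded_clinear_fourier: "bounded_clinear fourier"
proof -
  have add: "fourier (f + g) = fourier f + fourier g" for f g
    by (rule L2_circle_eqI) (simp add: cinner_fourier_character cinner_add_left plus_ell2.rep_eq)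
  have sc: "fourier (c *\<^sub>C f) = c *\<^sub>C fourier f" for c f
    by (rule L2_circle_eqI) (simp add: cinner_fourier_character cinner_scaleC_left scaleC_ell2.rep_eq)
  show ?thesis unfolding bounded_clinear_def
    by (auto simp: add sc scaleR_eq_scaleC intro!: bounded_linear_intro[where K = 1])
qed

lemma bounded_clinear_inv_fourier: "bounded_clinear (inv fourier)"
proof -
  have add: "inv fourier (x + y) = inv fourier x + inv fourier y" for x y
    by (rule injD[OF bij_is_inj[OF bij_fourier]])
      (use bounded_clinear_fourier in \<open>simp add: bounded_clinear_def linear_add bounded_linear.linear\<close>)
  have sc: "inv fourier (c *\<^sub>C f) = c *\<^sub>C inv fourier f" for c f
    by (rule injD[OF bij_is_inj[OF bij_fourier]])
      (use bounded_clinear_fourier in \<open>simp add: bounded_clinear_def\<close>)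
  have "norm (inv fourier x) = norm x" for x by (metis fourier_inv(1) norm_fourier)
  then show ?thesis unfolding bounded_clinear_def
    by (auto simp: add sc scaleR_eq_scaleC intro!: bounded_linear_intro[where K = 1])
qed

lemma phi_bounds: "0 \<le> \<phi> \<xi>" "\<phi> \<xi> \<le> 2"
  using cos_ge_minus_one[of "2 * pi * \<xi>"] cos_le_one[of "2 * pi * \<xi>"] by (auto simp: \<phi>_def)

lemma bounded_multiplier_phi: "bounded_multiplier (\<lambda>\<xi>. complex_of_real (\<phi> \<xi>))"
proof (rule bounded_multiplierI[where K = 2])
  fix \<xi> show "cmod (complex_of_real (\<phi> \<xi>)) \<le> 2"
    by (simp add: phi_bounds)
qed (auto simp: \<phi>_def intro!: borel_measurable_continuous_onI continuous_intros)

lemma cinner_mult_op_phi: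
  "cinner (mult_op (\<lambda>\<xi>. complex_of_real (\<phi> \<xi>)) g) h = cinner g (mult_op (\<lambda>\<xi>. complex_of_real (\<phi> \<xi>)) h)"
  using cinner_mult_op[OF bounded_multiplier_phi, of g h] by simp

lemma mult_op_phi_character:
  "mult_op (\<lambda>\<xi>. complex_of_real (\<phi> \<xi>)) (character k)
    = character k + (- 1/2) *\<^sub>C (character (k + 1) + character (k - 1))"
proof -
  have eq: "complex_of_real (\<phi> \<xi>) * cis (2 * pi * of_int k * \<xi>)
    = cis (2 * pi * of_int k * \<xi>) + (- 1/2) *
       (cis (2 * pi * of_int (k + 1) * \<xi>) + cis (2 * pi * of_int (k - 1) * \<xi>))" for \<xi>
    by (simp add: complex_eq_iff \<phi>_def algebra_simps cos_add sin_add cos_diff sin_diff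
        add_divide_distrib diff_divide_distrib)
  show ?thesis
    unfolding character_eq
    by (simp only: mult_op_L2_of[OF bounded_multiplier_phi square_integrable_cis] eq
        L2_of_add L2_of_scaleC square_integrable_add square_integrable_scale square_integrable_cis)
qed

text \<open>
  On characters, multiplication by \<open>\<phi> = 1 - (z + 1 / z) / 2\<close> is the Laplace stencil.
\<close>
lemma fourier_laplacian: "fourier (laplacian f) = mult_op (\<lambda>\<xi>. complex_of_real (\<phi> \<xi>)) (fourier f)"
  by (rule L2_circle_eqI)
    (simp add: cinner_mult_op_phi mult_op_phi_character cinner_fourier_character cinner_add_right
      cinner_scaleC_right laplacian.rep_eq field_simps)


section \<open>Spectral measures and the Bernstein characterization\<close>

lemma orthogonal_projection_norm:
  assumes "orthogonal_projection P"
  shows "(norm (P x))\<^sup>2 = inner (P x) x"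
proof -
  have "cinner (P x) (P x) = cinner (P x) x"
    using assms unfolding orthogonal_projection_def by metis
  then show ?thesis by (simp add: power2_norm_eq_inner inner_eq_Re_cinner)
qed

lemma orthogonal_projection_norm_le:
  assumes "orthogonal_projection P" shows "norm (P x) \<le> norm x"
proof -
  have "norm (P x) * norm (P x) \<le> norm (P x) * norm x"
    using orthogonal_projection_norm[OF assms, of x] norm_cauchy_schwarz[of "P x" x]
    by (simp add: power2_eq_square)
  then show ?thesis by (cases "norm (P x) = 0") auto
qed

lemma bounded_clinear_linear: "bounded_clinear A \<Longrightarrow> linear A"
  by (simp add: bounded_clinear_def bounded_linear.linear)

locale pvm =
  fixes E :: "real set \<Rightarrow> 'a::complex_inner \<Rightarrow> 'a"
  assumes E: "projection_valued_measure E"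
begin

lemma proj: "B \<in> sets borel \<Longrightarrow> orthogonal_projection (E B)"
  and E_UNIV: "E UNIV x = x"
  and E_Int: "B \<in> sets borel \<Longrightarrow> C \<in> sets borel \<Longrightarrow> E (B \<inter> C) x = E B (E C x)"
  and E_sums: "range F \<subseteq> sets borel \<Longrightarrow> disjoint_family F \<Longrightarrow> (\<lambda>n::nat. E (F n) x) sums E (\<Union>n. F n) x"
  using E unfolding projection_valued_measure_def by auto

lemma E_linear: "B \<in> sets borel \<Longrightarrow> linear (E B)"
  using proj by (auto simp: orthogonal_projection_def bounded_clinear_linear)

lemma E_range: "B \<in> sets borel \<Longrightarrow> x \<in> range (E B) \<longleftrightarrow> E B x = x"
  using proj[of B] unfolding orthogonal_projection_def by (metis rangeE rangeI)

lemma E_empty: "E {} x = 0"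
proof -
  have "(\<lambda>n::nat. E {} x) sums E {} x"
    using E_sums[of "\<lambda>_. {}" x] by (simp add: disjoint_family_on_def)
  then have "(\<lambda>n::nat. E {} x) \<longlonglongrightarrow> 0" by (rule summable_LIMSEQ_zero[OF sums_summable])
  then show ?thesis by (simp add: LIMSEQ_const_iff)
qed

lemma E_Compl:
  assumes B: "B \<in> sets borel" shows "E B x + E (- B) x = x"
proof -
  define F where "F n = (if n = 0 then B else if n = 1 then - B else {})" for n :: nat
  have "(\<lambda>n. E (F n) x) sums E (\<Union>n. F n) x"
    using B by (intro E_sums) (auto simp: F_def disjoint_family_on_def)
  moreover have "(\<lambda>n. E (F n) x) sums (\<Sum>n\<in>{0,1}. E (F n) x)"
    by (rule sums_finite) (auto simp: F_def E_empty)
  moreover have "(\<Union>n. F n) = UNIV"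
    using UN_I[of 0 UNIV _ F] UN_I[of 1 UNIV _ F] by (auto simp: F_def)
  ultimately show ?thesis using sums_unique2 by (fastforce simp: F_def E_UNIV)
qed

lemma space_scalar_measure [simp]: "space (scalar_measure E x) = UNIV"
  by (simp add: scalar_measure_def space_measure_of)

lemma sets_scalar_measure [simp, measurable_cong]: "sets (scalar_measure E x) = sets borel"
  using sets.sigma_sets_eq[of "borel :: real measure"] by (simp add: scalar_measure_def sets_measure_of)

text \<open>
  Since \<open>E B\<close> is an orthogonal projection, \<open>(norm (E B x))\<^sup>2 = inner (E B x) x\<close> depends linearly
  on \<open>E B x\<close>, so countable additivity is inherited from \<open>E\<close>.
\<close>
lemma emeasure_scalar_measure:
  assumes "B \<in> sets borel"
  shows "emeasure (scalar_measure E x) B = ennreal ((norm (E B x))\<^sup>2)"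
proof (rule emeasure_measure_of[OF scalar_measure_def])
  show "positive (sets (scalar_measure E x)) (\<lambda>B. ennreal ((norm (E B x))\<^sup>2))"
    by (simp add: positive_def E_empty)
  show "countably_additive (sets (scalar_measure E x)) (\<lambda>B. ennreal ((norm (E B x))\<^sup>2))"
  proof (rule countably_additiveI)
    fix F :: "nat \<Rightarrow> real set"
    assume F: "range F \<subseteq> sets (scalar_measure E x)" "disjoint_family F"
      "(\<Union>i. F i) \<in> sets (scalar_measure E x)"
    have n: "(norm (E B x))\<^sup>2 = inner (E B x) x" if "B \<in> sets borel" for B
      by (rule orthogonal_projection_norm[OF proj[OF that]])
    have "(\<lambda>n. inner (E (F n) x) x) sums inner (E (\<Union>n. F n) x) x"
      by (rule bounded_linear.sums[OF bounded_linear_inner_left]) (use F E_sums in auto)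
    then have "(\<lambda>n. (norm (E (F n) x))\<^sup>2) sums (norm (E (\<Union>n. F n) x))\<^sup>2"
      using F n by (simp add: image_subset_iff)
    then show "(\<Sum>i. ennreal ((norm (E (F i) x))\<^sup>2)) = ennreal ((norm (E (\<Union>i. F i) x))\<^sup>2)"
      by (intro suminf_ennreal_eq) auto
  qed
qed (use assms in auto)

lemma measure_scalar_measure:
  "B \<in> sets borel \<Longrightarrow> measure (scalar_measure E x) B = (norm (E B x))\<^sup>2"
  by (simp add: measure_def emeasure_scalar_measure)

lemma finite_scalar_measure: "finite_measure (scalar_measure E x)"
  by (rule finite_measureI) (simp add: emeasure_scalar_measure)

text \<open>Projecting the vector by \<open>E B\<close> restricts its scalar measure to \<open>B\<close>.\<close>
lemma scalar_measure_projection: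
  assumes B: "B \<in> sets borel"
  shows "scalar_measure E (E B x) = density (scalar_measure E x) (\<lambda>t. ennreal (indicator B t))"
proof (rule measure_eqI)
  fix C assume "C \<in> sets (scalar_measure E (E B x))"
  then have C: "C \<in> sets borel" by simp
  have "emeasure (density (scalar_measure E x) (\<lambda>t. ennreal (indicator B t))) C = emeasure (scalar_measure E x) (B \<inter> C)"
    using B C by (subst emeasure_density) (simp_all add: ennreal_indicator flip: indicator_inter_arith)
  then show "emeasure (scalar_measure E (E B x)) C = emeasure (density (scalar_measure E x) (\<lambda>t. ennreal (indicator B t))) C"
    using B C by (simp add: emeasure_scalar_measure E_Int[symmetric] Int_commute)
qed simp

end

locale spectral = pvm E for E :: "real set \<Rightarrow> 'a::complex_inner \<Rightarrow> 'a" +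
  fixes A :: "'a \<Rightarrow> 'a"
  assumes spectral: "is_spectral_measure A E" and A: "bounded_clinear A"
begin

lemma integrable_scalar: "integrable (scalar_measure E x) (\<lambda>t. t)"
  and cinner_A: "cinner (A x) x = complex_of_real (LINT t|scalar_measure E x. t)"
  using spectral by (auto simp: is_spectral_measure_def)

lemma integrable_indicator_id:
  "B \<in> sets borel \<Longrightarrow> integrable (scalar_measure E x) (\<lambda>t. indicator B t * t)"
  using integrable_mult_indicator[OF _ integrable_scalar, of B x] by simp

lemma integrable_indicator_const:
  "B \<in> sets borel \<Longrightarrow> integrable (scalar_measure E x) (\<lambda>t. indicator B t * c :: real)"
  by (intro integrable_mult_left integrable_real_indicator) (auto simp: emeasure_scalar_measure)

lemma cinner_A_projection:
  assumes B: "B \<in> sets borel"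
  shows "cinner (A (E B x)) (E B x) = complex_of_real (LINT t|scalar_measure E x. indicator B t * t)"
  unfolding cinner_A scalar_measure_projection[OF B]
  using B by (subst integral_density) auto

lemma A_le:
  assumes B: "B \<in> sets borel" "B \<subseteq> {..c}" and x: "E B x = x"
  shows "inner (A x) x \<le> c * (norm x)\<^sup>2"
proof -
  interpret finite_measure "scalar_measure E x" by (rule finite_scalar_measure)
  have "inner (A x) x = (LINT t|scalar_measure E x. indicator B t * t)"
    using cinner_A_projection[OF B(1), of x] by (simp add: x inner_eq_Re_cinner)
  also have "\<dots> \<le> (LINT t|scalar_measure E x. indicator B t * c)"
    using B by (intro integral_mono integrable_indicator_id integrable_indicator_const) (auto simp: indicator_def)
  also have "\<dots> = c * (norm x)\<^sup>2" using B by (simp add: measure_scalar_measure x)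
  finally show ?thesis .
qed

lemma A_ge:
  assumes B: "B \<in> sets borel" "B \<subseteq> {c..}" and x: "E B x = x"
  shows "c * (norm x)\<^sup>2 \<le> inner (A x) x"
proof -
  interpret finite_measure "scalar_measure E x" by (rule finite_scalar_measure)
  have "c * (norm x)\<^sup>2 = (LINT t|scalar_measure E x. indicator B t * c)"
    using B by (simp add: measure_scalar_measure x)
  also have "\<dots> \<le> (LINT t|scalar_measure E x. indicator B t * t)"
    using B by (intro integral_mono integrable_indicator_id integrable_indicator_const) (auto simp: indicator_def)
  also have "\<dots> = inner (A x) x"
    using cinner_A_projection[OF B(1), of x] by (simp add: x inner_eq_Re_cinner)
  finally show ?thesis .
qed

text \<open>
  The quadratic form of \<open>A\<close> splits along \<open>E B\<close> and \<open>E (- B)\<close>, so its cross terms vanish, by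
  polarization.
\<close>
lemma A_commute:
  assumes B: "B \<in> sets borel" shows "A (E B x) = E B (A x)"
proof -
  have A_lin: "linear A" by (rule bounded_clinear_linear[OF A])
  have B': "- B \<in> sets borel" using B by auto
  have zero: "E B (E (- B) x) = 0" "E (- B) (E B x) = 0" for x
    using E_Int[OF B B', of x] E_Int[OF B' B, of x] by (simp_all add: E_empty)
  have split: "cinner (A z) z = cinner (A (E B z)) (E B z) + cinner (A (E (- B) z)) (E (- B) z)" for z
  proof -
    have "(LINT t|scalar_measure E z. t)
        = (LINT t|scalar_measure E z. indicator B t * t + indicator (- B) t * t)"
      by (intro Bochner_Integration.integral_cong) (auto simp: indicator_def)
    also have "\<dots> = (LINT t|scalar_measure E z. indicator B t * t)
        + (LINT t|scalar_measure E z. indicator (- B) t * t)"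
      by (rule Bochner_Integration.integral_add) (intro integrable_indicator_id B B')+
    finally show ?thesis by (simp add: cinner_A[of z] cinner_A_projection B B')
  qed
  have cross: "cinner (A x) y = 0 \<and> cinner (A y) x = 0"
    if x: "E B x = x" and y: "E (- B) y = y" for x y
  proof -
    have sum0: "cinner (A x) y + cinner (A y) x = 0"
      if "E (- B) y = y" for y
    proof -
      have "E B (x + y) = x" "E (- B) (x + y) = y"
        using x that zero[of x] zero[of y] by (simp_all add: linear_add E_linear B B')
      then show ?thesis
        using split[of "x + y"]
        by (simp add: linear_add[OF A_lin] cinner_add_left cinner_add_right add.commute)
    qed
    have "E (- B) (\<i> *\<^sub>C y) = \<i> *\<^sub>C y"
      using proj[OF B'] y by (simp add: orthogonal_projection_def bounded_clinear_def)
    \<comment> \<open>Replacing \<open>y\<close> by \<open>\<i> y\<close> separates the two terms.\<close>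
    from sum0[OF this] have "- \<i> * cinner (A x) y + \<i> * cinner (A y) x = 0"
      using A by (simp add: bounded_clinear_def cinner_scaleC_left cinner_scaleC_right)
    then have "cinner (A x) y = cinner (A y) x" by (simp add: complex_eq_iff)
    then show ?thesis using sum0[OF y] by simp
  qed
  have invariant: "E (- C) (A (E C x)) = 0" if C: "C \<in> sets borel" "C = B \<or> C = - B" for C x
  proof -
    define y where "y = E (- C) (A (E C x))"
    have C': "- C \<in> sets borel" using C by auto
    have "E C (E C x) = E C x" "E (- C) y = y"
      using proj[OF C(1)] proj[OF C'] by (auto simp: orthogonal_projection_def y_def)
    then have "cinner (A (E C x)) y = 0"
      using cross[of "E C x" y] cross[of y "E C x"] C(2) by auto
    then have "cinner y y = 0"
      using proj[OF C'] unfolding y_def orthogonal_projection_def by metis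
    then show ?thesis by (simp add: cinner_self y_def)
  qed
  have "A x = A (E B x) + A (E (- B) x)"
    using E_Compl[OF B, of x] linear_add[OF A_lin] by metis
  then have "E B (A x) = E B (A (E B x)) + E B (A (E (- B) x))"
    by (simp add: linear_add[OF E_linear[OF B]])
  moreover have "E B (A (E (- B) x)) = 0" using invariant[OF B', of x] by simp
  moreover have "E B (A (E B x)) = A (E B x)"
    using E_Compl[OF B, of "A (E B x)"] invariant[OF B, of x] by simp
  ultimately show ?thesis by simp
qed

lemma A_power_commute: "B \<in> sets borel \<Longrightarrow> (A ^^ n) (E B x) = E B ((A ^^ n) x)"
  by (induction n) (auto simp: A_commute)

text \<open>
  Bernstein's characterization: on \<open>range (E {0..w})\<close> the operator has norm at most \<open>w\<close>, whereas
  on \<open>range (E {c..})\<close> it expands norms by the factor \<open>c\<close>, so a component there with \<open>c > w\<close>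
  would grow too fast. The right-hand side does not depend on \<open>E\<close>.
\<close>
lemma range_E_eq_Bernstein:
  assumes sym: "\<And>x y. inner (A x) y = inner x (A y)" and pos: "\<And>x. 0 \<le> inner (A x) x"
    and w: "w > 0"
  shows "range (E {0..w}) = {x. \<forall>n. norm ((A ^^ n) x) \<le> w ^ n * norm x}"
proof (intro set_eqI iffI CollectI allI)
  have A_lin: "linear A" by (rule bounded_clinear_linear[OF A])
  fix x n assume "x \<in> range (E {0..w})"
  then have x: "E {0..w} x = x" by (simp add: E_range)
  have step: "norm (A y) \<le> w * norm y" if y: "E {0..w} y = y" for y
  proof -
    define u where "u = A y"
    have u: "E {0..w} u = u" unfolding u_def by (metis A_commute y borel_closed closed_atLeastAtMost)
    \<comment> \<open>This is \<open>w * A * (w - A) = A * (w - A) * A + (w - A) * A * (w - A) \<ge> 0\<close>, which yields \<open>A\<^sup>2 \<le> w * A\<close>.\<close>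
    have "0 \<le> inner (A (w *\<^sub>R y - u)) (w *\<^sub>R y - u)" by (rule pos)
    also have "\<dots> = w\<^sup>2 * inner u y - 2 * w * (norm u)\<^sup>2 + inner (A u) u"
      using sym[of u y] unfolding power2_norm_eq_inner
      by (simp add: linear_diff[OF A_lin] linear_scale[OF A_lin] u_def[symmetric] inner_diff
          power2_eq_square algebra_simps inner_commute)
    also have "\<dots> \<le> w\<^sup>2 * inner u y - w * (norm u)\<^sup>2"
      using A_le[of "{0..w}" w u] u by auto
    finally have "w * (norm u)\<^sup>2 \<le> w * (w * inner u y)" by (simp add: power2_eq_square)
    then have "(norm u)\<^sup>2 \<le> w * inner u y" using w by simp
    also have "\<dots> \<le> w * (w * (norm y)\<^sup>2)"
      using A_le[of "{0..w}" w y] y w unfolding u_def by (intro mult_left_mono) auto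
    also have "\<dots> = (w * norm y)\<^sup>2" by (simp add: power2_eq_square)
    finally show ?thesis unfolding u_def by (rule power2_le_imp_le) (use w in simp)
  qed
  show "norm ((A ^^ n) x) \<le> w ^ n * norm x"
  proof (induction n)
    case (Suc n)
    have "E {0..w} ((A ^^ n) x) = (A ^^ n) x"
      using A_power_commute[of "{0..w}" n x] x by simp
    from step[OF this] have "norm ((A ^^ Suc n) x) \<le> w * norm ((A ^^ n) x)" by simp
    also have "\<dots> \<le> w * (w ^ n * norm x)" using Suc w by (intro mult_left_mono) auto
    finally show ?case by simp
  qed simp
next
  fix x assume "x \<in> {x. \<forall>n. norm ((A ^^ n) x) \<le> w ^ n * norm x}"
  then have x: "norm ((A ^^ n) x) \<le> w ^ n * norm x" for n by simp
  \<comment> \<open>The component in \<open>range (E {c..})\<close> grows at least like \<open>c ^ n\<close>.\<close>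
  have above: "E {c..} x = 0" if c: "c > w" for c
  proof -
    define y where "y = E {c..} x"
    have grow: "c * norm z \<le> norm (A z)" if z: "E {c..} z = z" for z
    proof -
      have "c * norm z * norm z \<le> norm (A z) * norm z"
        using A_ge[of "{c..}" c z] z norm_cauchy_schwarz[of "A z" z] by (simp add: power2_eq_square)
      then show ?thesis by (cases "norm z = 0") auto
    qed
    have yn: "E {c..} ((A ^^ n) y) = (A ^^ n) y" for n
      unfolding y_def A_power_commute[OF borel_closed[OF closed_atLeast]]
      using proj[of "{c..}"] by (auto simp: orthogonal_projection_def)
    have "c ^ n * norm y \<le> norm ((A ^^ n) y)" for n
    proof (induction n)
      case (Suc n)
      have "c * (c ^ n * norm y) \<le> c * norm ((A ^^ n) y)" using Suc c w by (intro mult_left_mono) auto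
      also have "\<dots> \<le> norm (A ((A ^^ n) y))" by (rule grow[OF yn])
      finally show ?case by simp
    qed simp
    also have "norm ((A ^^ n) y) \<le> norm ((A ^^ n) x)" for n
      unfolding y_def A_power_commute[OF borel_closed[OF closed_atLeast]]
      by (intro orthogonal_projection_norm_le proj) auto
    finally have "c ^ n * norm y \<le> w ^ n * norm x" for n using x[of n] by (meson order_trans)
    then have bound: "norm y * (c / w) ^ n \<le> norm x" for n
      using w by (simp add: power_divide field_simps)
    have "y = 0"
    proof (rule ccontr)
      assume "y \<noteq> 0"
      obtain n where "norm x / norm y < (c / w) ^ n"
        using real_arch_pow[of "c / w" "norm x / norm y"] c w by auto
      then show False using bound[of n] \<open>y \<noteq> 0\<close> by (simp add: field_simps)
    qed
    then show ?thesis by (simp add: y_def)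
  qed
  \<comment> \<open>Positivity of \<open>A\<close> excludes negative spectrum.\<close>
  have below: "E {..c} x = 0" if c: "c < 0" for c
  proof -
    have "E {..c} (E {..c} x) = E {..c} x"
      using proj[of "{..c}"] by (auto simp: orthogonal_projection_def)
    from A_le[OF _ order.refl this] pos[of "E {..c} x"] have "0 \<le> c * (norm (E {..c} x))\<^sup>2" by auto
    then show ?thesis using c by (simp add: zero_le_mult_iff)
  qed
  have "emeasure (scalar_measure E x) (\<Union>n::nat. {..- (1 / Suc n)} \<union> {w + 1 / Suc n..}) = 0"
  proof (rule emeasure_UN_eq_0)
    fix n :: nat
    have "emeasure (scalar_measure E x) {..- (1 / Suc n)} = 0" "emeasure (scalar_measure E x) {w + 1 / Suc n..} = 0"
      by (auto simp: emeasure_scalar_measure above below)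
    then show "emeasure (scalar_measure E x) ({..- (1 / Suc n)} \<union> {w + 1 / Suc n..}) = 0"
      by (intro emeasure_Un_null_set[THEN trans] null_setsI) auto
  qed auto
  moreover have "(\<Union>n::nat. {..- (1 / Suc n)} \<union> {w + 1 / Suc n..}) = - {0..w}"
  proof (intro set_eqI iffI)
    fix t assume "t \<in> - {0..w}"
    then consider "0 < - t" | "0 < t - w" by force
    then show "t \<in> (\<Union>n::nat. {..- (1 / Suc n)} \<union> {w + 1 / Suc n..})"
    proof cases
      case 1
      then obtain n :: nat where "1 / Suc n < - t" using nat_approx_posE by metis
      then show ?thesis by (intro UN_I[of n]) auto
    next
      case 2
      then obtain n :: nat where "1 / Suc n < t - w" using nat_approx_posE by metis
      then show ?thesis by (intro UN_I[of n]) auto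
    qed
  next
    fix t assume "t \<in> (\<Union>n::nat. {..- (1 / Suc n)} \<union> {w + 1 / Suc n..})"
    then obtain n :: nat where n: "t \<le> - (1 / real (Suc n)) \<or> w + 1 / real (Suc n) \<le> t"
      unfolding UN_iff Un_iff atMost_iff atLeast_iff by blast
    have "1 / real (Suc n) > 0" by simp
    then show "t \<in> - {0..w}"
      using n unfolding Compl_iff atLeastAtMost_iff by linarith
  qed
  ultimately have "E (- {0..w}) x = 0" by (simp add: emeasure_scalar_measure)
  then have "E {0..w} x = x" using E_Compl[of "{0..w}" x] by simp
  then show "x \<in> range (E {0..w})" by (simp add: E_range)
qed

end


section \<open>The spectral measure of the Laplacian\<close>

lemma bounded_clinear_compose:
  assumes "bounded_clinear A" "bounded_clinear B" shows "bounded_clinear (\<lambda>x. A (B x))"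
proof -
  have "bounded_linear (\<lambda>x. A (B x))"
    by (rule bounded_linear_compose) (use assms in \<open>auto simp: bounded_clinear_def\<close>)
  then show ?thesis using assms by (simp add: bounded_clinear_def)
qed

text \<open>
  On the Fourier side the Laplacian is multiplication by \<open>\<phi>\<close>, so its spectral projections are
  multiplications by the indicators of the sets where \<open>\<phi>\<close> takes values in \<open>B\<close>.
\<close>
definition laplacian_pvm :: "real set \<Rightarrow> ell2 \<Rightarrow> ell2" where
  "laplacian_pvm B f = inv fourier (mult_op (indicator (\<phi> -` B)) (fourier f))"

lemma fourier_laplacian_pvm: "fourier (laplacian_pvm B f) = mult_op (indicator (\<phi> -` B)) (fourier f)"
  by (simp add: laplacian_pvm_def)

lemma phi_borel [measurable]: "\<phi> \<in> borel_measurable borel"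
  unfolding \<phi>_def by measurable

lemma phi_vimage_borel: "B \<in> sets borel \<Longrightarrow> \<phi> -` B \<in> sets borel"
  using measurable_sets_borel[OF phi_borel] by simp

lemma orthogonal_projection_laplacian_pvm:
  assumes B: "B \<in> sets borel" shows "orthogonal_projection (laplacian_pvm B)"
proof -
  have bm: "bounded_multiplier (indicator (\<phi> -` B))"
    by (intro bounded_multiplier_indicator phi_vimage_borel B)
  have "bounded_clinear (laplacian_pvm B)"
    unfolding laplacian_pvm_def[abs_def]
    by (rule bounded_clinear_compose[OF bounded_clinear_inv_fourier
          bounded_clinear_compose[OF bounded_clinear_mult_op[OF bm] bounded_clinear_fourier]])
  moreover have "laplacian_pvm B (laplacian_pvm B f) = laplacian_pvm B f" for f
    using mult_op_indicator_in_L2_on[OF phi_vimage_borel[OF B], of "fourier f"]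
    by (simp add: laplacian_pvm_def L2_on_iff phi_vimage_borel B)
  moreover have "cinner (laplacian_pvm B f) g = cinner f (laplacian_pvm B g)" for f g
    by (simp add: cinner_mult_op[OF bm] cnj_indicator fourier_laplacian_pvm flip: cinner_fourier)
  ultimately show ?thesis by (simp add: orthogonal_projection_def)
qed

text \<open>
  By dominated convergence, with the square of the function itself as majorant.
\<close>
lemma mult_op_indicator_sums:
  fixes B :: "nat \<Rightarrow> real set"
  assumes B: "\<And>n. B n \<in> sets borel" and disj: "disjoint_family B"
  shows "(\<lambda>n. mult_op (indicator (B n)) g) sums mult_op (indicator (\<Union>n. B n)) g"
proof (rule L2_cases[of g])
  fix f assume f: "square_integrable f" "g = L2_of f"
  have [measurable]: "f \<in> borel_measurable circle" using f by (simp add: square_integrable_def)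
  have U: "(\<Union>n. B n) \<in> sets borel" using B by auto
  have sq: "square_integrable (\<lambda>x. indicator C x * f x)" if "C \<in> sets borel" for C
    by (intro square_integrable_mult bounded_multiplier_indicator that f)
  define d where "d N x = indicator (\<Union>n. B n) x * f x - (\<Sum>n<N. indicator (B n) x * f x)" for N x
  have sum_sq: "square_integrable (\<lambda>x. \<Sum>n<N. indicator (B n) x * f x)
      \<and> (\<Sum>n<N. mult_op (indicator (B n)) g) = L2_of (\<lambda>x. \<Sum>n<N. indicator (B n) x * f x)" for N
  proof (induction N)
    case 0
    then show ?case by (simp add: square_integrable_zero zero_L2_circle_def)
  next
    case (Suc N)
    then show ?case
      by (simp add: f mult_op_L2_of bounded_multiplier_indicator B sq L2_of_add square_integrable_add)
  qed
  have d_sq: "square_integrable (d N)" for N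
    unfolding d_def using sum_sq by (intro square_integrable_diff sq U) auto
  have "(\<lambda>N. LINT x|circle. (cmod (d N x))\<^sup>2) \<longlonglongrightarrow> (LINT x|circle. 0)"
  proof (rule integral_dominated_convergence[where w = "\<lambda>x. (cmod (f x))\<^sup>2"])
    have s: "(\<lambda>n. indicator (B n) x :: real) sums indicator (\<Union>n. B n) x" for x
      using disj by (intro indicator_sums) (auto simp: disjoint_family_on_def)
    have d_eq: "d N x = complex_of_real (indicator (\<Union>n. B n) x - (\<Sum>n<N. indicator (B n) x)) * f x" for N x
    proof -
      have "complex_of_real (indicator C x) = indicator C x" for C :: "real set" by (simp add: indicator_def)
      then show ?thesis by (simp add: d_def left_diff_distrib sum_distrib_right)
    qed
    show "AE x in circle. (\<lambda>N. (cmod (d N x))\<^sup>2) \<longlonglongrightarrow> 0"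
    proof (rule AE_I2)
      fix x
      have "(\<lambda>N. indicator (\<Union>n. B n) x - (\<Sum>n<N. indicator (B n) x) :: real) \<longlonglongrightarrow> 0"
        using tendsto_diff[OF tendsto_const s[of x, unfolded sums_def], of "indicator (\<Union>n. B n) x"] by simp
      from tendsto_mult[OF tendsto_of_real[OF this] tendsto_const[of "f x"]]
      have "(\<lambda>N. d N x) \<longlonglongrightarrow> 0" by (simp add: d_eq)
      from tendsto_power[OF tendsto_norm[OF this], of 2] show "(\<lambda>N. (cmod (d N x))\<^sup>2) \<longlonglongrightarrow> 0" by simp
    qed
    show "AE x in circle. norm ((cmod (d N x))\<^sup>2) \<le> (cmod (f x))\<^sup>2" for N
    proof (rule AE_I2)
      fix x
      have "(\<Sum>n<N. indicator (B n) x :: real) \<le> indicator (\<Union>n. B n) x"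
        using sum_le_suminf[OF sums_summable[OF s], of "{..<N}" x] sums_unique[OF s, of x] by simp
      moreover have "0 \<le> (\<Sum>n<N. indicator (B n) x :: real)" by (intro sum_nonneg) simp
      moreover have "(indicator (\<Union>n. B n) x :: real) \<le> 1" by (simp add: indicator_def)
      ultimately have "\<bar>indicator (\<Union>n. B n) x - (\<Sum>n<N. indicator (B n) x) :: real\<bar> \<le> 1" by linarith
      then have "cmod (d N x) \<le> cmod (f x)"
        unfolding d_eq norm_mult norm_of_real by (intro mult_left_le_one_le) auto
      then show "norm ((cmod (d N x))\<^sup>2) \<le> (cmod (f x))\<^sup>2" by (simp add: power_mono)
    qed
  qed (use f d_sq in \<open>auto simp: square_integrable_def\<close>)
  moreover have "(LINT x|circle. (cmod (d N x))\<^sup>2)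
      = (norm (mult_op (indicator (\<Union>n. B n)) g - (\<Sum>n<N. mult_op (indicator (B n)) g)))\<^sup>2" for N
    using sum_sq[of N] norm_L2_of[OF d_sq[of N]] unfolding d_def
    by (simp add: f mult_op_L2_of bounded_multiplier_indicator U L2_of_diff sq)
  ultimately have "(\<lambda>N. sqrt ((norm (mult_op (indicator (\<Union>n. B n)) g - (\<Sum>n<N. mult_op (indicator (B n)) g)))\<^sup>2)) \<longlonglongrightarrow> sqrt 0"
    by (intro tendsto_real_sqrt) simp
  then have "(\<lambda>N. norm ((\<Sum>n<N. mult_op (indicator (B n)) g) - mult_op (indicator (\<Union>n. B n)) g)) \<longlonglongrightarrow> 0"
    by (simp add: norm_minus_commute)
  then show ?thesis
    unfolding sums_def by (simp only: tendsto_norm_zero_iff LIM_zero_iff)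
qed

lemma projection_valued_measure_laplacian_pvm: "projection_valued_measure laplacian_pvm"
  unfolding projection_valued_measure_def
proof (intro conjI ballI allI impI)
  fix f show "laplacian_pvm UNIV f = f"
  proof -
    have "(indicator UNIV :: real \<Rightarrow> complex) = (\<lambda>_. 1)" by (auto simp: indicator_def)
    then show ?thesis by (simp add: laplacian_pvm_def)
  qed
next
  fix B C :: "real set" and f assume "B \<in> sets borel" "C \<in> sets borel"
  moreover have "(indicator (\<phi> -` (B \<inter> C)) :: real \<Rightarrow> complex)
      = (\<lambda>\<xi>. indicator (\<phi> -` B) \<xi> * indicator (\<phi> -` C) \<xi>)" by (auto simp: indicator_def)
  ultimately show "laplacian_pvm (B \<inter> C) f = laplacian_pvm B (laplacian_pvm C f)"
    by (simp add: laplacian_pvm_def mult_op_mult_op bounded_multiplier_indicator phi_vimage_borel)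
next
  fix B :: "nat \<Rightarrow> real set" and f assume B: "range B \<subseteq> sets borel" "disjoint_family B"
  have "(\<lambda>n. mult_op (indicator (\<phi> -` B n)) (fourier f)) sums mult_op (indicator (\<Union>n. \<phi> -` B n)) (fourier f)"
    using B by (intro mult_op_indicator_sums phi_vimage_borel) (auto simp: disjoint_family_on_def)
  from bounded_linear.sums[OF _ this, of "inv fourier"] bounded_clinear_inv_fourier
  show "(\<lambda>n. laplacian_pvm (B n) f) sums laplacian_pvm (\<Union>n. B n) f"
    by (simp add: laplacian_pvm_def bounded_clinear_def vimage_UN)
qed (rule orthogonal_projection_laplacian_pvm)

interpretation laplacian_pvm: pvm laplacian_pvm
  by unfold_locales (rule projection_valued_measure_laplacian_pvm)

text \<open>
  The spectral distribution of \<open>f\<close> is the distribution of \<open>\<phi>\<close> under the density given by the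
  squared modulus of its Fourier transform, so integrals against it are integrals over the circle.
\<close>
lemma scalar_measure_laplacian_pvm:
  assumes F: "square_integrable F" "fourier f = L2_of F"
  shows "scalar_measure laplacian_pvm f
    = distr (density circle (\<lambda>\<xi>. ennreal ((cmod (F \<xi>))\<^sup>2))) borel \<phi>"
proof (rule measure_eqI)
  have [measurable]: "F \<in> borel_measurable circle" "\<phi> \<in> borel_measurable circle"
    using F borel_measurable_circle[OF phi_borel] by (auto simp: square_integrable_def)
  fix B assume "B \<in> sets (scalar_measure laplacian_pvm f)"
  then have B: "B \<in> sets borel" by simp
  have sq: "square_integrable (\<lambda>x. indicator (\<phi> -` B) x * F x)"
    by (intro square_integrable_mult bounded_multiplier_indicator phi_vimage_borel B F)
  have "emeasure (distr (density circle (\<lambda>\<xi>. ennreal ((cmod (F \<xi>))\<^sup>2))) borel \<phi>) B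
      = emeasure (density circle (\<lambda>\<xi>. ennreal ((cmod (F \<xi>))\<^sup>2))) (\<phi> -` B \<inter> space circle)"
    using B by (subst emeasure_distr) auto
  also have "\<dots> = (\<integral>\<^sup>+\<xi>. ennreal ((cmod (F \<xi>))\<^sup>2) * indicator (\<phi> -` B \<inter> space circle) \<xi> \<partial>circle)"
    by (rule emeasure_density) (use B in \<open>auto intro: measurable_sets\<close>)
  also have "\<dots> = (\<integral>\<^sup>+\<xi>. ennreal ((cmod (indicator (\<phi> -` B) \<xi> * F \<xi>))\<^sup>2) \<partial>circle)"
    by (intro nn_integral_cong) (auto simp: indicator_def)
  also have "\<dots> = ennreal (LINT \<xi>|circle. (cmod (indicator (\<phi> -` B) \<xi> * F \<xi>))\<^sup>2)"
    by (rule nn_integral_eq_integral) (use sq in \<open>auto simp: square_integrable_def\<close>)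
  also have "\<dots> = ennreal ((norm (laplacian_pvm B f))\<^sup>2)"
    using norm_L2_of[OF sq] norm_fourier[of "laplacian_pvm B f"]
    by (simp add: fourier_laplacian_pvm F mult_op_L2_of bounded_multiplier_indicator phi_vimage_borel B)
  finally show "emeasure (scalar_measure laplacian_pvm f) B
      = emeasure (distr (density circle (\<lambda>\<xi>. ennreal ((cmod (F \<xi>))\<^sup>2))) borel \<phi>) B"
    by (simp add: laplacian_pvm.emeasure_scalar_measure B)
qed simp

lemma cinner_laplacian:
  assumes F: "square_integrable F" "fourier f = L2_of F"
  shows "cinner (laplacian f) f = complex_of_real (LINT \<xi>|circle. (cmod (F \<xi>))\<^sup>2 * \<phi> \<xi>)"
proof -
  have "cinner (laplacian f) f = cinner (mult_op (\<lambda>\<xi>. complex_of_real (\<phi> \<xi>)) (L2_of F)) (L2_of F)"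
    by (simp add: fourier_laplacian flip: cinner_fourier F(2))
  also have "\<dots> = (LINT \<xi>|circle. complex_of_real (\<phi> \<xi>) * F \<xi> * cnj (F \<xi>))"
    by (simp add: mult_op_L2_of bounded_multiplier_phi F cinner_L2_of square_integrable_mult)
  also have "\<dots> = (LINT \<xi>|circle. complex_of_real ((cmod (F \<xi>))\<^sup>2 * \<phi> \<xi>))"
    by (intro Bochner_Integration.integral_cong) (simp_all add: cmod_square_eq mult_ac)
  finally show ?thesis by (simp only: integral_complex_of_real)
qed

lemma is_spectral_measure_laplacian_pvm: "is_spectral_measure laplacian laplacian_pvm"
  unfolding is_spectral_measure_def
proof (intro conjI allI)
  fix f
  obtain F where F: "square_integrable F" "fourier f = L2_of F" by (rule L2_cases)
  have [measurable]: "F \<in> borel_measurable circle" "\<phi> \<in> borel_measurable circle"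
    using F borel_measurable_circle[OF phi_borel] by (auto simp: square_integrable_def)
  have int: "integrable circle (\<lambda>\<xi>. (cmod (F \<xi>))\<^sup>2 * \<phi> \<xi>)"
  proof (rule Bochner_Integration.integrable_bound)
    show "integrable circle (\<lambda>\<xi>. (cmod (F \<xi>))\<^sup>2 * 2)" using F by (auto simp: square_integrable_def)
  qed (auto simp: abs_mult phi_bounds intro!: mult_left_mono)
  show "integrable (scalar_measure laplacian_pvm f) (\<lambda>t. t)"
    unfolding scalar_measure_laplacian_pvm[OF F]
    by (subst integrable_distr_eq) (use int in \<open>auto simp: integrable_density\<close>)
  show "cinner (laplacian f) f = complex_of_real (LINT t|scalar_measure laplacian_pvm f. t)"
    unfolding scalar_measure_laplacian_pvm[OF F] cinner_laplacian[OF F]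
    by (subst integral_distr) (auto simp: integral_density)
qed (rule projection_valued_measure_laplacian_pvm)

lemma bounded_clinear_laplacian: "bounded_clinear laplacian"
proof -
  have eq: "laplacian f = inv fourier (mult_op (\<lambda>\<xi>. complex_of_real (\<phi> \<xi>)) (fourier f))" for f
    by (metis fourier_inv(2) fourier_laplacian)
  show ?thesis
    unfolding eq[abs_def]
    by (rule bounded_clinear_compose[OF bounded_clinear_inv_fourier
          bounded_clinear_compose[OF bounded_clinear_mult_op[OF bounded_multiplier_phi] bounded_clinear_fourier]])
qed

lemma inner_laplacian_commute: "inner (laplacian f) g = inner f (laplacian g)"
  by (simp add: inner_eq_Re_cinner fourier_laplacian cinner_mult_op_phi flip: cinner_fourier)

lemma inner_laplacian_nonneg: "0 \<le> inner (laplacian f) f"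
proof (rule L2_cases[of "fourier f"])
  fix F assume "square_integrable F" "fourier f = L2_of F"
  then show ?thesis
    by (simp add: inner_eq_Re_cinner cinner_laplacian integral_nonneg phi_bounds)
qed

text \<open>
  \<^const>\<open>GPW\<close> refers to some spectral measure of the Laplacian. One exists, and by Bernstein's
  characterization every one of them gives the same subspace as \<open>laplacian_pvm\<close>.
\<close>
lemma GPW_eq:
  assumes l: "l \<ge> 1"
  shows "f \<in> GPW (band_limit l) \<longleftrightarrow> fourier f \<in> L2_on (band l)"
proof -
  define E :: "real set \<Rightarrow> ell2 \<Rightarrow> ell2" where "E = (SOME E. is_spectral_measure laplacian E)"
  have E: "is_spectral_measure laplacian E"
    unfolding E_def by (rule someI[of "is_spectral_measure laplacian", OF is_spectral_measure_laplacian_pvm])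
  interpret E: spectral E laplacian
    using E by unfold_locales (auto simp: is_spectral_measure_def bounded_clinear_laplacian)
  interpret L: spectral laplacian_pvm laplacian
    by unfold_locales (rule is_spectral_measure_laplacian_pvm, rule bounded_clinear_laplacian)
  have w: "band_limit l > 0"
  proof -
    have "cos (pi / real l) < cos 0"
      using l by (intro cos_monotone_0_pi) (auto simp: field_simps)
    then show ?thesis by (simp add: band_limit_def \<phi>_def)
  qed
  have "GPW (band_limit l) = range (laplacian_pvm {0..band_limit l})"
    unfolding GPW_def spectral_subspace_def E_def[symmetric]
    by (simp only: E.range_E_eq_Bernstein[OF inner_laplacian_commute inner_laplacian_nonneg w]
        L.range_E_eq_Bernstein[OF inner_laplacian_commute inner_laplacian_nonneg w])
  also have "f \<in> \<dots> \<longleftrightarrow> laplacian_pvm {0..band_limit l} f = f"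
    by (rule laplacian_pvm.E_range) simp
  also have "\<dots> \<longleftrightarrow> mult_op (indicator (\<phi> -` {0..band_limit l})) (fourier f) = fourier f"
    by (metis fourier_inv(2) fourier_laplacian_pvm)
  also have "mult_op (indicator (\<phi> -` {0..band_limit l})) (fourier f) = mult_op (indicator (band l)) (fourier f)"
  proof (rule L2_cases[of "fourier f"])
    fix F assume F: "square_integrable F" "fourier f = L2_of F"
    have "AE x in circle. indicator (\<phi> -` {0..band_limit l}) x * F x = indicator (band l) x * F x"
      using AE_circle_interval by eventually_elim (auto simp: band_def indicator_def)
    then show ?thesis
      by (simp add: F mult_op_L2_of L2_of_eq_iff bounded_multiplier_indicator phi_vimage_borel
          band_borel square_integrable_mult)
  qed
  finally show ?thesis by (simp add: L2_on_iff)
qed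


section \<open>Bounded analytic interpolation at separated points\<close>

text \<open>
  Let the indices enter in order of decreasing \<open>r\<close>. Each summand is at most the amount by which
  \<open>exp (- s)\<close> drops when \<open>t j\<close> is added to the running sum \<open>s\<close>, because
  \<open>t * exp (- (s + t)) \<le> exp (- s) - exp (- (s + t))\<close>. These drops telescope.
\<close>
lemma sum_exp_telescope:
  fixes t r :: "'i \<Rightarrow> real"
  assumes "finite I" "\<And>i. i \<in> I \<Longrightarrow> 0 \<le> t i"
  shows "(\<Sum>j\<in>I. t j * exp (- (\<Sum>k\<in>{k\<in>I. r j \<le> r k}. t k))) \<le> 1 - exp (- sum t I)"
  using assms
proof (induction I rule: finite_ranking_induct[where f = "\<lambda>j. - r j"])
  case empty
  then show ?case by simp
next
  case (insert x S)
  show ?case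
  proof (cases "x \<in> S")
    case True
    then show ?thesis using insert by (simp add: insert_absorb)
  next
    case False
    have "t x * exp (- sum t (insert x S)) + (1 - exp (- sum t S)) \<le> 1 - exp (- sum t (insert x S))"
    proof -
      have "(1 + t x) * exp (- sum t (insert x S)) \<le> exp (t x) * exp (- sum t (insert x S))"
        by (intro mult_right_mono exp_ge_add_one_self) auto
      also have "\<dots> = exp (- sum t S)"
        using False insert(1) by (simp flip: exp_add)
      finally show ?thesis by (simp add: algebra_simps)
    qed
    moreover have "(\<Sum>j\<in>S. t j * exp (- (\<Sum>k\<in>{k\<in>insert x S. r j \<le> r k}. t k)))
        \<le> (\<Sum>j\<in>S. t j * exp (- (\<Sum>k\<in>{k\<in>S. r j \<le> r k}. t k)))"
      using insert by (intro sum_mono mult_left_mono) (auto intro!: sum_mono2)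
    moreover have "\<dots> \<le> 1 - exp (- sum t S)" using insert by auto
    moreover have "{k \<in> insert x S. r x \<le> r k} = insert x S" using insert(2) by auto
    ultimately show ?thesis using False insert(1) by simp
  qed
qed

lemma cmod_one_minus_sq:
  "(cmod (1 - cnj b * a))\<^sup>2 - (cmod (a - b))\<^sup>2 = (1 - (cmod a)\<^sup>2) * (1 - (cmod b)\<^sup>2)"
  unfolding cmod_power2 by (simp add: algebra_simps power2_eq_square)

lemma one_minus_cnj_mult_nonzero:
  assumes "cmod a < 1" "cmod w \<le> 1" shows "1 - cnj a * w \<noteq> 0"
proof
  assume "1 - cnj a * w = 0"
  then have "cmod (cnj a * w) = 1" by simp
  moreover have "cmod a * cmod w \<le> cmod a * 1" using assms by (intro mult_left_mono) auto
  ultimately show False using assms by (simp add: norm_mult)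
qed

text \<open>
  The pseudohyperbolic distance of the unit disc.
\<close>
definition pseudo_dist :: "complex \<Rightarrow> complex \<Rightarrow> real" where
  "pseudo_dist a b = cmod ((a - b) / (1 - cnj b * a))"

lemma one_minus_pseudo_dist_sq:
  assumes "cmod a < 1" "cmod b < 1"
  shows "1 - (pseudo_dist a b)\<^sup>2 = (1 - (cmod a)\<^sup>2) * (1 - (cmod b)\<^sup>2) / (cmod (1 - cnj b * a))\<^sup>2"
proof -
  have "cmod (1 - cnj b * a) \<noteq> 0" using one_minus_cnj_mult_nonzero[of b a] assms by simp
  then show ?thesis
    using cmod_one_minus_sq[of b a]
    by (simp add: pseudo_dist_def norm_divide power_divide diff_divide_eq_iff)
qed

lemma pseudo_dist_le_1:
  assumes "cmod a < 1" "cmod b < 1" shows "pseudo_dist a b \<le> 1"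
proof -
  have "0 \<le> 1 - (pseudo_dist a b)\<^sup>2"
    unfolding one_minus_pseudo_dist_sq[OF assms] using assms
    by (intro divide_nonneg_nonneg mult_nonneg_nonneg) (auto simp: power2_eq_square mult_le_one less_imp_le)
  then show ?thesis by (simp add: pseudo_dist_def abs_square_le_1)
qed

lemma Re_Cayley:
  "Re ((1 + u) / (1 - u)) = (1 - (cmod u)\<^sup>2) / (cmod (1 - u))\<^sup>2"
proof -
  have "(1 + u) / (1 - u) = (1 + u) * cnj (1 - u) / complex_of_real ((cmod (1 - u))\<^sup>2)"
    by (rule complex_div_cnj[of "1 + u" "1 - u", unfolded of_real_power[symmetric]])
  then have "Re ((1 + u) / (1 - u)) = Re ((1 + u) * cnj (1 - u)) / (cmod (1 - u))\<^sup>2"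
    by (simp only: Re_divide_of_real)
  also have "Re ((1 + u) * cnj (1 - u)) = 1 - (cmod u)\<^sup>2"
    unfolding cmod_power2 by (simp add: algebra_simps power2_eq_square)
  finally show ?thesis .
qed

lemma sum_one_minus_sq_le:
  assumes "finite I" "\<And>i. i \<in> I \<Longrightarrow> 0 \<le> (x i :: real)" "0 < \<delta>" "\<delta> \<le> prod x I"
  shows "(\<Sum>i\<in>I. 1 - (x i)\<^sup>2) \<le> 2 * ln (1 / \<delta>)"
proof -
  have "prod x I \<noteq> 0" using assms by linarith
  then have pos: "x i > 0" if "i \<in> I" for i
    using assms that by (force simp: less_le)
  have "(\<Sum>i\<in>I. 1 - (x i)\<^sup>2) \<le> (\<Sum>i\<in>I. - 2 * ln (x i))"
  proof (rule sum_mono)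
    fix i assume i: "i \<in> I"
    then have "ln ((x i)\<^sup>2) \<le> (x i)\<^sup>2 - 1" using pos[OF i] by (intro ln_le_minus_one) auto
    then show "1 - (x i)\<^sup>2 \<le> - 2 * ln (x i)" using pos[OF i] by (simp add: ln_realpow)
  qed
  also have "\<dots> = - 2 * ln (prod x I)"
  proof -
    have "ln (prod x I) = (\<Sum>i\<in>I. ln (x i))" using pos by (intro ln_prod[OF assms(1)]) fastforce
    then show ?thesis by (simp add: sum_distrib_left)
  qed
  also have "\<dots> \<le> 2 * ln (1 / \<delta>)" using assms by (simp add: ln_div)
  finally show ?thesis .
qed


text \<open>
  P. Jones' interpolating functions. The normalized Blaschke product vanishes at the points other
  than \<open>z j\<close> and equals \<open>1\<close> at \<open>z j\<close>, as does the second factor, which localizes near \<open>z j\<close>.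
  The localized functions alone need not have a bounded sum. The exponential, normalized to \<open>1\<close>
  at \<open>z j\<close>, damps the function of index \<open>j\<close> wherever the localizing factors of points closer to
  the boundary are large.
\<close>
definition jones :: "('i \<Rightarrow> complex) \<Rightarrow> 'i set \<Rightarrow> 'i \<Rightarrow> complex \<Rightarrow> complex" where
  "jones z I j w =
     (\<Prod>k\<in>I - {j}. ((w - z k) / (1 - cnj (z k) * w)) / ((z j - z k) / (1 - cnj (z k) * z j))) *
     (complex_of_real (1 - (cmod (z j))\<^sup>2) / (1 - cnj (z j) * w))\<^sup>2 *
     exp (- (\<Sum>k\<in>{k\<in>I. cmod (z j) \<le> cmod (z k)}. complex_of_real (1 - (cmod (z k))\<^sup>2) *
        ((1 + cnj (z k) * w) / (1 - cnj (z k) * w) - (1 + cnj (z k) * z j) / (1 - cnj (z k) * z j))))"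

locale finite_separated =
  fixes z :: "'i \<Rightarrow> complex" and I :: "'i set" and \<delta> :: real
  assumes fin: "finite I" and disc: "\<And>j. j \<in> I \<Longrightarrow> cmod (z j) < 1" and \<delta>: "\<delta> > 0"
    and sep: "\<And>j. j \<in> I \<Longrightarrow> \<delta> \<le> (\<Prod>k\<in>I - {j}. pseudo_dist (z j) (z k))"
begin

lemma pseudo_dist_nonzero:
  assumes "j \<in> I" "k \<in> I" "j \<noteq> k" shows "pseudo_dist (z j) (z k) \<noteq> 0"
proof -
  have "(\<Prod>k\<in>I - {j}. pseudo_dist (z j) (z k)) \<noteq> 0" using sep[OF assms(1)] \<delta> by linarith
  then show ?thesis using fin assms by auto
qed

lemma jones_holomorphic:
  assumes j: "j \<in> I" shows "jones z I j holomorphic_on ball 0 1"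
proof -
  have nz: "1 - cnj (z k) * w \<noteq> 0" if "k \<in> I" "w \<in> ball 0 1" for k w
    using that disc by (intro one_minus_cnj_mult_nonzero) auto
  have nz': "(z j - z k) / (1 - cnj (z k) * z j) \<noteq> 0" if "k \<in> I - {j}" for k
    using pseudo_dist_nonzero[OF j, of k] that unfolding pseudo_dist_def by auto
  show ?thesis
    unfolding jones_def by (intro holomorphic_intros nz nz') (use j in auto)
qed

lemma jones_continuous:
  assumes j: "j \<in> I" shows "continuous_on (cball 0 1) (jones z I j)"
proof -
  have nz: "1 - cnj (z k) * w \<noteq> 0" if "k \<in> I" "w \<in> cball 0 1" for k w
    using that disc by (intro one_minus_cnj_mult_nonzero) auto
  have nz': "(z j - z k) / (1 - cnj (z k) * z j) \<noteq> 0" if "k \<in> I - {j}" for k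
    using pseudo_dist_nonzero[OF j, of k] that unfolding pseudo_dist_def by auto
  show ?thesis
    unfolding jones_def by (intro continuous_intros ballI nz nz') (use j in auto)
qed

lemma jones_interpolates:
  assumes "j \<in> I" "k \<in> I" shows "jones z I j (z k) = (if j = k then 1 else 0)"
proof (cases "j = k")
  case True
  have "(\<Prod>i\<in>I - {j}. ((z j - z i) / (1 - cnj (z i) * z j)) / ((z j - z i) / (1 - cnj (z i) * z j))) = 1"
    using pseudo_dist_nonzero assms by (intro prod.neutral) (auto simp: pseudo_dist_def)
  moreover have "complex_of_real (1 - (cmod (z j))\<^sup>2) / (1 - cnj (z j) * z j) = 1"
    using one_minus_cnj_mult_nonzero[of "z j" "z j"] disc[OF assms(1)]
    by (simp add: cmod_square_eq)
  ultimately show ?thesis using True by (simp add: jones_def)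
next
  case False
  then have "(\<Prod>i\<in>I - {j}. ((z k - z i) / (1 - cnj (z i) * z k)) / ((z j - z i) / (1 - cnj (z i) * z j))) = 0"
    using assms fin by (intro prod_zero) auto
  then show ?thesis using False by (simp add: jones_def)
qed

text \<open>
  The constant that normalizes the exponential is bounded because only points \<open>z k\<close> at least as
  close to the boundary as \<open>z j\<close> enter. For these the terms are at most
  \<open>2 * (1 - (pseudo_dist (z j) (z k))\<^sup>2)\<close>, and the sum of those is controlled by the product that
  the separation condition bounds below.
\<close>
lemma jones_exponent_le:
  assumes j: "j \<in> I"
  shows "(\<Sum>k\<in>{k\<in>I. cmod (z j) \<le> cmod (z k)}. (1 - (cmod (z k))\<^sup>2) *
      Re ((1 + cnj (z k) * z j) / (1 - cnj (z k) * z j))) \<le> 2 + 4 * ln (1 / \<delta>)"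
proof -
  have h: "0 \<le> 1 - (cmod (z k))\<^sup>2" if "k \<in> I" for k
    using disc[OF that] by (simp add: abs_square_le_1 less_imp_le)
  have "(\<Sum>k\<in>{k\<in>I. cmod (z j) \<le> cmod (z k)}. (1 - (cmod (z k))\<^sup>2) *
      Re ((1 + cnj (z k) * z j) / (1 - cnj (z k) * z j)))
    \<le> (\<Sum>k\<in>{k\<in>I. cmod (z j) \<le> cmod (z k)}. 2 * (1 - (pseudo_dist (z j) (z k))\<^sup>2))"
  proof (rule sum_mono)
    fix k assume "k \<in> {k\<in>I. cmod (z j) \<le> cmod (z k)}"
    then have k: "k \<in> I" "cmod (z j) \<le> cmod (z k)" by auto
    have "(cmod (z j))\<^sup>2 \<le> (cmod (z k))\<^sup>2" using k by (simp add: power_mono)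
    then have "(cmod (z j))\<^sup>2 * (cmod (z j))\<^sup>2 \<le> (cmod (z k))\<^sup>2 * (cmod (z j))\<^sup>2" by (rule mult_right_mono) simp
    moreover have "2 * (cmod (z j))\<^sup>2 \<le> 1 + (cmod (z j))\<^sup>2 * (cmod (z j))\<^sup>2"
      using sum_squares_bound[of 1 "(cmod (z j))\<^sup>2"] by (simp add: power2_eq_square)
    ultimately have "1 - (cmod (cnj (z k) * z j))\<^sup>2 \<le> 2 * (1 - (cmod (z j))\<^sup>2)"
      by (simp add: norm_mult power_mult_distrib)
    then have "(1 - (cmod (z k))\<^sup>2) * ((1 - (cmod (cnj (z k) * z j))\<^sup>2) / (cmod (1 - cnj (z k) * z j))\<^sup>2)
        \<le> (1 - (cmod (z k))\<^sup>2) * (2 * (1 - (cmod (z j))\<^sup>2) / (cmod (1 - cnj (z k) * z j))\<^sup>2)"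
      by (intro mult_left_mono[OF divide_right_mono] h k) auto
    then show "(1 - (cmod (z k))\<^sup>2) * Re ((1 + cnj (z k) * z j) / (1 - cnj (z k) * z j))
        \<le> 2 * (1 - (pseudo_dist (z j) (z k))\<^sup>2)"
      unfolding Re_Cayley one_minus_pseudo_dist_sq[OF disc[OF j] disc[OF k(1)]]
      by (simp only: times_divide_eq_right mult.assoc mult.commute mult.left_commute)
  qed
  also have "\<dots> \<le> (\<Sum>k\<in>I. 2 * (1 - (pseudo_dist (z j) (z k))\<^sup>2))"
    using fin pseudo_dist_le_1[OF disc[OF j] disc]
    by (intro sum_mono2) (auto simp: abs_square_le_1 pseudo_dist_def)
  also have "\<dots> = 2 * ((\<Sum>k\<in>I - {j}. 1 - (pseudo_dist (z j) (z k))\<^sup>2) + 1)"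
    using fin j unfolding sum_distrib_left[symmetric] by (simp add: sum.remove[of I j] pseudo_dist_def)
  also have "\<dots> \<le> 2 * (2 * ln (1 / \<delta>) + 1)"
    using fin sep[OF j] \<delta>
    by (intro mult_left_mono add_right_mono sum_one_minus_sq_le) (auto simp: pseudo_dist_def)
  finally show ?thesis by simp
qed

text \<open>
  A bound for the interpolation problem that depends on the separation constant only, and not on
  the number of points.
\<close>
definition M where "M = exp (2 + 4 * ln (1 / \<delta>)) / \<delta>"

lemma M_pos: "M > 0" using \<delta> by (simp add: M_def)

text \<open>
  On the unit circle Blaschke factors are unimodular, and the real part of the exponent is, up to
  its normalization, minus the sum of the same weights \<open>t k\<close> that bound the localizing factors.
  This coincidence makes the bounds telescope.
\<close>
lemma jones_bound:
  assumes j: "j \<in> I" and w: "cmod w = 1"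
  defines "t \<equiv> \<lambda>k. ((1 - (cmod (z k))\<^sup>2) / cmod (1 - cnj (z k) * w))\<^sup>2"
  shows "cmod (jones z I j w) \<le> M * (t j * exp (- (\<Sum>k\<in>{k\<in>I. cmod (z j) \<le> cmod (z k)}. t k)))"
proof -
  let ?S = "{k\<in>I. cmod (z j) \<le> cmod (z k)}"
  have "cmod ((w - z k) / (1 - cnj (z k) * w)) = 1" if "k \<in> I" for k
  proof -
    have "(cmod (1 - cnj (z k) * w))\<^sup>2 = (cmod (w - z k))\<^sup>2" using cmod_one_minus_sq[of "z k" w] w by simp
    then have "cmod (1 - cnj (z k) * w) = cmod (w - z k)" by (simp add: power2_eq_iff_nonneg)
    then show ?thesis
      using one_minus_cnj_mult_nonzero[OF disc[OF that], of w] w by (auto simp: norm_divide)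
  qed
  then have "cmod (\<Prod>k\<in>I - {j}. ((w - z k) / (1 - cnj (z k) * w)) / ((z j - z k) / (1 - cnj (z k) * z j)))
      = 1 / (\<Prod>k\<in>I - {j}. pseudo_dist (z j) (z k))"
    unfolding prod_norm[symmetric] pseudo_dist_def
    by (subst norm_divide) (simp add: prod_dividef)
  also have "\<dots> \<le> 1 / \<delta>" using sep[OF j] \<delta> by (intro divide_left_mono) auto
  finally have P: "cmod (\<Prod>k\<in>I - {j}. ((w - z k) / (1 - cnj (z k) * w)) / ((z j - z k) / (1 - cnj (z k) * z j)))
      \<le> 1 / \<delta>" .
  have Q: "cmod ((complex_of_real (1 - (cmod (z j))\<^sup>2) / (1 - cnj (z j) * w))\<^sup>2) = t j"
    by (simp only: t_def norm_power norm_divide norm_of_real power_divide power2_abs)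
  have R: "Re (complex_of_real r * u) = r * Re u" for r u by simp
  have "Re (\<Sum>k\<in>?S. complex_of_real (1 - (cmod (z k))\<^sup>2) *
        ((1 + cnj (z k) * w) / (1 - cnj (z k) * w) - (1 + cnj (z k) * z j) / (1 - cnj (z k) * z j)))
      = (\<Sum>k\<in>?S. t k) - (\<Sum>k\<in>?S. (1 - (cmod (z k))\<^sup>2) * Re ((1 + cnj (z k) * z j) / (1 - cnj (z k) * z j)))"
    unfolding Re_sum sum_subtractf[symmetric]
  proof (rule sum.cong[OF refl])
    fix k
    have "Re ((1 + cnj (z k) * w) / (1 - cnj (z k) * w)) = (1 - (cmod (z k))\<^sup>2) / (cmod (1 - cnj (z k) * w))\<^sup>2"
      unfolding Re_Cayley by (simp add: norm_mult w)
    then have "(1 - (cmod (z k))\<^sup>2) * Re ((1 + cnj (z k) * w) / (1 - cnj (z k) * w)) = t k"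
      by (simp add: t_def power_divide power2_eq_square)
    then show "Re (complex_of_real (1 - (cmod (z k))\<^sup>2) *
        ((1 + cnj (z k) * w) / (1 - cnj (z k) * w) - (1 + cnj (z k) * z j) / (1 - cnj (z k) * z j)))
      = t k - (1 - (cmod (z k))\<^sup>2) * Re ((1 + cnj (z k) * z j) / (1 - cnj (z k) * z j))"
      by (simp only: R minus_complex.sel right_diff_distrib)
  qed
  then have "cmod (exp (- (\<Sum>k\<in>?S. complex_of_real (1 - (cmod (z k))\<^sup>2) *
        ((1 + cnj (z k) * w) / (1 - cnj (z k) * w) - (1 + cnj (z k) * z j) / (1 - cnj (z k) * z j)))))
      \<le> exp (2 + 4 * ln (1 / \<delta>) - (\<Sum>k\<in>?S. t k))"
    using jones_exponent_le[OF j] unfolding norm_exp_eq_Re uminus_complex.sel by simp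
  also have "\<dots> = exp (2 + 4 * ln (1 / \<delta>)) * exp (- (\<Sum>k\<in>?S. t k))" by (simp flip: exp_add)
  finally have "cmod (jones z I j w) \<le> 1 / \<delta> * t j * (exp (2 + 4 * ln (1 / \<delta>)) * exp (- (\<Sum>k\<in>?S. t k)))"
    unfolding jones_def norm_mult Q using P \<delta>
    by (intro mult_mono mult_right_mono) (auto simp: t_def)
  then show ?thesis by (simp add: M_def mult_ac)
qed

text \<open>
  Carleson's interpolation theorem for finitely many points, with a uniform bound.
\<close>
lemma bounded_interpolation:
  assumes \<epsilon>: "\<And>j. j \<in> I \<Longrightarrow> cmod (\<epsilon> j) \<le> 1"
  obtains m where "m holomorphic_on ball 0 1" "continuous_on (cball 0 1) m"
    "\<And>j. j \<in> I \<Longrightarrow> m (z j) = \<epsilon> j" "\<And>w. cmod w = 1 \<Longrightarrow> cmod (m w) \<le> M"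
proof
  let ?m = "\<lambda>w. \<Sum>j\<in>I. \<epsilon> j * jones z I j w"
  show "?m holomorphic_on ball 0 1"
    by (intro holomorphic_intros jones_holomorphic)
  show "continuous_on (cball 0 1) ?m"
    by (intro continuous_intros jones_continuous)
  show "?m (z k) = \<epsilon> k" if "k \<in> I" for k
    using that fin by (simp add: jones_interpolates if_distrib cong: if_cong)
  show "cmod (?m w) \<le> M" if w: "cmod w = 1" for w
  proof -
    define t where "t k = ((1 - (cmod (z k))\<^sup>2) / cmod (1 - cnj (z k) * w))\<^sup>2" for k
    have "cmod (?m w) \<le> (\<Sum>j\<in>I. cmod (\<epsilon> j * jones z I j w))" by (rule norm_sum)
    also have "\<dots> \<le> (\<Sum>j\<in>I. M * (t j * exp (- (\<Sum>k\<in>{k\<in>I. cmod (z j) \<le> cmod (z k)}. t k))))"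
    proof (rule sum_mono)
      fix j assume j: "j \<in> I"
      have "cmod (\<epsilon> j) * cmod (jones z I j w) \<le> 1 * cmod (jones z I j w)"
        using \<epsilon>[OF j] by (rule mult_right_mono) simp
      then show "cmod (\<epsilon> j * jones z I j w) \<le> M * (t j * exp (- (\<Sum>k\<in>{k\<in>I. cmod (z j) \<le> cmod (z k)}. t k)))"
        using jones_bound[OF j w] by (simp add: norm_mult t_def)
    qed
    also have "\<dots> \<le> M * 1"
      unfolding sum_distrib_left[symmetric]
      using sum_exp_telescope[OF fin, of t "\<lambda>j. cmod (z j)"] M_pos
      by (intro mult_left_mono) (auto simp: t_def intro: order.trans)
    finally show ?thesis by simp
  qed
qed

end


section \<open>Cauchy kernels form a Riesz sequence\<close>

lemma integral_circle_eq:
  fixes f :: "real \<Rightarrow> complex"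
  assumes f: "continuous_on UNIV f" and i: "(f has_integral i) {-1/2..1/2}"
  shows "(LINT x|circle. f x) = i"
proof -
  have [measurable]: "f \<in> borel_measurable borel" using f by (rule borel_measurable_continuous_onI)
  have "(LINT x|circle. f x) = (LINT x|lebesgue. indicator {-1/2..<1/2} x *\<^sub>R f x)"
    unfolding circle_def by (rule integral_restrict_space) auto
  also have "\<dots> = (LINT x|lborel. indicator {-1/2..<1/2} x *\<^sub>R f x)"
    by (intro integral_completion) measurable
  also have "\<dots> = (LINT x|lborel. indicator {-1/2..1/2} x *\<^sub>R f x)"
  proof (rule integral_cong_AE)
    have "AE x in lborel. x \<noteq> 1/2" by (rule AE_lborel_singleton)
    then show "AE x in lborel. indicator {-1/2..<1/2} x *\<^sub>R f x = indicator {-1/2..1/2} x *\<^sub>R f x"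
      by eventually_elim (auto simp: indicator_def)
  qed measurable
  also have "\<dots> = i"
    using set_borel_integral_eq_integral(2)[OF borel_integrable_atLeastAtMost'[OF continuous_on_subset[OF f]], of "-1/2" "1/2"]
      integral_unique[OF i]
    by (simp add: set_lebesgue_integral_def)
  finally show ?thesis .
qed

lemma continuous_on_cis_compose:
  assumes "continuous_on (cball 0 1) h"
  shows "continuous_on UNIV (\<lambda>x. h (cis (2 * pi * x)))"
  by (rule continuous_on_compose2[OF assms]) (auto simp: cis_conv_exp intro!: continuous_intros)

lemma Cauchy_integral_circle:
  assumes cont: "continuous_on (cball 0 1) h" and hol: "h holomorphic_on ball 0 1" and a: "cmod a < 1"
  shows "(LINT \<xi>|circle. h (cis (2 * pi * \<xi>)) * cis (2 * pi * \<xi>) / (cis (2 * pi * \<xi>) - a)) = h a"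
proof (rule integral_circle_eq)
  \<comment> \<open>The contour starts at \<open>1\<close> and the fundamental domain of the circle at \<open>- 1\<close>: rotate by a half turn.\<close>
  define H where "H w = h (- w)" for w
  have "continuous_on (cball 0 1) H" "H holomorphic_on ball 0 1"
    unfolding H_def
    by (auto intro!: continuous_on_compose2[OF cont] holomorphic_on_compose_gen[OF _ hol, unfolded o_def]
        continuous_intros holomorphic_intros)
  from Cauchy_integral_circlepath[OF this, of "- a"] a
  have "((\<lambda>u. H u / (u + a)) has_contour_integral (2 * of_real pi * \<i> * h a)) (circlepath 0 1)"
    by (simp add: H_def)
  then have "((\<lambda>x. H (circlepath 0 1 x) / (circlepath 0 1 x + a) * (2 * pi * \<i> * exp (2 * of_real pi * \<i> * x)))
      has_integral (2 * of_real pi * \<i> * h a)) {0..1}"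
    by (simp add: has_contour_integral vector_derivative_circlepath)
  moreover have "circlepath 0 1 x = cis (2 * pi * x)" "exp (2 * of_real pi * \<i> * complex_of_real x) = cis (2 * pi * x)" for x
    by (simp_all add: circlepath cis_conv_exp mult_ac)
  ultimately have "((\<lambda>x. H (cis (2 * pi * x)) / (cis (2 * pi * x) + a) * (2 * pi * \<i> * cis (2 * pi * x)))
      has_integral (2 * of_real pi * \<i> * h a)) {0..1}"
    by simp
  from has_integral_mult_right[OF this, of "1 / (2 * of_real pi * \<i>)"]
  have "((\<lambda>x. H (cis (2 * pi * x)) * cis (2 * pi * x) / (cis (2 * pi * x) + a)) has_integral h a) (cbox 0 1)"
    by (simp add: mult_ac)
  from has_integral_affinity'[OF this, of 1 "1/2"]
  have "((\<lambda>x. H (cis (2 * pi * (x + 1/2))) * cis (2 * pi * (x + 1/2)) / (cis (2 * pi * (x + 1/2)) + a)) has_integral h a) {-1/2..1/2}"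
    by simp
  moreover have "cis (2 * pi * (x + 1/2)) = - cis (2 * pi * x)" for x
    by (simp add: distrib_left complex_eq_iff)
  ultimately have *: "((\<lambda>x. h (cis (2 * pi * x)) * - cis (2 * pi * x) / (- cis (2 * pi * x) + a)) has_integral h a) {-1/2..1/2}"
    by (simp only: H_def minus_minus)
  moreover have "w * - u / (- u + a) = w * u / (u - a)" for w u
    using minus_divide_divide[of "w * u" "u - a"] by (simp add: algebra_simps)
  ultimately show "((\<lambda>x. h (cis (2 * pi * x)) * cis (2 * pi * x) / (cis (2 * pi * x) - a)) has_integral h a) {-1/2..1/2}"
    by simp
  have "cis (2 * pi * x) - a \<noteq> 0" for x
    using a by (metis eq_iff_diff_eq_0 less_irrefl norm_cis)
  then show "continuous_on UNIV (\<lambda>x. h (cis (2 * pi * x)) * cis (2 * pi * x) / (cis (2 * pi * x) - a))"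
    by (intro continuous_intros continuous_on_cis_compose[OF cont]) (auto simp: cis_conv_exp intro!: continuous_intros)
qed

text \<open>
  This is \<open>1 / (1 - a / z)\<close> on the unit circle, the complex conjugate of the reproducing kernel
  of the Hardy space at \<open>a\<close>. Its Fourier coefficients are the powers of \<open>a\<close>, at the nonpositive
  frequencies.
\<close>
definition cauchy_kernel :: "complex \<Rightarrow> L2_circle" where
  "cauchy_kernel a = L2_of (\<lambda>\<xi>. cis (2 * pi * \<xi>) / (cis (2 * pi * \<xi>) - a))"

lemma square_integrable_cauchy_kernel:
  assumes a: "cmod a < 1" shows "square_integrable (\<lambda>\<xi>. cis (2 * pi * \<xi>) / (cis (2 * pi * \<xi>) - a))"
proof (rule square_integrable_bounded[where K = "1 / (1 - cmod a)"])
  have ne: "cis x - a \<noteq> 0" for x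
    using a by (metis eq_iff_diff_eq_0 less_irrefl norm_cis)
  have "continuous_on UNIV (\<lambda>\<xi>. cis (2 * pi * \<xi>))"
    unfolding cis_conv_exp by (intro continuous_intros)
  then show "(\<lambda>\<xi>. cis (2 * pi * \<xi>) / (cis (2 * pi * \<xi>) - a)) \<in> borel_measurable circle"
    using ne by (intro borel_measurable_circle borel_measurable_continuous_onI continuous_intros) auto
  fix x
  have "1 - cmod a \<le> cmod (cis (2 * pi * x) - a)"
    using norm_triangle_ineq2[of "cis (2 * pi * x)" a] by simp
  then show "cmod (cis (2 * pi * x) / (cis (2 * pi * x) - a)) \<le> 1 / (1 - cmod a)"
    using a by (simp add: norm_divide frac_le)
qed

lemma bounded_multiplier_circle:
  assumes "continuous_on (cball 0 1) m" "\<And>w. cmod w = 1 \<Longrightarrow> cmod (m w) \<le> K"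
  shows "bounded_multiplier (\<lambda>\<xi>. m (cis (2 * pi * \<xi>)))"
  using assms
  by (intro bounded_multiplierI[where K = K] borel_measurable_continuous_onI continuous_on_cis_compose) auto

text \<open>
  The coefficient is the contour integral of \<open>m w * w ^ n / (w - a)\<close>, which Cauchy's formula
  evaluates.
\<close>
lemma coefficient_mult_cauchy_kernel:
  assumes m: "continuous_on (cball 0 1) m" "m holomorphic_on ball 0 1"
    and K: "\<And>w. cmod w = 1 \<Longrightarrow> cmod (m w) \<le> K" and a: "cmod a < 1"
  shows "cinner (mult_op (\<lambda>\<xi>. m (cis (2 * pi * \<xi>))) (cauchy_kernel a)) (character (- int n)) = m a * a ^ n"
proof -
  have "cinner (mult_op (\<lambda>\<xi>. m (cis (2 * pi * \<xi>))) (cauchy_kernel a)) (character (- int n))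
      = (LINT \<xi>|circle. m (cis (2 * pi * \<xi>)) * (cis (2 * pi * \<xi>) / (cis (2 * pi * \<xi>) - a)) * cnj (cis (2 * pi * of_int (- int n) * \<xi>)))"
    unfolding cauchy_kernel_def character_eq
    by (simp only: mult_op_L2_of bounded_multiplier_circle[OF m(1) K] cinner_L2_of square_integrable_cauchy_kernel[OF a]
        square_integrable_mult square_integrable_cis)
  also have "\<dots> = (LINT \<xi>|circle. (m (cis (2 * pi * \<xi>)) * cis (2 * pi * \<xi>) ^ n) * cis (2 * pi * \<xi>) / (cis (2 * pi * \<xi>) - a))"
    by (intro Bochner_Integration.integral_cong) (simp_all add: cis_cnj Complex.DeMoivre mult_ac)
  also have "\<dots> = m a * a ^ n"
    by (rule Cauchy_integral_circle) (use m a in \<open>auto intro!: continuous_intros holomorphic_intros\<close>)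
  finally show ?thesis .
qed

lemma coefficient_cauchy_kernel:
  assumes a: "cmod a < 1"
  shows "cinner (cauchy_kernel a) (character k) = (if k \<le> 0 then a ^ nat (- k) else 0)"
proof (cases "k \<le> 0")
  case True
  have "cinner (mult_op (\<lambda>\<xi>. 1) (cauchy_kernel a)) (character (- int (nat (- k)))) = 1 * a ^ nat (- k)"
    by (rule coefficient_mult_cauchy_kernel[where K = 1]) (use a in auto)
  then show ?thesis using True by simp
next
  case False
  define n where "n = nat k"
  have n: "k = int n" "n \<noteq> 0" using False by (auto simp: n_def)
  let ?h = "\<lambda>w. w ^ n / (1 - cnj a * w)"
  have nz: "1 - cnj a * w \<noteq> 0" if "w \<in> cball 0 1" for w
    using that by (intro one_minus_cnj_mult_nonzero a) auto
  have "cinner (cauchy_kernel a) (character k)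
      = (LINT \<xi>|circle. cis (2 * pi * \<xi>) / (cis (2 * pi * \<xi>) - a) * cnj (cis (2 * pi * of_int k * \<xi>)))"
    unfolding cauchy_kernel_def character_eq
    by (rule cinner_L2_of[OF square_integrable_cauchy_kernel[OF a] square_integrable_cis])
  \<comment> \<open>At a positive frequency, conjugation leads to the Cauchy integral at \<open>0\<close> of a function vanishing there.\<close>
  also have "\<dots> = (LINT \<xi>|circle. cnj (?h (cis (2 * pi * \<xi>)) * cis (2 * pi * \<xi>) / (cis (2 * pi * \<xi>) - 0)))"
  proof (intro Bochner_Integration.integral_cong refl)
    fix \<xi>
    define u where "u = cis (2 * pi * \<xi>)"
    have u: "u \<noteq> 0" "cnj u = 1 / u" by (auto simp: u_def cis_cnj cis_inverse divide_inverse)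
    have "cis (2 * pi * of_int k * \<xi>) = u ^ n" by (simp add: u_def Complex.DeMoivre n mult_ac)
    moreover have "u / (u - a) = 1 / (1 - a / u)" using u(1) by (simp add: field_simps)
    ultimately show "cis (2 * pi * \<xi>) / (cis (2 * pi * \<xi>) - a) * cnj (cis (2 * pi * of_int k * \<xi>))
        = cnj (?h (cis (2 * pi * \<xi>)) * cis (2 * pi * \<xi>) / (cis (2 * pi * \<xi>) - 0))"
      unfolding u_def[symmetric] using u by simp
  qed
  also have "\<dots> = cnj (?h 0)"
    unfolding Bochner_Integration.integral_cnj
    by (intro arg_cong[of _ _ cnj] Cauchy_integral_circle)
      (use nz in \<open>auto intro!: continuous_intros holomorphic_intros\<close>)
  finally show ?thesis using n False by simp
qed

lemma cauchy_kernel_sum_sums: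
  assumes I: "\<And>j. j \<in> I \<Longrightarrow> cmod (z j) < 1"
  shows "(\<lambda>n. (cmod (\<Sum>j\<in>I. c j * z j ^ n))\<^sup>2) sums (norm (\<Sum>j\<in>I. c j *\<^sub>C cauchy_kernel (z j)))\<^sup>2"
proof -
  let ?U = "\<Sum>j\<in>I. c j *\<^sub>C cauchy_kernel (z j)"
  have coeff: "cinner ?U (character k) = (if k \<le> 0 then \<Sum>j\<in>I. c j * z j ^ nat (- k) else 0)" for k
    using I by (simp add: cinner_sum_left cinner_scaleC_left coefficient_cauchy_kernel)
  have "((\<lambda>k. (cmod (cinner ?U (character k)))\<^sup>2) has_sum (norm ?U)\<^sup>2) UNIV"
    by (rule norm_orthonormal_has_sum[OF orthonormal_character character_has_sum])
  also have "?this \<longleftrightarrow> ((\<lambda>k. (cmod (cinner ?U (character k)))\<^sup>2) has_sum (norm ?U)\<^sup>2) (range (\<lambda>n. - int n))"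
  proof (rule has_sum_cong_neutral)
    fix k assume "k \<in> UNIV - range (\<lambda>n. - int n)"
    moreover have "k = - int (nat (- k))" if "k \<le> 0" using that by simp
    ultimately have "\<not> k \<le> 0" by blast
    then show "(cmod (cinner ?U (character k)))\<^sup>2 = 0" by (simp add: coeff)
  qed auto
  also have "\<dots> \<longleftrightarrow> ((\<lambda>n. (cmod (cinner ?U (character (- int n))))\<^sup>2) has_sum (norm ?U)\<^sup>2) UNIV"
    by (subst has_sum_reindex) (auto simp: o_def inj_on_def)
  finally show ?thesis by (intro has_sum_imp_sums) (simp add: coeff)
qed

lemma norm_cauchy_kernel:
  assumes "cmod a < 1" shows "(norm (cauchy_kernel a))\<^sup>2 = 1 / (1 - (cmod a)\<^sup>2)"
proof -
  have "(\<lambda>n. (cmod (\<Sum>j\<in>{0::nat}. 1 * a ^ n))\<^sup>2) sums (norm (\<Sum>j\<in>{0::nat}. 1 *\<^sub>C cauchy_kernel a))\<^sup>2"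
    by (rule cauchy_kernel_sum_sums) (use assms in auto)
  then have "(\<lambda>n. ((cmod a)\<^sup>2) ^ n) sums (norm (cauchy_kernel a))\<^sup>2"
    by (simp add: norm_power power_mult[symmetric] mult.commute)
  moreover have "(\<lambda>n. ((cmod a)\<^sup>2) ^ n) sums (1 / (1 - (cmod a)\<^sup>2))"
    using assms by (intro geometric_sums) (simp add: abs_square_less_1)
  ultimately show ?thesis by (rule sums_unique2)
qed

text \<open>
  Scaling the kernel at each \<open>z j\<close> by \<open>m (z j)\<close> has the same effect as multiplying the whole
  combination by \<open>m\<close> and dropping the positive frequencies. A multiplication operator is bounded by
  the supremum of its symbol on the unit circle, and Bessel's inequality absorbs the truncation.
\<close>
lemma norm_multiplied_kernels_le:
  assumes I: "\<And>j. j \<in> I \<Longrightarrow> cmod (z j) < 1"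
    and m: "continuous_on (cball 0 1) m" "m holomorphic_on ball 0 1"
    and K: "\<And>w. cmod w = 1 \<Longrightarrow> cmod (m w) \<le> K"
  shows "norm (\<Sum>j\<in>I. (m (z j) * c j) *\<^sub>C cauchy_kernel (z j)) \<le> K * norm (\<Sum>j\<in>I. c j *\<^sub>C cauchy_kernel (z j))"
proof -
  let ?U = "\<Sum>j\<in>I. c j *\<^sub>C cauchy_kernel (z j)" and ?m = "\<lambda>\<xi>. m (cis (2 * pi * \<xi>))"
  let ?V = "mult_op ?m ?U"
  have bm: "bounded_multiplier ?m" by (rule bounded_multiplier_circle[OF m(1) K])
  have cl: "bounded_clinear (mult_op ?m)" by (rule bounded_clinear_mult_op[OF bm])
  have V: "cinner ?V (character (- int n)) = (\<Sum>j\<in>I. (m (z j) * c j) * z j ^ n)" for n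
    using cl I coefficient_mult_cauchy_kernel[OF m K]
    by (simp add: bounded_clinear_def linear_sum[OF bounded_linear.linear] cinner_sum_left cinner_scaleC_left mult_ac)
  have o: "orthonormal (\<lambda>n. character (- int n))"
    using orthonormal_character by (auto simp: orthonormal_def)
  have "K \<ge> 0" using K[of 1] norm_ge_zero[of "m 1"] by (simp del: norm_ge_zero)
  have "(norm (\<Sum>j\<in>I. (m (z j) * c j) *\<^sub>C cauchy_kernel (z j)))\<^sup>2 \<le> (norm ?V)\<^sup>2"
  proof -
    have "(\<lambda>n. (cmod (cinner ?V (character (- int n))))\<^sup>2) sums (norm (\<Sum>j\<in>I. (m (z j) * c j) *\<^sub>C cauchy_kernel (z j)))\<^sup>2"
      unfolding V by (rule cauchy_kernel_sum_sums[OF I])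
    then show ?thesis
      unfolding sums_def
      by (rule LIMSEQ_le_const2) (intro exI allI impI bessel_finite[OF o] finite_lessThan)
  qed
  then have "norm (\<Sum>j\<in>I. (m (z j) * c j) *\<^sub>C cauchy_kernel (z j)) \<le> norm ?V"
    by (rule power2_le_imp_le) simp
  also have "\<dots> \<le> K * norm ?U" by (rule norm_mult_op_le[OF bm]) (simp add: K)
  finally show ?thesis .
qed

text \<open>
  The sign of each new vector is chosen so that its cross term with the earlier ones is not
  positive.
\<close>
lemma exists_signs_norm_le:
  fixes v :: "'i \<Rightarrow> 'a::real_inner"
  assumes "finite I"
  shows "\<exists>\<epsilon>. range \<epsilon> \<subseteq> {1, -1} \<and> (norm (\<Sum>j\<in>I. \<epsilon> j *\<^sub>R v j))\<^sup>2 \<le> (\<Sum>j\<in>I. (norm (v j))\<^sup>2)"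
  using assms
proof induction
  case (insert i I)
  then obtain \<epsilon> where \<epsilon>: "range \<epsilon> \<subseteq> {1, -1}" "(norm (\<Sum>j\<in>I. \<epsilon> j *\<^sub>R v j))\<^sup>2 \<le> (\<Sum>j\<in>I. (norm (v j))\<^sup>2)"
    by auto
  define u where "u = (\<Sum>j\<in>I. \<epsilon> j *\<^sub>R v j)"
  define s :: real where "s = (if inner (v i) u \<le> 0 then 1 else -1)"
  have "(\<Sum>j\<in>insert i I. (\<epsilon>(i := s)) j *\<^sub>R v j) = s *\<^sub>R v i + (\<Sum>j\<in>I. (\<epsilon>(i := s)) j *\<^sub>R v j)"
    using insert by simp
  also have "(\<Sum>j\<in>I. (\<epsilon>(i := s)) j *\<^sub>R v j) = u"
    unfolding u_def using insert by (intro sum.cong) auto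
  finally have "(norm (\<Sum>j\<in>insert i I. (\<epsilon>(i := s)) j *\<^sub>R v j))\<^sup>2 = (norm (v i))\<^sup>2 + 2 * s * inner (v i) u + (norm u)\<^sup>2"
    by (simp add: power2_norm_eq_inner inner_add inner_commute s_def)
  also have "\<dots> \<le> (\<Sum>j\<in>insert i I. (norm (v j))\<^sup>2)"
    using insert \<epsilon> by (auto simp: s_def u_def)
  finally show ?case
    using \<epsilon>(1) by (intro exI[of _ "\<epsilon>(i := s)"]) (auto simp: s_def)
qed auto

text \<open>
  The opposite choice of signs.
\<close>
lemma exists_signs_norm_ge:
  fixes v :: "'i \<Rightarrow> 'a::real_inner"
  assumes "finite I"
  shows "\<exists>\<epsilon>. range \<epsilon> \<subseteq> {1, -1} \<and> (\<Sum>j\<in>I. (norm (v j))\<^sup>2) \<le> (norm (\<Sum>j\<in>I. \<epsilon> j *\<^sub>R v j))\<^sup>2"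
  using assms
proof induction
  case (insert i I)
  then obtain \<epsilon> where \<epsilon>: "range \<epsilon> \<subseteq> {1, -1}" "(\<Sum>j\<in>I. (norm (v j))\<^sup>2) \<le> (norm (\<Sum>j\<in>I. \<epsilon> j *\<^sub>R v j))\<^sup>2"
    by auto
  define u where "u = (\<Sum>j\<in>I. \<epsilon> j *\<^sub>R v j)"
  define s :: real where "s = (if inner (v i) u \<ge> 0 then 1 else -1)"
  have "(\<Sum>j\<in>insert i I. (\<epsilon>(i := s)) j *\<^sub>R v j) = s *\<^sub>R v i + (\<Sum>j\<in>I. (\<epsilon>(i := s)) j *\<^sub>R v j)"
    using insert by simp
  also have "(\<Sum>j\<in>I. (\<epsilon>(i := s)) j *\<^sub>R v j) = u"
    unfolding u_def using insert by (intro sum.cong) auto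
  finally have "(norm (\<Sum>j\<in>insert i I. (\<epsilon>(i := s)) j *\<^sub>R v j))\<^sup>2 = (norm (v i))\<^sup>2 + 2 * s * inner (v i) u + (norm u)\<^sup>2"
    by (simp add: power2_norm_eq_inner inner_add inner_commute s_def)
  also have "\<dots> \<ge> (\<Sum>j\<in>insert i I. (norm (v j))\<^sup>2)"
    using insert \<epsilon> by (auto simp: s_def u_def)
  finally show ?case
    using \<epsilon>(1) by (intro exI[of _ "\<epsilon>(i := s)"]) (auto simp: s_def)
qed auto

context finite_separated
begin

lemma signed_kernels_le:
  assumes \<epsilon>: "range \<epsilon> \<subseteq> {1, -1 :: real}"
  shows "norm (\<Sum>j\<in>I. \<epsilon> j *\<^sub>R c j *\<^sub>C cauchy_kernel (z j)) \<le> M * norm (\<Sum>j\<in>I. c j *\<^sub>C cauchy_kernel (z j))"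
proof -
  have "cmod (complex_of_real (\<epsilon> j)) \<le> 1" for j using \<epsilon> by (auto simp: image_subset_iff dest!: spec[of _ j])
  then obtain m where m: "m holomorphic_on ball 0 1" "continuous_on (cball 0 1) m"
    "\<And>j. j \<in> I \<Longrightarrow> m (z j) = complex_of_real (\<epsilon> j)" "\<And>w. cmod w = 1 \<Longrightarrow> cmod (m w) \<le> M"
    by (rule bounded_interpolation[where \<epsilon> = "\<lambda>j. complex_of_real (\<epsilon> j)"]) blast
  show ?thesis
    using norm_multiplied_kernels_le[where c = c, OF disc m(2,1,4)] m(3)
    by (simp add: scaleR_eq_scaleC scaleC_scaleC cong: sum.cong)
qed

text \<open>
  Changing signs of the terms changes the norm by a factor of at most \<open>M\<close>, in both directions,
  and for suitable signs the norm squared lies below, or above, the sum of the squared norms of the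
  terms.
\<close>
lemma Riesz_sequence_kernels:
  defines "S \<equiv> \<lambda>c. (\<Sum>j\<in>I. (cmod (c j))\<^sup>2 / (1 - (cmod (z j))\<^sup>2))"
  shows "S c \<le> M\<^sup>2 * (norm (\<Sum>j\<in>I. c j *\<^sub>C cauchy_kernel (z j)))\<^sup>2" (is ?lower)
    and "(norm (\<Sum>j\<in>I. c j *\<^sub>C cauchy_kernel (z j)))\<^sup>2 \<le> M\<^sup>2 * S c" (is ?upper)
proof -
  define v where "v j = c j *\<^sub>C cauchy_kernel (z j)" for j
  have S: "S c = (\<Sum>j\<in>I. (norm (v j))\<^sup>2)"
    unfolding S_def v_def by (simp add: norm_scaleC power_mult_distrib norm_cauchy_kernel disc)
  have signed: "norm (\<Sum>j\<in>I. \<epsilon> j *\<^sub>R v j) \<le> M * norm (\<Sum>j\<in>I. v j)" if "range \<epsilon> \<subseteq> {1, -1}" for \<epsilon>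
    unfolding v_def by (rule signed_kernels_le[OF that])
  obtain \<epsilon> where "range \<epsilon> \<subseteq> {1, -1}" "S c \<le> (norm (\<Sum>j\<in>I. \<epsilon> j *\<^sub>R v j))\<^sup>2"
    using exists_signs_norm_ge[OF fin, of v] S by auto
  then show ?lower
    using power_mono[OF signed[of \<epsilon>], of 2] by (simp add: power_mult_distrib v_def)
  obtain \<epsilon> where \<epsilon>: "range \<epsilon> \<subseteq> {1, -1}" "(norm (\<Sum>j\<in>I. \<epsilon> j *\<^sub>R v j))\<^sup>2 \<le> S c"
    using exists_signs_norm_le[OF fin, of v] S by auto
  have "\<epsilon> j * \<epsilon> j = 1" for j using \<epsilon>(1) by (auto simp: image_subset_iff dest!: spec[of _ j])
  \<comment> \<open>Applying the same signs twice restores the original combination.\<close>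
  then have "(\<Sum>j\<in>I. v j) = (\<Sum>j\<in>I. \<epsilon> j *\<^sub>R (complex_of_real (\<epsilon> j) * c j) *\<^sub>C cauchy_kernel (z j))"
    by (simp add: v_def scaleR_eq_scaleC scaleC_scaleC flip: of_real_mult mult.assoc)
  then have "norm (\<Sum>j\<in>I. v j) \<le> M * norm (\<Sum>j\<in>I. \<epsilon> j *\<^sub>R v j)"
    using signed_kernels_le[OF \<epsilon>(1), of "\<lambda>j. complex_of_real (\<epsilon> j) * c j"]
    by (simp add: v_def scaleR_eq_scaleC scaleC_scaleC)
  then have "(norm (\<Sum>j\<in>I. v j))\<^sup>2 \<le> M\<^sup>2 * (norm (\<Sum>j\<in>I. \<epsilon> j *\<^sub>R v j))\<^sup>2"
    using power_mono[of _ _ 2] by (fastforce simp: power_mult_distrib)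
  also have "\<dots> \<le> M\<^sup>2 * S c" using \<epsilon>(2) by (intro mult_left_mono) auto
  finally show ?upper by (simp add: v_def)
qed

end


section \<open>Orbits of diagonal operators\<close>

text \<open>
  All factors are at most \<open>1\<close>, so a product over finitely many of them dominates the infinite
  product.
\<close>
lemma uniformly_separated_imp_finite:
  assumes disc: "\<And>j. cmod (z j) < 1" and sep: "uniformly_separated z"
  obtains \<delta> where "\<delta> > 0"
    "\<And>I j. finite I \<Longrightarrow> j \<in> I \<Longrightarrow> \<delta> \<le> (\<Prod>k\<in>I - {j}. pseudo_dist (z j) (z k))"
proof -
  define P where "P j n = (\<Prod>k\<in>{..<n} - {j}. pseudo_dist (z j) (z k))" for j n :: nat
  have x: "0 \<le> pseudo_dist (z j) (z k)" "pseudo_dist (z j) (z k) \<le> 1" for j k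
    by (simp add: pseudo_dist_def) (rule pseudo_dist_le_1[OF disc disc])
  have mono: "(\<Prod>k\<in>B. pseudo_dist (z j) (z k)) \<le> (\<Prod>k\<in>A. pseudo_dist (z j) (z k))"
    if "finite B" "A \<subseteq> B" for A B j
  proof -
    have "(\<Prod>k\<in>B. pseudo_dist (z j) (z k)) = (\<Prod>k\<in>B - A. pseudo_dist (z j) (z k)) * (\<Prod>k\<in>A. pseudo_dist (z j) (z k))"
      using that by (intro prod.subset_diff)
    also have "\<dots> \<le> 1 * (\<Prod>k\<in>A. pseudo_dist (z j) (z k))"
      by (intro mult_right_mono prod_le_1 prod_nonneg) (use x in auto)
    finally show ?thesis by simp
  qed
  have "P j n \<le> P j m" if "m \<le> n" for j m n
    unfolding P_def by (rule mono) (use that in auto)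
  then have dec: "decseq (P j)" for j by (simp add: decseq_def)
  have nonneg: "0 \<le> P j n" for j n unfolding P_def by (intro prod_nonneg) (use x in auto)
  have lim: "P j \<longlonglongrightarrow> lim (P j)" for j
  proof -
    obtain L where "P j \<longlonglongrightarrow> L" by (rule decseq_convergent[OF dec[of j], of 0]) (use nonneg in auto)
    then show ?thesis by (simp add: limI)
  qed
  have lim_nonneg: "0 \<le> lim (P j)" for j
    by (rule LIMSEQ_le_const[OF lim]) (use nonneg in auto)
  define \<delta> where "\<delta> = (INF j. lim (P j))"
  have "\<delta> > 0"
    using sep unfolding uniformly_separated_def \<delta>_def P_def pseudo_dist_def .
  moreover have "\<delta> \<le> (\<Prod>k\<in>I - {j}. pseudo_dist (z j) (z k))" if I: "finite I" "j \<in> I" for I j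
  proof -
    obtain n where n: "I \<subseteq> {..<n}" using finite_nat_iff_bounded[of I] I by auto
    have "\<delta> \<le> lim (P j)"
      unfolding \<delta>_def by (rule cINF_lower) (use lim_nonneg in \<open>auto intro!: bdd_belowI2\<close>)
    also have "\<dots> \<le> P j n" by (rule decseq_ge[OF dec lim])
    also have "\<dots> \<le> (\<Prod>k\<in>I - {j}. pseudo_dist (z j) (z k))"
      unfolding P_def by (rule mono) (use n in auto)
    finally show ?thesis .
  qed
  ultimately show ?thesis by (rule that)
qed

text \<open>
  Finite partial sums are continuous, so the upper bound extends to limits. For the lower bound,
  the upper bound controls the error made by replacing \<open>x\<close> by an approximation \<open>xs k\<close>, and
  \<open>(a + b)\<^sup>2 \<le> 2 * a\<^sup>2 + 2 * b\<^sup>2\<close> costs a factor \<open>2\<close>.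
\<close>
lemma is_frame_dense:
  fixes v :: "nat \<Rightarrow> 'a::complex_inner"
  assumes H: "subspace H" "\<And>n. v n \<in> H"
    and dense: "\<And>x. x \<in> H \<Longrightarrow> \<exists>xs. (\<forall>k. xs k \<in> D) \<and> xs \<longlonglongrightarrow> x" and D: "D \<subseteq> H"
    and AB: "A > 0" "B > 0"
    and frame: "\<And>d. d \<in> D \<Longrightarrow> \<exists>S. (\<lambda>n. (cmod (cinner d (v n)))\<^sup>2) sums S \<and>
        A * (norm d)\<^sup>2 \<le> S \<and> S \<le> B * (norm d)\<^sup>2"
  shows "is_frame H v"
proof -
  define q where "q x n = (cmod (cinner x (v n)))\<^sup>2" for x n
  have partial: "(\<Sum>n<N. q x n) \<le> B * (norm x)\<^sup>2" if x: "x \<in> H" for x N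
  proof -
    obtain xs where xs: "\<And>k. xs k \<in> D" "xs \<longlonglongrightarrow> x" using dense[OF x] by auto
    have "(\<lambda>k. \<Sum>n<N. q (xs k) n) \<longlonglongrightarrow> (\<Sum>n<N. q x n)"
      unfolding q_def
      by (intro tendsto_intros bounded_linear.tendsto[OF bounded_linear_cinner_left] xs)
    moreover have "(\<lambda>k. B * (norm (xs k))\<^sup>2) \<longlonglongrightarrow> B * (norm x)\<^sup>2"
      by (intro tendsto_intros xs)
    moreover have "(\<Sum>n<N. q (xs k) n) \<le> B * (norm (xs k))\<^sup>2" for k
    proof -
      obtain S where S: "q (xs k) sums S" "S \<le> B * (norm (xs k))\<^sup>2"
        using frame[OF xs(1)[of k]] unfolding q_def by auto
      have "(\<Sum>n<N. q (xs k) n) \<le> S"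
        using sum_le_suminf[OF sums_summable[OF S(1)], of "{..<N}"] sums_unique[OF S(1)]
        by (simp add: q_def)
      then show ?thesis using S(2) by linarith
    qed
    ultimately show ?thesis by (intro LIMSEQ_le) auto
  qed
  have summable: "summable (q x)" if "x \<in> H" for x
  proof (rule bounded_imp_summable)
    show "(\<Sum>n\<le>N. q x n) \<le> B * (norm x)\<^sup>2" for N
      using partial[OF that, of "Suc N"] by (simp add: lessThan_Suc_atMost)
  qed (simp add: q_def)
  have upper: "suminf (q x) \<le> B * (norm x)\<^sup>2" if "x \<in> H" for x
    by (rule suminf_le_const[OF summable[OF that] partial[OF that]])
  have lower: "A / 2 * (norm x)\<^sup>2 \<le> suminf (q x)" if x: "x \<in> H" for x
  proof -
    obtain xs where xs: "\<And>k. xs k \<in> D" "xs \<longlonglongrightarrow> x" using dense[OF x] by auto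
    have "A * (norm (xs k))\<^sup>2 \<le> 2 * suminf (q x) + 2 * (B * (norm (xs k - x))\<^sup>2)" for k
    proof -
      have diff: "xs k - x \<in> H" using H x xs D by (intro subspace_diff) auto
      have "A * (norm (xs k))\<^sup>2 \<le> suminf (q (xs k))"
        using frame[OF xs(1)[of k]] sums_unique unfolding q_def by blast
      also have "\<dots> \<le> (\<Sum>n. 2 * q x n + 2 * q (xs k - x) n)"
      proof (rule suminf_le)
        show "q (xs k) n \<le> 2 * q x n + 2 * q (xs k - x) n" for n
          using cmod_add_sq_le[of "cinner x (v n)" "cinner (xs k - x) (v n)"]
          by (simp add: q_def cinner_diff_left)
        show "summable (q (xs k))" using xs(1)[of k] D by (intro summable) auto
        show "summable (\<lambda>n. 2 * q x n + 2 * q (xs k - x) n)"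
          by (intro summable_add summable_mult summable x diff)
      qed
      also have "\<dots> = 2 * suminf (q x) + 2 * suminf (q (xs k - x))"
        by (simp add: suminf_add[symmetric] suminf_mult summable x diff summable_mult)
      also have "\<dots> \<le> 2 * suminf (q x) + 2 * (B * (norm (xs k - x))\<^sup>2)"
        using upper[OF diff] by simp
      finally show ?thesis .
    qed
    moreover have "(\<lambda>k. A * (norm (xs k))\<^sup>2) \<longlonglongrightarrow> A * (norm x)\<^sup>2"
      by (intro tendsto_intros xs)
    moreover have "(\<lambda>k. 2 * suminf (q x) + 2 * (B * (norm (xs k - x))\<^sup>2)) \<longlonglongrightarrow> 2 * suminf (q x) + 2 * (B * (norm (x - x))\<^sup>2)"
      by (intro tendsto_intros xs)
    ultimately have "A * (norm x)\<^sup>2 \<le> 2 * suminf (q x) + 2 * (B * (norm (x - x))\<^sup>2)"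
      by (intro LIMSEQ_le) auto
    then show ?thesis by simp
  qed
  show ?thesis
    unfolding is_frame_def
    using H AB summable upper lower unfolding q_def
    by (intro conjI exI[of _ "A / 2"] exI[of _ B]) auto
qed

lemma orthonormal_reindex: "orthonormal u \<Longrightarrow> inj s \<Longrightarrow> orthonormal (\<lambda>j. u (s j))"
  by (simp add: orthonormal_def inj_eq)

text \<open>
  A diagonal operator with respect to an orthonormal basis of a closed subspace \<open>H\<close>. It is defined
  on the whole space and annihilates the orthogonal complement of \<open>H\<close>.
\<close>
locale diagonal_operator =
  fixes u :: "nat \<Rightarrow> 'a::{complex_inner, banach}" and lam :: "nat \<Rightarrow> complex" and H :: "'a set"
  assumes u: "orthonormal u" and lam: "\<And>j. cmod (lam j) < 1"
    and subspace: "subspace H" and closed: "closed H" and uH: "\<And>c j. c *\<^sub>C u j \<in> H"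
    and expansion: "\<And>g. g \<in> H \<Longrightarrow> ((\<lambda>j. cinner g (u j) *\<^sub>C u j) has_sum g) UNIV"
begin

definition T :: "'a \<Rightarrow> 'a" where "T g = (\<Sum>j. lam j *\<^sub>C cinner g (u j) *\<^sub>C u j)"

lemma H_eqI: "g \<in> H \<Longrightarrow> h \<in> H \<Longrightarrow> (\<And>j. cinner g (u j) = cinner h (u j)) \<Longrightarrow> g = h"
  using expansion[of g] expansion[of h] has_sum_unique by auto

lemma T_has_sum: "((\<lambda>j. (lam j * cinner g (u j)) *\<^sub>C u j) has_sum T g) UNIV"
proof -
  have "(\<lambda>j. (cmod (lam j * cinner g (u j)))\<^sup>2) summable_on UNIV"
  proof (rule summable_on_comparison_test[OF bessel_summable[OF u, of g]])
    fix j
    have "cmod (lam j) * cmod (cinner g (u j)) \<le> cmod (cinner g (u j))"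
      using lam[of j] by (intro mult_left_le_one_le) auto
    then show "(cmod (lam j * cinner g (u j)))\<^sup>2 \<le> (cmod (cinner g (u j)))\<^sup>2"
      unfolding norm_mult by (intro power_mono) auto
  qed auto
  from orthonormal_summable[OF u this]
  have s: "((\<lambda>j. (lam j * cinner g (u j)) *\<^sub>C u j) has_sum (\<Sum>\<^sub>\<infinity>j. (lam j * cinner g (u j)) *\<^sub>C u j)) UNIV"
    by (rule has_sum_infsum)
  moreover have "(\<Sum>\<^sub>\<infinity>j. (lam j * cinner g (u j)) *\<^sub>C u j) = T g"
    using sums_unique[OF has_sum_imp_sums[OF s]] by (simp add: T_def scaleC_scaleC)
  ultimately show ?thesis by simp
qed

lemma T_sums: "(\<lambda>j. lam j *\<^sub>C cinner g (u j) *\<^sub>C u j) sums T g"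
  using has_sum_imp_sums[OF T_has_sum] by (simp add: scaleC_scaleC)

lemma cinner_T: "cinner (T g) (u j) = lam j * cinner g (u j)"
  by (rule cinner_orthonormal_has_sum[OF u T_has_sum])

lemma T_in_H: "T g \<in> H"
  using T_sums[of g] unfolding sums_def
  by (rule closed_sequentially[OF closed, rotated]) (auto intro!: subspace_sum subspace uH simp: scaleC_scaleC)

lemma scaleC_H: "g \<in> H \<Longrightarrow> c *\<^sub>C g \<in> H"
proof -
  assume g: "g \<in> H"
  have "(\<lambda>j. c *\<^sub>C cinner g (u j) *\<^sub>C u j) sums (c *\<^sub>C g)"
    by (rule bounded_linear.sums[OF bounded_linear_scaleC_right has_sum_imp_sums[OF expansion[OF g]]])
  then show ?thesis
    unfolding sums_def
    by (rule closed_sequentially[OF closed, rotated]) (auto intro!: subspace_sum subspace uH simp: scaleC_scaleC)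
qed

lemma bounded_clinear_T: "bounded_clinear T"
proof -
  have add: "T (x + y) = T x + T y" for x y
    by (rule H_eqI) (auto intro: T_in_H subspace_add[OF subspace] simp: cinner_T cinner_add_left distrib_left)
  have sc: "T (c *\<^sub>C x) = c *\<^sub>C T x" for c x
    by (rule H_eqI) (auto intro: T_in_H scaleC_H simp: cinner_T cinner_scaleC_left)
  have "norm (T x) \<le> norm x" for x
  proof -
    have "(norm (T x))\<^sup>2 \<le> (norm x)\<^sup>2"
    proof (rule has_sum_le_finite_sums[OF norm_orthonormal_has_sum[OF u T_has_sum]])
      fix F :: "nat set" assume F: "finite F"
      have "(\<Sum>j\<in>F. (cmod (lam j * cinner x (u j)))\<^sup>2) \<le> (\<Sum>j\<in>F. (cmod (cinner x (u j)))\<^sup>2)"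
        using lam by (intro sum_mono power_mono) (auto simp: norm_mult less_imp_le intro!: mult_left_le_one_le)
      also have "\<dots> \<le> (norm x)\<^sup>2" by (rule bessel_finite[OF u F])
      finally show "(\<Sum>j\<in>F. (cmod (lam j * cinner x (u j)))\<^sup>2) \<le> (norm x)\<^sup>2" .
    qed
    then show ?thesis by (rule power2_le_imp_le) simp
  qed
  then show ?thesis
    unfolding bounded_clinear_def
    by (auto simp: add sc scaleR_eq_scaleC intro!: bounded_linear_intro[where K = 1])
qed

lemma cinner_T_power: "cinner ((T ^^ n) g) (u j) = lam j ^ n * cinner g (u j)"
  by (induction n) (auto simp: cinner_T)

text \<open>
  Pairing a finite combination of basis vectors with the orbit produces power sums of the
  \<open>lam j\<close>. These are the Fourier coefficients of a combination of Cauchy kernels, whose norm is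
  comparable to that of the given combination because the kernels form a Riesz sequence and because
  \<open>(cmod (cinner a (u j)))\<^sup>2\<close> compensates for their norms \<open>1 / sqrt (1 - (cmod (lam j))\<^sup>2)\<close>.
\<close>
lemma is_frame_T_orbit:
  assumes sep: "uniformly_separated lam" and a: "a \<in> H"
    and cmp: "comparable (\<lambda>j. (cmod (cinner a (u j)))\<^sup>2) (\<lambda>j. 1 - (cmod (lam j))\<^sup>2)"
  shows "is_frame H (\<lambda>n. (T ^^ n) a)"
proof -
  obtain \<delta> where \<delta>: "\<delta> > 0"
    "\<And>I j. finite I \<Longrightarrow> j \<in> I \<Longrightarrow> \<delta> \<le> (\<Prod>k\<in>I - {j}. pseudo_dist (lam j) (lam k))"
    using uniformly_separated_imp_finite[OF lam sep] by metis
  obtain c C where c: "c > 0" "\<And>j. c * (cmod (cinner a (u j)))\<^sup>2 \<le> 1 - (cmod (lam j))\<^sup>2"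
    and C: "C > 0" "\<And>j. 1 - (cmod (lam j))\<^sup>2 \<le> C * (cmod (cinner a (u j)))\<^sup>2"
    using cmp unfolding comparable_def by blast
  define D where "D = {\<Sum>j\<in>I. x j *\<^sub>C u j | I x. finite I}"
  define K where "K = finite_separated.M \<delta>"
  have fs: "finite_separated lam I \<delta>" if "finite I" for I
    using \<delta> that lam by unfold_locales auto
  have K: "K > 0" unfolding K_def by (rule finite_separated.M_pos[OF fs[of "{}"]]) simp
  have h: "0 < 1 - (cmod (lam j))\<^sup>2" for j using lam[of j] by (simp add: abs_square_less_1)
  show ?thesis
  proof (rule is_frame_dense[OF subspace])
    show "(T ^^ n) a \<in> H" for n
      using a T_in_H by (cases n) auto
    show "D \<subseteq> H" by (auto simp: D_def intro!: subspace_sum subspace uH)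
    show "\<exists>xs. (\<forall>k. xs k \<in> D) \<and> xs \<longlonglongrightarrow> x" if "x \<in> H" for x
    proof (intro exI conjI allI)
      show "(\<lambda>k. \<Sum>j<k. cinner x (u j) *\<^sub>C u j) \<longlonglongrightarrow> x"
        using has_sum_imp_sums[OF expansion[OF that]] by (simp add: sums_def)
      show "(\<Sum>j<k. cinner x (u j) *\<^sub>C u j) \<in> D" for k
        unfolding D_def mem_Collect_eq
        by (intro exI[of _ "{..<k}"] exI[of _ "\<lambda>j. cinner x (u j)"]) simp
    qed
    show "1 / (C * K\<^sup>2) > 0" "K\<^sup>2 / c > 0" using K c(1) C(1) by auto
    fix d assume "d \<in> D"
    then obtain I x where I: "finite I" and d: "d = (\<Sum>j\<in>I. x j *\<^sub>C u j)" by (auto simp: D_def)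
    interpret finite_separated lam I \<delta> by (rule fs[OF I])
    let ?y = "\<lambda>j. cnj (x j) * cinner a (u j)"
    let ?S = "(norm (\<Sum>j\<in>I. ?y j *\<^sub>C cauchy_kernel (lam j)))\<^sup>2"
    have "cmod (cinner d ((T ^^ n) a)) = cmod (\<Sum>j\<in>I. ?y j * lam j ^ n)" for n
    proof -
      have "cinner d ((T ^^ n) a) = cnj (cinner ((T ^^ n) a) d)" by (rule cinner_commute)
      also have "cinner ((T ^^ n) a) d = (\<Sum>j\<in>I. ?y j * lam j ^ n)"
        by (simp add: d cinner_sum_right cinner_scaleC_right cinner_T_power mult_ac)
      finally show ?thesis by (simp only: complex_mod_cnj)
    qed
    then have orbit_sums: "(\<lambda>n. (cmod (cinner d ((T ^^ n) a)))\<^sup>2) sums ?S"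
      using cauchy_kernel_sum_sums[of I lam ?y] lam by simp
    have norm_d: "(norm d)\<^sup>2 = (\<Sum>j\<in>I. (cmod (x j))\<^sup>2)"
      unfolding d by (rule norm_orthonormal_sum[OF u I])
    have weight: "(cmod (x j))\<^sup>2 / C \<le> (cmod (?y j))\<^sup>2 / (1 - (cmod (lam j))\<^sup>2)"
      "(cmod (?y j))\<^sup>2 / (1 - (cmod (lam j))\<^sup>2) \<le> (cmod (x j))\<^sup>2 / c" for j
    proof -
      have "(cmod (x j))\<^sup>2 * (1 - (cmod (lam j))\<^sup>2) \<le> (cmod (x j))\<^sup>2 * (C * (cmod (cinner a (u j)))\<^sup>2)"
        "(cmod (x j))\<^sup>2 * (c * (cmod (cinner a (u j)))\<^sup>2) \<le> (cmod (x j))\<^sup>2 * (1 - (cmod (lam j))\<^sup>2)"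
        using c(2)[of j] C(2)[of j] by (intro mult_left_mono; simp)+
      then show "(cmod (x j))\<^sup>2 / C \<le> (cmod (?y j))\<^sup>2 / (1 - (cmod (lam j))\<^sup>2)"
        "(cmod (?y j))\<^sup>2 / (1 - (cmod (lam j))\<^sup>2) \<le> (cmod (x j))\<^sup>2 / c"
        using h[of j] c(1) C(1) by (simp_all add: norm_mult power_mult_distrib divide_simps mult_ac)
    qed
    have "1 / (C * K\<^sup>2) * (norm d)\<^sup>2 = (\<Sum>j\<in>I. (cmod (x j))\<^sup>2 / C) / K\<^sup>2"
      by (simp add: norm_d sum_divide_distrib)
    also have "\<dots> \<le> (\<Sum>j\<in>I. (cmod (?y j))\<^sup>2 / (1 - (cmod (lam j))\<^sup>2)) / K\<^sup>2"
      by (intro divide_right_mono sum_mono weight) simp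
    also have "\<dots> \<le> ?S"
      using Riesz_sequence_kernels(1)[of ?y] K unfolding K_def by (simp add: field_simps)
    finally have lower: "1 / (C * K\<^sup>2) * (norm d)\<^sup>2 \<le> ?S" .
    have upper: "?S \<le> K\<^sup>2 / c * (norm d)\<^sup>2"
    proof -
      have "?S \<le> K\<^sup>2 * (\<Sum>j\<in>I. (cmod (?y j))\<^sup>2 / (1 - (cmod (lam j))\<^sup>2))"
        unfolding K_def by (rule Riesz_sequence_kernels(2))
      also have "\<dots> \<le> K\<^sup>2 * (\<Sum>j\<in>I. (cmod (x j))\<^sup>2 / c)"
        by (intro mult_left_mono sum_mono weight) simp
      also have "\<dots> = K\<^sup>2 / c * (norm d)\<^sup>2"
        by (simp add: norm_d flip: sum_divide_distrib)
      finally show ?thesis .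
    qed
    from orbit_sums lower upper show "\<exists>S. (\<lambda>n. (cmod (cinner d ((T ^^ n) a)))\<^sup>2) sums S \<and>
        1 / (C * K\<^sup>2) * (norm d)\<^sup>2 \<le> S \<and> S \<le> K\<^sup>2 / c * (norm d)\<^sup>2" by blast
  qed
qed

end

section \<open>Sampling and frames in the Graph Paley--Wiener space\<close>

lemma ell2_apply_eq: "ell2_apply f k = cinner (fourier f) (character k)"
  by (simp add: cinner_fourier_character)

lemma bounded_linear_ell2_apply: "bounded_linear (\<lambda>f. ell2_apply f k)"
  unfolding ell2_apply_eq
  using bounded_linear_compose[OF bounded_linear_cinner_left, of fourier] bounded_clinear_fourier
  by (auto simp: bounded_clinear_def)

theorem theorem3p10:
  fixes l :: nat
    and lam :: "nat \<Rightarrow> complex"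
    and s :: "nat \<Rightarrow> int"
    and e :: "nat \<Rightarrow> L2_circle"
    and T :: "L2_circle \<Rightarrow> L2_circle"
    and a :: L2_circle
    and R :: "ell2 \<Rightarrow> ell2"
    and f0 :: ell2
  assumes "l \<ge> 1"
    and "\<And>j. cmod (lam j) < 1"
    and "uniformly_separated lam"
    and "bij s"
    and "e = (\<lambda>j. band_basis l (s j))"
    and "T = (\<lambda>g. \<Sum>j. lam j *\<^sub>C cinner g (e j) *\<^sub>C e j)"
    and "a \<in> L2_on (band l)"
    and "comparable (\<lambda>j. (cmod (cinner a (e j)))\<^sup>2) (\<lambda>j. 1 - (cmod (lam j))\<^sup>2)"
    and "R = inv fourier \<circ> T \<circ> fourier"
    and "f0 = inv fourier a"
  shows "(bounded_clinear R \<and> R ` GPW (band_limit l) \<subseteq> GPW (band_limit l)) \<and>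
    (\<forall>f\<in>GPW (band_limit l).
       let h = (\<lambda>j k. lam j * ell2_apply f (int l * s j) *
                  complex_of_real (sinc (real_of_int k / real l - real_of_int (s j))))
       in (\<forall>j. square_summable (h j)) \<and>
          (\<lambda>j. ell2_of (h j)) sums R f \<and>
          (\<forall>k. (\<lambda>j. h j k) sums ell2_apply (R f) k)) \<and>
    is_frame (GPW (band_limit l)) (\<lambda>n. (R ^^ n) f0)"
proof -
  note l = assms(1)
  interpret D: diagonal_operator e lam "L2_on (band l)"
  proof
    show "orthonormal e"
      unfolding assms(5) by (rule orthonormal_reindex[OF orthonormal_band_basis[OF l] bij_is_inj[OF assms(4)]])
    show "((\<lambda>j. cinner g (e j) *\<^sub>C e j) has_sum g) UNIV" if "g \<in> L2_on (band l)" for g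
      using band_basis_has_sum[OF l that]
        has_sum_reindex_bij_betw[OF assms(4), of "\<lambda>m. cinner g (band_basis l m) *\<^sub>C band_basis l m"]
      by (simp add: assms(5))
  qed (auto simp: assms(2,5) intro: subspace_L2_on closed_L2_on scaleC_in_L2_on band_basis_in_L2_on)
  have T: "T = D.T" unfolding assms(6) D.T_def[abs_def] ..
  have R: "R f = inv fourier (D.T (fourier f))" for f by (simp add: assms(9) T)
  have R_clinear: "bounded_clinear R"
    unfolding R[abs_def]
    by (rule bounded_clinear_compose[OF bounded_clinear_inv_fourier
          bounded_clinear_compose[OF D.bounded_clinear_T bounded_clinear_fourier]])
  have R_GPW: "R f \<in> GPW (band_limit l)" for f
    by (simp add: R GPW_eq[OF l] D.T_in_H)
  have sampling: "(\<forall>j. square_summable (h j)) \<and> (\<lambda>j. ell2_of (h j)) sums R f \<and>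
      (\<forall>k. (\<lambda>j. h j k) sums ell2_apply (R f) k)"
    if f: "f \<in> GPW (band_limit l)" and h: "h = (\<lambda>j k. lam j * ell2_apply f (int l * s j) *
                  complex_of_real (sinc (real_of_int k / real l - real_of_int (s j))))" for f h
  proof -
    have F: "fourier f \<in> L2_on (band l)" using f GPW_eq[OF l] by simp
    have eq: "h j = ell2_apply (inv fourier (lam j *\<^sub>C cinner (fourier f) (e j) *\<^sub>C e j))" for j
    proof
      fix k
      have "complex_of_real (sqrt (real l)) * complex_of_real (x / sqrt (real l)) = complex_of_real x" for x
        unfolding of_real_mult[symmetric] using l by simp
      then show "h j k = ell2_apply (inv fourier (lam j *\<^sub>C cinner (fourier f) (e j) *\<^sub>C e j)) k"
        by (simp add: h ell2_apply_inv_fourier cinner_scaleC_left assms(5) cinner_band_basis[OF F]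
            cinner_fourier_character cinner_band_basis_character[OF l] mult_ac del: of_real_divide)
    qed
    have sums: "(\<lambda>j. inv fourier (lam j *\<^sub>C cinner (fourier f) (e j) *\<^sub>C e j)) sums R f"
      unfolding R using bounded_clinear_inv_fourier
      by (intro bounded_linear.sums[OF _ D.T_sums]) (simp add: bounded_clinear_def)
    from bounded_linear.sums[OF bounded_linear_ell2_apply this]
    show ?thesis using sums by (simp add: eq square_summable_ell2_apply ell2_apply_inverse)
  qed
  have orbit: "fourier ((R ^^ n) f0) = (D.T ^^ n) a" for n
    by (induction n) (simp_all add: assms(10) R)
  have "is_frame (GPW (band_limit l)) (\<lambda>n. (R ^^ n) f0)"
  proof -
    have "is_frame (L2_on (band l)) (\<lambda>n. (D.T ^^ n) a)"
      by (rule D.is_frame_T_orbit[OF assms(3,7,8)])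
    moreover have "cinner f ((R ^^ n) f0) = cinner (fourier f) ((D.T ^^ n) a)" for f n
      using cinner_fourier[of f "(R ^^ n) f0"] by (simp add: orbit)
    ultimately show ?thesis
      unfolding is_frame_def
      by (simp add: GPW_eq[OF l] orbit Ball_def) (metis norm_fourier)
  qed
  then show ?thesis using R_clinear R_GPW sampling unfolding Let_def by blast
qed

end
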